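(* Let $\mathfrak{S}=(M\xleftarrow{\pi}L\xhookrightarrow{\iota}N)$ be a linked $\infty$-category with exit path $\infty$-category $\mathbf{EX}=\mathbf{EX}(\mathfrak{S})$. 1. The objects of $\mathbf{EX}(\mathfrak{S})$ are those of $M$ and $N$. 2. The $\infty$-categories $M$ and $N$ are full sub-$\infty$-categories of $\mathbf{EX}(\mathfrak{S})$. 3. There are no morphisms in $\mathbf{EX}(\mathfrak{S})$ from (objects of) $N$ to (objects of) $M$. 4. For $p\in M$ and $q\in N$, there is an equivalence $\mathrm{Hom}_{\mathbf{EX}(\mathfrak{S})}(p,q)\simeq\mathbf{P}_{L_p,q}$, where $\mathbf{P}_{L_p,q}$ is the space of morphisms in $N$ that start in the embedded fibre $\iota(L_p)$, $L_p=\{p\}\times_M L$, and end in $q$. 5. There is an isomorphism of simplicial sets $(M\downarrow N)^{\mathbf{EX}}\cong(L\downarrow N)^{N}$. 6. There is a constant exit loop inclusion $\Box\colon L\hookrightarrow(M\downarrow N)^{\mathbf{EX}}$. 7. If $\mathfrak{S}$ is a linked $\infty$-groupoid, then $\Box$ is an equivalence $L\simeq(M\downarrow N)^{\mathbf{EX}}$.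
   Context: An $\infty$-category is a quasi-category; an $\infty$-groupoid is a Kan complex; a cofibration of simplicial sets is a monomorphism; a right fibration has the right lifting property against $\Lambda^n_i\subset\Delta[n]$, $0<i\le n$. A linked $\infty$-category (resp. linked $\infty$-groupoid) is a span $M\xleftarrow{\pi}L\xrightarrow{\iota}N$ of $\infty$-categories (resp. $\infty$-groupoids) with $\pi$ a right fibration and $\iota$ a cofibration. Exit path $\infty$-category: $\mathbf{EX}(\mathfrak{S})$ is the simplicial set with $\mathbf{EX}_0=M_0\amalg N_0$ and, for $k\ge1$, $\mathbf{EX}_k=M_k\amalg \mathbf{P}^\Delta_{k-1}\amalg N_k$, where $\mathbf{P}^\Delta_{k-1}$ is the set of pairs $(\gamma,j)$ with $\gamma\in N_k$, $j\in\{1,\dots,k\}$ and $\gamma|_{0,\dots,j-1}\in\iota(L_{j-1})$ (exit $k$-paths of index $j$). $M$ and $N$ are simplicial subsets, and for $\alpha\colon[m]\to[k]$: if $\alpha(i)<j$ for all $i$ then $\alpha^*(\gamma,j)=\pi(\iota^{-1}(\alpha^*\gamma))\in M_m$; if $\alpha(0)\ge j$ then $\alpha^*(\gamma,j)=\alpha^*\gamma\in N_m$; otherwise $\alpha^*(\gamma,j)=(\alpha^*\gamma,j')$ with $j'=\min\{i:\alpha(i)\ge j\}$. It is an $\infty$-category. For maps $A,B\to C$ of simplicial sets, $(A\downarrow B)^C=A\times_{C^{\Delta\{0\}}}C^{\Delta[1]}\times_{C^{\Delta\{1\}}}B$. In particular $\mathbf{P}_{L_p,q}=(L_p\downarrow\{q\})^N$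 (formed using $\iota$). The map $\Box$: for $1\le j\le n+1$ let $\mathcal{S}_j\colon\Delta[n+1]\hookrightarrow\Delta[1]\times\Delta[n]$ be induced by the poset map $i\mapsto(0,i)$ for $i<j$, $i\mapsto(1,i-1)$ for $i\ge j$. For $b\in L_n$, $\Box(b)\colon\Delta[1]\times\Delta[n]\to\mathbf{EX}$ is the map whose restriction along $\mathcal{S}_j$ is the exit $(n+1)$-path $(s_{j-1}\iota(b),j)$ for every $j$; its restriction to $\{0\}\times\Delta[n]$ is $\pi(b)$ and to $\{1\}\times\Delta[n]$ is $\iota(b)$. *)

theory Defs
  imports Main "HOL-Library.FuncSet"
begin

section \<open>Simplicial sets\<close>

text \<open>
  A map of finite ordinals from \<open>[m]\<close> to \<open>[k]\<close> is represented by a function on \<open>nat\<close> of which only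
  the values on \<open>{..m}\<close> matter; accordingly the action of a simplicial set on such functions is
  required to depend on these values only (\<open>pull_cong\<close> below).
\<close>

definition ord_maps :: "nat \<Rightarrow> nat \<Rightarrow> (nat \<Rightarrow> nat) set" where
  "ord_maps m k = {\<alpha>. \<alpha> \<in> {..m} \<rightarrow> {..k} \<and> mono_on {..m} \<alpha>}"

definition coface :: "nat \<Rightarrow> nat \<Rightarrow> nat" where
  "coface i t = (if t < i then t else Suc t)"

definition codegen :: "nat \<Rightarrow> nat \<Rightarrow> nat" where
  "codegen i t = (if t \<le> i then t else t - 1)"

text \<open>\<open>pull X m k \<alpha>\<close> is \<open>\<alpha>\<^sup>*\<close>, from \<open>k\<close>-simplices to \<open>m\<close>-simplices.\<close>

record 'a sset =
  simplices :: "nat \<Rightarrow> 'a set"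
  pull :: "nat \<Rightarrow> nat \<Rightarrow> (nat \<Rightarrow> nat) \<Rightarrow> 'a \<Rightarrow> 'a"

locale simplicial_set =
  fixes X :: "'a sset"
  assumes pull_closed:
      "\<And>m k \<alpha> x. \<alpha> \<in> ord_maps m k \<Longrightarrow> x \<in> simplices X k \<Longrightarrow> pull X m k \<alpha> x \<in> simplices X m"
    and pull_id: "\<And>k x. x \<in> simplices X k \<Longrightarrow> pull X k k id x = x"
    and pull_comp: "\<And>l m k \<beta> \<alpha> x. \<beta> \<in> ord_maps l m \<Longrightarrow> \<alpha> \<in> ord_maps m k \<Longrightarrow> x \<in> simplices X k \<Longrightarrow>
      pull X l k (\<alpha> \<circ> \<beta>) x = pull X l m \<beta> (pull X m k \<alpha> x)"
    and pull_cong: "\<And>m k \<alpha> \<beta> x. \<alpha> \<in> ord_maps m k \<Longrightarrow> x \<in> simplices X k \<Longrightarrow>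
      (\<And>i. i \<le> m \<Longrightarrow> \<alpha> i = \<beta> i) \<Longrightarrow> pull X m k \<alpha> x = pull X m k \<beta> x"

definition vertex :: "'a sset \<Rightarrow> nat \<Rightarrow> nat \<Rightarrow> 'a \<Rightarrow> 'a" where
  "vertex X k v x = pull X 0 k (\<lambda>_. v) x"

definition face :: "'a sset \<Rightarrow> nat \<Rightarrow> nat \<Rightarrow> 'a \<Rightarrow> 'a" where
  "face X k i x = pull X (k - 1) k (coface i) x"

definition degen :: "'a sset \<Rightarrow> nat \<Rightarrow> nat \<Rightarrow> 'a \<Rightarrow> 'a" where
  "degen X k i x = pull X (Suc k) k (codegen i) x"

definition smap :: "(nat \<Rightarrow> 'a \<Rightarrow> 'b) \<Rightarrow> 'a sset \<Rightarrow> 'b sset \<Rightarrow> bool" where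
  "smap f X Y \<longleftrightarrow> (\<forall>k. f k \<in> simplices X k \<rightarrow> simplices Y k) \<and>
    (\<forall>m k. \<forall>\<alpha>\<in>ord_maps m k. \<forall>x\<in>simplices X k. f m (pull X m k \<alpha> x) = pull Y m k \<alpha> (f k x))"

text \<open>The set of maps from \<open>X\<close> to \<open>Y\<close>: each map has a unique extensional representative.\<close>

definition smaps :: "'a sset \<Rightarrow> 'b sset \<Rightarrow> (nat \<Rightarrow> 'a \<Rightarrow> 'b) set" where
  "smaps X Y = {f. smap f X Y \<and> (\<forall>k. f k \<in> extensional (simplices X k))}"

definition smono :: "(nat \<Rightarrow> 'a \<Rightarrow> 'b) \<Rightarrow> 'a sset \<Rightarrow> 'b sset \<Rightarrow> bool" where
  "smono f X Y \<longleftrightarrow> smap f X Y \<and> (\<forall>k. inj_on (f k) (simplices X k))"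

definition siso :: "(nat \<Rightarrow> 'a \<Rightarrow> 'b) \<Rightarrow> 'a sset \<Rightarrow> 'b sset \<Rightarrow> bool" where
  "siso f X Y \<longleftrightarrow> smap f X Y \<and> (\<forall>k. bij_betw (f k) (simplices X k) (simplices Y k))"

definition std_simplex :: "nat \<Rightarrow> (nat \<Rightarrow> nat) sset" where
  "std_simplex n =
    \<lparr>simplices = (\<lambda>k. {\<tau>. \<tau> \<in> {..k} \<rightarrow>\<^sub>E {..n} \<and> mono_on {..k} \<tau>}),
     pull = (\<lambda>m k \<alpha> \<tau>. restrict (\<tau> \<circ> \<alpha>) {..m})\<rparr>"

definition horn :: "nat \<Rightarrow> nat \<Rightarrow> (nat \<Rightarrow> nat) sset" where
  "horn n i =
    \<lparr>simplices = (\<lambda>k. {\<tau> \<in> simplices (std_simplex n) k. \<exists>v\<le>n. v \<noteq> i \<and> v \<notin> \<tau> ` {..k}}),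
     pull = pull (std_simplex n)\<rparr>"

definition sprod :: "'a sset \<Rightarrow> 'b sset \<Rightarrow> ('a \<times> 'b) sset" where
  "sprod X Y =
    \<lparr>simplices = (\<lambda>k. simplices X k \<times> simplices Y k),
     pull = (\<lambda>m k \<alpha> (x, y). (pull X m k \<alpha> x, pull Y m k \<alpha> y))\<rparr>"

text \<open>The fibre product of \<open>f\<close> on \<open>A\<close> and \<open>g\<close> on \<open>B\<close> over their common target.\<close>

definition fibre_prod ::
    "'a sset \<Rightarrow> (nat \<Rightarrow> 'a \<Rightarrow> 'c) \<Rightarrow> (nat \<Rightarrow> 'b \<Rightarrow> 'c) \<Rightarrow> 'b sset \<Rightarrow> ('a \<times> 'b) sset" where
  "fibre_prod A f g B =
    \<lparr>simplices = (\<lambda>k. {(a, b) \<in> simplices A k \<times> simplices B k. f k a = g k b}),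
     pull = pull (sprod A B)\<rparr>"

text \<open>The mapping space \<open>C\<^sup>K\<close>, also written \<open>Fun(K, C)\<close>: its \<open>n\<close>-simplices are the maps
  \<open>K \<times> \<Delta>[n] \<rightarrow> C\<close>.\<close>

definition map_space :: "'a sset \<Rightarrow> 'c sset \<Rightarrow> (nat \<Rightarrow> 'a \<times> (nat \<Rightarrow> nat) \<Rightarrow> 'c) sset" where
  "map_space K C =
    \<lparr>simplices = (\<lambda>n. smaps (sprod K (std_simplex n)) C),
     pull = (\<lambda>m n \<alpha> h k. restrict (\<lambda>(x, \<tau>). h k (x, restrict (\<alpha> \<circ> \<tau>) {..k}))
                           (simplices (sprod K (std_simplex m)) k))\<rparr>"

text \<open>The sub-simplicial set \<open>{x}\<close> generated by a vertex \<open>x\<close>.\<close>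

definition spoint :: "'a sset \<Rightarrow> 'a \<Rightarrow> 'a sset" where
  "spoint X x = \<lparr>simplices = (\<lambda>k. {pull X k 0 (\<lambda>_. 0) x}), pull = pull X\<rparr>"

text \<open>Restriction \<open>C\<^bsup>\<Delta>[1]\<^esup> \<rightarrow> C\<^bsup>\<Delta>{e}\<^esup> = C\<close> for \<open>e = 0, 1\<close>; a map \<open>\<Delta>{e} \<times> \<Delta>[n] \<rightarrow> C\<close> is identified with its
  value on the nondegenerate \<open>n\<close>-simplex.\<close>

definition ev_end :: "nat \<Rightarrow> nat \<Rightarrow> (nat \<Rightarrow> (nat \<Rightarrow> nat) \<times> (nat \<Rightarrow> nat) \<Rightarrow> 'c) \<Rightarrow> 'c" where
  "ev_end e n h = h n (restrict (\<lambda>_. e) {..n}, restrict id {..n})"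

text \<open>\<open>comma A f B g C\<close> is \<open>(A \<down> B)\<^sup>C\<close> for \<open>f\<close> and \<open>g\<close> maps from \<open>A\<close> and \<open>B\<close> to \<open>C\<close>; its simplices
  are the triples \<open>(a, h, b)\<close> with \<open>h\<close> starting at \<open>f a\<close> and ending at \<open>g b\<close>.\<close>

definition comma ::
    "'a sset \<Rightarrow> (nat \<Rightarrow> 'a \<Rightarrow> 'c) \<Rightarrow> 'b sset \<Rightarrow> (nat \<Rightarrow> 'b \<Rightarrow> 'c) \<Rightarrow> 'c sset
      \<Rightarrow> ('a \<times> (nat \<Rightarrow> (nat \<Rightarrow> nat) \<times> (nat \<Rightarrow> nat) \<Rightarrow> 'c) \<times> 'b) sset" where
  "comma A f B g C =
    fibre_prod A f (\<lambda>n (h, b). ev_end 0 n h)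
      (fibre_prod (map_space (std_simplex 1) C) (ev_end 1) g B)"

definition hom_space ::
    "'c sset \<Rightarrow> 'c \<Rightarrow> 'c \<Rightarrow> ('c \<times> (nat \<Rightarrow> (nat \<Rightarrow> nat) \<times> (nat \<Rightarrow> nat) \<Rightarrow> 'c) \<times> 'c) sset" where
  "hom_space C x y = comma (spoint C x) (\<lambda>_. id) (spoint C y) (\<lambda>_. id) C"

section \<open>Quasi-categories\<close>

definition fills_horn :: "'a sset \<Rightarrow> nat \<Rightarrow> nat \<Rightarrow> bool" where
  "fills_horn X n i \<longleftrightarrow> (\<forall>u. smap u (horn n i) X \<longrightarrow>
    (\<exists>w. smap w (std_simplex n) X \<and> (\<forall>k. \<forall>\<tau>\<in>simplices (horn n i) k. w k \<tau> = u k \<tau>)))"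

definition lifts_horn :: "(nat \<Rightarrow> 'a \<Rightarrow> 'b) \<Rightarrow> 'a sset \<Rightarrow> 'b sset \<Rightarrow> nat \<Rightarrow> nat \<Rightarrow> bool" where
  "lifts_horn p X Y n i \<longleftrightarrow> (\<forall>u v. smap u (horn n i) X \<and> smap v (std_simplex n) Y \<and>
      (\<forall>k. \<forall>\<tau>\<in>simplices (horn n i) k. p k (u k \<tau>) = v k \<tau>) \<longrightarrow>
    (\<exists>w. smap w (std_simplex n) X \<and>
      (\<forall>k. \<forall>\<tau>\<in>simplices (horn n i) k. w k \<tau> = u k \<tau>) \<and>
      (\<forall>k. \<forall>\<tau>\<in>simplices (std_simplex n) k. p k (w k \<tau>) = v k \<tau>)))"

definition quasi_category :: "'a sset \<Rightarrow> bool" where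
  "quasi_category X \<longleftrightarrow> simplicial_set X \<and> (\<forall>n i. 0 < i \<and> i < n \<longrightarrow> fills_horn X n i)"

definition kan_complex :: "'a sset \<Rightarrow> bool" where
  "kan_complex X \<longleftrightarrow> simplicial_set X \<and> (\<forall>n i. 1 \<le> n \<and> i \<le> n \<longrightarrow> fills_horn X n i)"

definition right_fibration :: "(nat \<Rightarrow> 'a \<Rightarrow> 'b) \<Rightarrow> 'a sset \<Rightarrow> 'b sset \<Rightarrow> bool" where
  "right_fibration p X Y \<longleftrightarrow> smap p X Y \<and> (\<forall>n i. 0 < i \<and> i \<le> n \<longrightarrow> lifts_horn p X Y n i)"

text \<open>\<open>i\<close> identifies \<open>S\<close> with a quasi-category that is the simplicial subset of \<open>X\<close> of all
  simplices whose vertices lie in \<open>S\<close>.\<close>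

definition full_subcategory :: "(nat \<Rightarrow> 'a \<Rightarrow> 'b) \<Rightarrow> 'a sset \<Rightarrow> 'b sset \<Rightarrow> bool" where
  "full_subcategory i S X \<longleftrightarrow> simplicial_set X \<and> quasi_category S \<and> smono i S X \<and>
    (\<forall>k. \<forall>x\<in>simplices X k.
      (\<forall>v\<le>k. vertex X k v x \<in> i 0 ` simplices S 0) \<longrightarrow> x \<in> i k ` simplices S k)"

text \<open>Objects \<open>x\<close>, \<open>y\<close> of \<open>C\<close> are isomorphic: there are \<open>u\<close> from \<open>x\<close> to \<open>y\<close> and \<open>v\<close> from \<open>y\<close> to \<open>x\<close>,
  with \<open>2\<close>-simplices exhibiting the identities as compositions of \<open>u\<close> and \<open>v\<close>.\<close>

definition isomorphic_in :: "'c sset \<Rightarrow> 'c \<Rightarrow> 'c \<Rightarrow> bool" where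
  "isomorphic_in C x y \<longleftrightarrow> x \<in> simplices C 0 \<and> y \<in> simplices C 0 \<and>
    (\<exists>u\<in>simplices C 1. \<exists>v\<in>simplices C 1. \<exists>\<sigma>\<in>simplices C 2. \<exists>\<tau>\<in>simplices C 2.
      face C 1 1 u = x \<and> face C 1 0 u = y \<and> face C 1 1 v = y \<and> face C 1 0 v = x \<and>
      face C 2 2 \<sigma> = u \<and> face C 2 0 \<sigma> = v \<and> face C 2 1 \<sigma> = degen C 0 0 x \<and>
      face C 2 2 \<tau> = v \<and> face C 2 0 \<tau> = u \<and> face C 2 1 \<tau> = degen C 0 0 y)"

text \<open>A map on \<open>X\<close> as an object of a mapping space, through \<open>X \<times> \<Delta>[0] = X\<close>.\<close>

definition map_vertex ::
    "'a sset \<Rightarrow> (nat \<Rightarrow> 'a \<Rightarrow> 'b) \<Rightarrow> nat \<Rightarrow> 'a \<times> (nat \<Rightarrow> nat) \<Rightarrow> 'b" where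
  "map_vertex X f k = restrict (\<lambda>(x, \<tau>). f k x) (simplices (sprod X (std_simplex 0)) k)"

text \<open>Equivalence of quasi-categories: invertible up to natural isomorphism. Between Kan complexes
  this is the same as homotopy equivalence.\<close>

definition equivalence :: "(nat \<Rightarrow> 'a \<Rightarrow> 'b) \<Rightarrow> 'a sset \<Rightarrow> 'b sset \<Rightarrow> bool" where
  "equivalence f X Y \<longleftrightarrow> smap f X Y \<and> (\<exists>g. smap g Y X \<and>
    isomorphic_in (map_space X X) (map_vertex X (\<lambda>k. g k \<circ> f k)) (map_vertex X (\<lambda>_. id)) \<and>
    isomorphic_in (map_space Y Y) (map_vertex Y (\<lambda>k. f k \<circ> g k)) (map_vertex Y (\<lambda>_. id)))"

section \<open>Linked \<open>\<infinity>\<close>-categories and exit paths\<close>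

record ('m, 'l, 'n) sspan =
  M_of :: "'m sset"
  L_of :: "'l sset"
  N_of :: "'n sset"
  pi_of :: "nat \<Rightarrow> 'l \<Rightarrow> 'm"
  iota_of :: "nat \<Rightarrow> 'l \<Rightarrow> 'n"

definition linked_category :: "('m, 'l, 'n) sspan \<Rightarrow> bool" where
  "linked_category S \<longleftrightarrow>
    quasi_category (M_of S) \<and> quasi_category (L_of S) \<and> quasi_category (N_of S) \<and>
    right_fibration (pi_of S) (L_of S) (M_of S) \<and> smono (iota_of S) (L_of S) (N_of S)"

definition linked_groupoid :: "('m, 'l, 'n) sspan \<Rightarrow> bool" where
  "linked_groupoid S \<longleftrightarrow>
    kan_complex (M_of S) \<and> kan_complex (L_of S) \<and> kan_complex (N_of S) \<and>
    right_fibration (pi_of S) (L_of S) (M_of S) \<and> smono (iota_of S) (L_of S) (N_of S)"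

text \<open>Simplices of the exit path \<open>\<infinity>\<close>-category; \<open>Exit \<gamma> j\<close> is the exit path \<open>(\<gamma>, j)\<close>.\<close>

datatype ('m, 'n) ex_simplex = In_M 'm | Exit 'n nat | In_N 'n

definition exit_paths :: "('m, 'l, 'n) sspan \<Rightarrow> nat \<Rightarrow> ('n \<times> nat) set" where
  "exit_paths S k = {(\<gamma>, j). \<gamma> \<in> simplices (N_of S) k \<and> j \<in> {1..k} \<and>
    pull (N_of S) (j - 1) k id \<gamma> \<in> iota_of S (j - 1) ` simplices (L_of S) (j - 1)}"

definition ExitCat :: "('m, 'l, 'n) sspan \<Rightarrow> ('m, 'n) ex_simplex sset" where
  "ExitCat S =
    \<lparr>simplices = (\<lambda>k. In_M ` simplices (M_of S) k \<union> (\<lambda>(\<gamma>, j). Exit \<gamma> j) ` exit_paths S k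
                       \<union> In_N ` simplices (N_of S) k),
     pull = (\<lambda>m k \<alpha> x. case x of
         In_M a \<Rightarrow> In_M (pull (M_of S) m k \<alpha> a)
       | In_N b \<Rightarrow> In_N (pull (N_of S) m k \<alpha> b)
       | Exit \<gamma> j \<Rightarrow>
          (let \<gamma>' = pull (N_of S) m k \<alpha> \<gamma> in
           if \<forall>i\<le>m. \<alpha> i < j
             then In_M (pi_of S m (the_inv_into (simplices (L_of S) m) (iota_of S m) \<gamma>'))
           else if j \<le> \<alpha> 0 then In_N \<gamma>'
           else Exit \<gamma>' (LEAST i. i \<le> m \<and> j \<le> \<alpha> i)))\<rparr>"

definition link_fibre :: "('m, 'l, 'n) sspan \<Rightarrow> 'm \<Rightarrow> ('m \<times> 'l) sset" where
  "link_fibre S p = fibre_prod (spoint (M_of S) p) (\<lambda>_. id) (pi_of S) (L_of S)"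

definition fibre_paths :: "('m, 'l, 'n) sspan \<Rightarrow> 'm \<Rightarrow> 'n
    \<Rightarrow> (('m \<times> 'l) \<times> (nat \<Rightarrow> (nat \<Rightarrow> nat) \<times> (nat \<Rightarrow> nat) \<Rightarrow> 'n) \<times> 'n) sset" where
  "fibre_paths S p q =
    comma (link_fibre S p) (\<lambda>k. iota_of S k \<circ> snd) (spoint (N_of S) q) (\<lambda>_. id) (N_of S)"

definition MN_comma :: "('m, 'l, 'n) sspan \<Rightarrow>
    ('m \<times> (nat \<Rightarrow> (nat \<Rightarrow> nat) \<times> (nat \<Rightarrow> nat) \<Rightarrow> ('m, 'n) ex_simplex) \<times> 'n) sset" where
  "MN_comma S = comma (M_of S) (\<lambda>_. In_M) (N_of S) (\<lambda>_. In_N) (ExitCat S)"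

definition LN_comma :: "('m, 'l, 'n) sspan \<Rightarrow>
    ('l \<times> (nat \<Rightarrow> (nat \<Rightarrow> nat) \<times> (nat \<Rightarrow> nat) \<Rightarrow> 'n) \<times> 'n) sset" where
  "LN_comma S = comma (L_of S) (iota_of S) (N_of S) (\<lambda>_. id) (N_of S)"

text \<open>The top-dimensional simplex \<open>\<S>\<^sub>j\<close> of the prism \<open>\<Delta>[1] \<times> \<Delta>[n]\<close>, for \<open>1 \<le> j \<le> n + 1\<close>:
  \<open>i \<mapsto> (0, i)\<close> for \<open>i < j\<close> and \<open>i \<mapsto> (1, i - 1)\<close> for \<open>i \<ge> j\<close>.\<close>

definition prism_simplex :: "nat \<Rightarrow> nat \<Rightarrow> (nat \<Rightarrow> nat) \<times> (nat \<Rightarrow> nat)" where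
  "prism_simplex n j =
    (restrict (\<lambda>i. if i < j then 0 else 1) {..Suc n},
     restrict (\<lambda>i. if i < j then i else i - 1) {..Suc n})"

text \<open>\<open>h\<close> is the map from the prism to \<open>ExitCat S\<close> restricting along each \<open>\<S>\<^sub>j\<close> to \<open>(s\<^bsub>j-1\<^esub> (\<iota> b), j)\<close>.\<close>

definition constant_exit_loop :: "('m, 'l, 'n) sspan \<Rightarrow> nat \<Rightarrow> 'l
    \<Rightarrow> (nat \<Rightarrow> (nat \<Rightarrow> nat) \<times> (nat \<Rightarrow> nat) \<Rightarrow> ('m, 'n) ex_simplex) \<Rightarrow> bool" where
  "constant_exit_loop S n b h \<longleftrightarrow>
    h \<in> smaps (sprod (std_simplex 1) (std_simplex n)) (ExitCat S) \<and>
    (\<forall>j\<in>{1..Suc n}.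
      h (Suc n) (prism_simplex n j) = Exit (degen (N_of S) n (j - 1) (iota_of S n b)) j)"

definition Box :: "('m, 'l, 'n) sspan \<Rightarrow> nat \<Rightarrow> 'l
    \<Rightarrow> 'm \<times> (nat \<Rightarrow> (nat \<Rightarrow> nat) \<times> (nat \<Rightarrow> nat) \<Rightarrow> ('m, 'n) ex_simplex) \<times> 'n" where
  "Box S n b = (pi_of S n b, (THE h. constant_exit_loop S n b h), iota_of S n b)"

end

(*
A map from the prism to the exit path category that starts in M and ends in N has an underlying map
of the prism to N: a simplex sent into M is the 0-side of its cone to the terminal vertex (1, n),
and the exit path on this cone exhibits a lift to L. Recording the lift at the start of the prism
makes this a bijection, natural in n, between (M, N)-paths in the exit path category and
(L, N)-paths in N. Restricted to the fibre over p and the point q it identifies the mapping spaces,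
and the constant exit loops correspond to the constant paths in N on simplices of L.

For N a Kan complex, contracting paths in N to their starting points shows that L is equivalent to
the space of (L, N)-paths. To have the contraction, its inverse and the two triangles at once, one
extends a map along the two ends of the contractible groupoid on two objects instead of along the
ends of an interval; the extension exists by the homotopy extension property of Kan complexes,
which is proved by filling the prism over each nondegenerate cell horn by horn.
*)

theory Submission
  imports Defs
begin

text \<open>The rule for pulling back an exit path has three outcomes, and treating them separately
  would multiply the cases in every naturality argument. A simplex of the exit path category is
  therefore described by a simplex of \<open>N\<close> together with an upward closed set of
  vertices, those lying in \<open>N\<close>. Pulling back precomposes this set with the ordinal map,
  and the side coordinate of the prism is such a set.

  The obstacle is that a simplex of \<open>M\<close> forgets its lift to \<open>L\<close>, since
  \<pi> may identify several lifts. The underlying map to \<open>N\<close> can thus not be read off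
  simplex by simplex; this is what the cone repairs.

  In the contraction the path parameter itself serves as the cylinder coordinate. Starting points
  form the bottom of the cylinder and have to stay in \<open>L\<close>, so the map to be extended is
  prescribed on the bottom and on the two ends of the groupoid. Transposing the extension turns it
  into a homotopy of paths with fixed start.\<close>

declare One_nat_def [simp del]

section \<open>Monotone maps of finite ordinals\<close>

lemma ord_mapsI:
  assumes "\<And>t. t \<le> m \<Longrightarrow> \<alpha> t \<le> k" "\<And>s t. s \<le> t \<Longrightarrow> t \<le> m \<Longrightarrow> \<alpha> s \<le> \<alpha> t"
  shows "\<alpha> \<in> ord_maps m k"
  using assms by (auto simp: ord_maps_def mono_on_def)

lemma ord_maps_le: "\<alpha> \<in> ord_maps m k \<Longrightarrow> t \<le> m \<Longrightarrow> \<alpha> t \<le> k"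
  by (auto simp: ord_maps_def)

lemma ord_maps_mono: "\<alpha> \<in> ord_maps m k \<Longrightarrow> s \<le> t \<Longrightarrow> t \<le> m \<Longrightarrow> \<alpha> s \<le> \<alpha> t"
  by (auto simp: ord_maps_def mono_on_def)

lemma ord_maps_comp: "\<beta> \<in> ord_maps l m \<Longrightarrow> \<alpha> \<in> ord_maps m k \<Longrightarrow> \<alpha> \<circ> \<beta> \<in> ord_maps l k"
  by (rule ord_mapsI) (auto dest: ord_maps_le intro: ord_maps_mono)

lemma ord_maps_cong: "\<alpha> \<in> ord_maps m k \<Longrightarrow> (\<And>t. t \<le> m \<Longrightarrow> \<alpha> t = \<beta> t) \<Longrightarrow> \<beta> \<in> ord_maps m k"
  by (rule ord_mapsI) (metis ord_maps_le, metis ord_maps_mono order_trans)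

lemma id_ord_maps: "m \<le> k \<Longrightarrow> id \<in> ord_maps m k"
  by (rule ord_mapsI) auto

lemma const_ord_maps: "v \<le> k \<Longrightarrow> (\<lambda>_. v) \<in> ord_maps m k"
  by (rule ord_mapsI) auto

lemma coface_ord_maps: "coface i \<in> ord_maps k (Suc k)"
  by (rule ord_mapsI) (auto simp: coface_def)

lemma codegen_ord_maps: "i \<le> k \<Longrightarrow> codegen i \<in> ord_maps (Suc k) k"
  by (rule ord_mapsI) (auto simp: codegen_def)

text \<open>Every choice of preimages is monotone because \<alpha> is. One preimage can thus be
  prescribed, here \<open>t\<close>; \<open>presentation_unique\<close> uses this freedom for each
  vertex in turn.\<close>

lemma ord_maps_section:
  assumes \<alpha>: "\<alpha> \<in> ord_maps m n" and surj: "\<And>v. v \<le> n \<Longrightarrow> \<exists>s\<le>m. \<alpha> s = v" and t: "t \<le> m"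
  obtains \<delta> where "\<delta> \<in> ord_maps n m" "\<And>v. v \<le> n \<Longrightarrow> \<alpha> (\<delta> v) = v" "\<delta> (\<alpha> t) = t"
proof -
  define \<delta> where "\<delta> v = (if v = \<alpha> t then t else (SOME s. s \<le> m \<and> \<alpha> s = v))" for v
  have \<delta>: "\<delta> v \<le> m \<and> \<alpha> (\<delta> v) = v" if "v \<le> n" for v
    using someI_ex[OF surj[OF that]] t by (auto simp: \<delta>_def)
  show ?thesis
  proof (rule that)
    show "\<delta> \<in> ord_maps n m"
    proof (rule ord_mapsI)
      fix s v assume "s \<le> v" "v \<le> n"
      then show "\<delta> s \<le> \<delta> v"
        using \<delta>[of s] \<delta>[of v] ord_maps_mono[OF \<alpha>, of "\<delta> v" "\<delta> s"]
        by (metis antisym nat_le_linear order_trans)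
    qed (use \<delta> in auto)
  qed (use \<delta> in \<open>auto simp: \<delta>_def\<close>)
qed

text \<open>A surjection of a finite set onto itself is injective, so \<alpha> is strictly
  increasing. Counting strict steps up from \<open>0\<close> gives
  \<open>s \<le> \<alpha> s\<close>, and counting them down from \<open>n\<close> gives the reverse
  bound.\<close>

lemma ord_maps_endo_surj_id:
  assumes \<alpha>: "\<alpha> \<in> ord_maps n n" and surj: "\<And>v. v \<le> n \<Longrightarrow> \<exists>s\<le>n. \<alpha> s = v" and t: "t \<le> n"
  shows "\<alpha> t = t"
proof -
  have img: "\<alpha> ` {..n} = {..n}" using surj ord_maps_le[OF \<alpha>] by force
  then have inj: "inj_on \<alpha> {..n}" by (simp add: eq_card_imp_inj_on)
  have less: "\<alpha> s < \<alpha> v" if "s < v" "v \<le> n" for s v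
    using ord_maps_mono[OF \<alpha>, of s v] inj_onD[OF inj, of s v] that by (auto simp: le_less)
  have ge: "s \<le> n \<Longrightarrow> s \<le> \<alpha> s" for s
    by (induction s) (use less in \<open>auto simp: Suc_le_eq intro: le_less_trans\<close>)
  have "s \<le> n \<Longrightarrow> \<alpha> (n - s) + s \<le> n" for s
  proof (induction s)
    case (Suc s)
    then show ?case using less[of "n - Suc s" "n - s"] by force
  qed (use ord_maps_le[OF \<alpha>] in auto)
  from this[of "n - t"] have "\<alpha> t \<le> t" using t by auto
  then show ?thesis using ge[OF t] by simp
qed

text \<open>Closing the gap at \<open>v\<close> inverts \<open>coface v\<close> on its image, so a
  map that avoids \<open>v\<close> factors through a proper face.\<close>

lemma ord_maps_skip:
  assumes \<alpha>: "\<alpha> \<in> ord_maps m (Suc n)" and skip: "\<And>s. s \<le> m \<Longrightarrow> \<alpha> s \<noteq> v" and v: "v \<le> Suc n"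
  shows "(\<lambda>t. if \<alpha> t < v then \<alpha> t else \<alpha> t - 1) \<in> ord_maps m n"
    and "t \<le> m \<Longrightarrow> coface v (if \<alpha> t < v then \<alpha> t else \<alpha> t - 1) = \<alpha> t"
proof -
  show "(\<lambda>t. if \<alpha> t < v then \<alpha> t else \<alpha> t - 1) \<in> ord_maps m n"
  proof (rule ord_mapsI)
    fix t assume t: "t \<le> m"
    show "(if \<alpha> t < v then \<alpha> t else \<alpha> t - 1) \<le> n"
      using ord_maps_le[OF \<alpha> t] v by auto
  next
    fix s t assume "s \<le> t" "t \<le> m"
    then show "(if \<alpha> s < v then \<alpha> s else \<alpha> s - 1) \<le> (if \<alpha> t < v then \<alpha> t else \<alpha> t - 1)"
      using ord_maps_mono[OF \<alpha>, of s t] by auto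
  qed
  show "coface v (if \<alpha> t < v then \<alpha> t else \<alpha> t - 1) = \<alpha> t" if "t \<le> m"
    using skip[OF that] by (auto simp: coface_def)
qed

section \<open>Standard simplices, products and simplicial maps\<close>

lemma std_simplex_iff:
  "\<tau> \<in> simplices (std_simplex n) k \<longleftrightarrow> \<tau> \<in> ord_maps k n \<and> \<tau> \<in> extensional {..k}"
  by (auto simp: std_simplex_def ord_maps_def PiE_def)

lemma std_simplex_pull: "pull (std_simplex n) m k \<alpha> \<tau> = restrict (\<tau> \<circ> \<alpha>) {..m}"
  by (simp add: std_simplex_def)

lemma restrict_std_simplex:
  "\<alpha> \<in> ord_maps k n \<Longrightarrow> restrict \<alpha> {..k} \<in> simplices (std_simplex n) k"
  by (auto simp: std_simplex_iff intro: ord_maps_cong)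

lemma simplicial_set_std_simplex: "simplicial_set (std_simplex n)"
proof
  fix m k \<alpha> x assume "\<alpha> \<in> ord_maps m k" "x \<in> simplices (std_simplex n) k"
  then show "pull (std_simplex n) m k \<alpha> x \<in> simplices (std_simplex n) m"
    by (auto simp: std_simplex_pull std_simplex_iff intro: ord_maps_cong[OF ord_maps_comp])
next
  fix k x assume "x \<in> simplices (std_simplex n) k"
  then show "pull (std_simplex n) k k id x = x"
    by (auto simp: std_simplex_pull std_simplex_iff intro: extensional_restrict)
next
  fix l m k \<beta> \<alpha> x assume "\<beta> \<in> ord_maps l m" "\<alpha> \<in> ord_maps m k" "x \<in> simplices (std_simplex n) k"
  then show "pull (std_simplex n) l k (\<alpha> \<circ> \<beta>) x = pull (std_simplex n) l m \<beta> (pull (std_simplex n) m k \<alpha> x)"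
    by (auto simp: std_simplex_pull fun_eq_iff restrict_def dest: ord_maps_le)
next
  fix m k :: nat and \<alpha> \<beta> x :: "nat \<Rightarrow> nat"
  assume "\<And>i. i \<le> m \<Longrightarrow> \<alpha> i = \<beta> i"
  then show "pull (std_simplex n) m k \<alpha> x = pull (std_simplex n) m k \<beta> x"
    by (auto simp: std_simplex_pull fun_eq_iff restrict_def)
qed

lemma sprod_iff: "(x, y) \<in> simplices (sprod X Y) k \<longleftrightarrow> x \<in> simplices X k \<and> y \<in> simplices Y k"
  by (simp add: sprod_def)

lemma sprod_pull: "pull (sprod X Y) m k \<alpha> (x, y) = (pull X m k \<alpha> x, pull Y m k \<alpha> y)"
  by (simp add: sprod_def)

lemma simplicial_set_sprod:
  assumes "simplicial_set X" "simplicial_set Y"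
  shows "simplicial_set (sprod X Y)"
proof -
  interpret X: simplicial_set X by fact
  interpret Y: simplicial_set Y by fact
  show ?thesis
  proof
    fix m k \<alpha> x assume "\<alpha> \<in> ord_maps m k" "x \<in> simplices (sprod X Y) k"
    then show "pull (sprod X Y) m k \<alpha> x \<in> simplices (sprod X Y) m"
      by (cases x) (auto simp: sprod_iff sprod_pull X.pull_closed Y.pull_closed)
  next
    fix k x assume "x \<in> simplices (sprod X Y) k"
    then show "pull (sprod X Y) k k id x = x"
      by (cases x) (auto simp: sprod_iff sprod_pull X.pull_id Y.pull_id)
  next
    fix l m k \<beta> \<alpha> x assume "\<beta> \<in> ord_maps l m" "\<alpha> \<in> ord_maps m k" "x \<in> simplices (sprod X Y) k"
    then show "pull (sprod X Y) l k (\<alpha> \<circ> \<beta>) x = pull (sprod X Y) l m \<beta> (pull (sprod X Y) m k \<alpha> x)"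
      by (cases x) (auto simp: sprod_iff sprod_pull X.pull_comp Y.pull_comp)
  next
    fix m k \<alpha> \<beta> x
    assume *: "\<alpha> \<in> ord_maps m k" "x \<in> simplices (sprod X Y) k" "\<And>i. i \<le> m \<Longrightarrow> \<alpha> i = \<beta> i"
    then show "pull (sprod X Y) m k \<alpha> x = pull (sprod X Y) m k \<beta> x"
      using X.pull_cong[OF *(1) _ *(3)] Y.pull_cong[OF *(1) _ *(3)]
      by (cases x) (auto simp: sprod_iff sprod_pull)
  qed
qed

lemma smapI:
  assumes "\<And>k x. x \<in> simplices X k \<Longrightarrow> f k x \<in> simplices Y k"
    and "\<And>m k \<alpha> x. \<alpha> \<in> ord_maps m k \<Longrightarrow> x \<in> simplices X k \<Longrightarrow> f m (pull X m k \<alpha> x) = pull Y m k \<alpha> (f k x)"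
  shows "smap f X Y"
  using assms by (auto simp: smap_def)

lemma smap_closed: "smap f X Y \<Longrightarrow> x \<in> simplices X k \<Longrightarrow> f k x \<in> simplices Y k"
  by (auto simp: smap_def)

lemma smap_pull: "smap f X Y \<Longrightarrow> \<alpha> \<in> ord_maps m k \<Longrightarrow> x \<in> simplices X k \<Longrightarrow>
    f m (pull X m k \<alpha> x) = pull Y m k \<alpha> (f k x)"
  by (auto simp: smap_def)

lemma smap_comp:
  assumes "smap f X Y" "smap g Y Z"
  shows "smap (\<lambda>k. g k \<circ> f k) X Z"
  by (rule smapI) (simp_all add: smap_closed[OF assms(1)] smap_closed[OF assms(2)]
      smap_pull[OF assms(1)] smap_pull[OF assms(2)])

lemma smap_cong_simplices:
  assumes "smap f X Y" "simplicial_set X" "\<And>k x. x \<in> simplices X k \<Longrightarrow> g k x = f k x"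
  shows "smap g X Y"
  by (rule smapI) (simp_all add: assms(3) smap_closed[OF assms(1)] smap_pull[OF assms(1)]
      simplicial_set.pull_closed[OF assms(2)])

lemma smapsD: "h \<in> smaps X Y \<Longrightarrow> smap h X Y"
  by (simp add: smaps_def)

lemma smaps_eqI:
  assumes "h \<in> smaps X Y" "h' \<in> smaps X Y" "\<And>k x. x \<in> simplices X k \<Longrightarrow> h k x = h' k x"
  shows "h = h'"
  using assms by (intro ext) (auto simp: smaps_def intro: extensionalityI[THEN fun_cong])

lemma restrict_smaps:
  assumes "smap h X Y" "simplicial_set X"
  shows "(\<lambda>k. restrict (h k) (simplices X k)) \<in> smaps X Y"
  using smap_cong_simplices[OF assms, of "\<lambda>k. restrict (h k) (simplices X k)"]
  by (simp add: smaps_def)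

lemma siso_inverse:
  assumes f: "siso f X Y" and X: "simplicial_set X"
  defines "g \<equiv> \<lambda>k. the_inv_into (simplices X k) (f k)"
  shows "siso g Y X"
    and "x \<in> simplices X k \<Longrightarrow> g k (f k x) = x"
    and "y \<in> simplices Y k \<Longrightarrow> f k (g k y) = y"
proof -
  have fm: "smap f X Y" and bij: "\<And>k. bij_betw (f k) (simplices X k) (simplices Y k)"
    using f by (auto simp: siso_def)
  show gf: "x \<in> simplices X k \<Longrightarrow> g k (f k x) = x" for x k
    unfolding g_def using bij[of k] by (simp add: bij_betw_def the_inv_into_f_f)
  show fg: "y \<in> simplices Y k \<Longrightarrow> f k (g k y) = y" for y k
    unfolding g_def using bij[of k] by (auto simp: bij_betw_def intro: f_the_inv_into_f)
  have gc: "y \<in> simplices Y k \<Longrightarrow> g k y \<in> simplices X k" for y k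
    using bij[of k] unfolding g_def bij_betw_def by (auto intro: the_inv_into_into)
  have "smap g Y X"
  proof (rule smapI)
    fix m k \<alpha> y assume a: "\<alpha> \<in> ord_maps m k" and y: "y \<in> simplices Y k"
    have "g m (pull Y m k \<alpha> y) = g m (f m (pull X m k \<alpha> (g k y)))"
      by (simp add: smap_pull[OF fm a gc[OF y]] fg[OF y])
    then show "g m (pull Y m k \<alpha> y) = pull X m k \<alpha> (g k y)"
      using gf simplicial_set.pull_closed[OF X a gc[OF y]] by simp
  qed (rule gc)
  moreover have "bij_betw (g k) (simplices Y k) (simplices X k)" for k
    unfolding g_def by (rule bij_betw_the_inv_into[OF bij])
  ultimately show "siso g Y X" by (simp add: siso_def)
qed

section \<open>Mapping spaces and comma objects\<close>

lemma map_space_simplices: "simplices (map_space K C) n = smaps (sprod K (std_simplex n)) C"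
  by (simp add: map_space_def)

lemma map_space_pull_apply:
  assumes "x \<in> simplices K k" "\<tau> \<in> simplices (std_simplex m) k"
  shows "pull (map_space K C) m n \<alpha> h k (x, \<tau>) = h k (x, restrict (\<alpha> \<circ> \<tau>) {..k})"
  using assms by (simp add: map_space_def sprod_iff)

lemma std_simplex_postcomp:
  "\<alpha> \<in> ord_maps m n \<Longrightarrow> \<tau> \<in> simplices (std_simplex m) k \<Longrightarrow>
    restrict (\<alpha> \<circ> \<tau>) {..k} \<in> simplices (std_simplex n) k"
  by (auto simp: std_simplex_iff intro: ord_maps_cong[OF ord_maps_comp])

lemma simplicial_set_map_space:
  assumes K: "simplicial_set K"
  shows "simplicial_set (map_space K C)"
proof -
  note KD = simplicial_set_sprod[OF K simplicial_set_std_simplex]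
  have closed: "pull (map_space K C) m n \<alpha> h \<in> smaps (sprod K (std_simplex m)) C"
    if \<alpha>: "\<alpha> \<in> ord_maps m n" and h: "h \<in> smaps (sprod K (std_simplex n)) C" for m n \<alpha> h
  proof -
    have "smap (\<lambda>k (x, \<tau>). h k (x, restrict (\<alpha> \<circ> \<tau>) {..k})) (sprod K (std_simplex m)) C"
    proof (rule smapI)
      fix k z assume "z \<in> simplices (sprod K (std_simplex m)) k"
      then show "(case z of (x, \<tau>) \<Rightarrow> h k (x, restrict (\<alpha> \<circ> \<tau>) {..k})) \<in> simplices C k"
        by (auto simp: sprod_iff std_simplex_postcomp[OF \<alpha>] intro!: smap_closed[OF smapsD[OF h]] split: prod.split)
    next
      fix l k \<beta> z assume \<beta>: "\<beta> \<in> ord_maps l k" and z: "z \<in> simplices (sprod K (std_simplex m)) k"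
      obtain x \<tau> where zx: "z = (x, \<tau>)" by (cases z)
      then have x: "x \<in> simplices K k" and \<tau>: "\<tau> \<in> simplices (std_simplex m) k"
        using z by (auto simp: sprod_iff)
      have "restrict (\<alpha> \<circ> restrict (\<tau> \<circ> \<beta>) {..l}) {..l} = restrict (restrict (\<alpha> \<circ> \<tau>) {..k} \<circ> \<beta>) {..l}"
        using ord_maps_le[OF \<beta>] by (auto simp: fun_eq_iff)
      then show "(case pull (sprod K (std_simplex m)) l k \<beta> z of (x, \<tau>) \<Rightarrow> h l (x, restrict (\<alpha> \<circ> \<tau>) {..l}))
        = pull C l k \<beta> (case z of (x, \<tau>) \<Rightarrow> h k (x, restrict (\<alpha> \<circ> \<tau>) {..k}))"
        using smap_pull[OF smapsD[OF h] \<beta>, of "(x, restrict (\<alpha> \<circ> \<tau>) {..k})"] x \<tau>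
        by (simp add: zx sprod_pull sprod_iff std_simplex_pull std_simplex_postcomp[OF \<alpha>])
    qed
    from restrict_smaps[OF this KD] show ?thesis
      by (simp add: map_space_def)
  qed
  show ?thesis
  proof
    fix m k \<alpha> x assume "\<alpha> \<in> ord_maps m k" "x \<in> simplices (map_space K C) k"
    then show "pull (map_space K C) m k \<alpha> x \<in> simplices (map_space K C) m"
      by (simp add: map_space_simplices closed)
  next
    fix n h assume h: "h \<in> simplices (map_space K C) n"
    show "pull (map_space K C) n n id h = h"
    proof (rule smaps_eqI)
      show "pull (map_space K C) n n id h \<in> smaps (sprod K (std_simplex n)) C"
        by (rule closed) (use h id_ord_maps in \<open>auto simp: map_space_simplices\<close>)
      fix k z assume "z \<in> simplices (sprod K (std_simplex n)) k"
      then show "pull (map_space K C) n n id h k z = h k z"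
        by (cases z) (auto simp: map_space_pull_apply sprod_iff std_simplex_iff extensional_restrict)
    qed (use h in \<open>simp add: map_space_simplices\<close>)
  next
    fix l m n \<beta> \<alpha> h
    assume \<beta>: "\<beta> \<in> ord_maps l m" and \<alpha>: "\<alpha> \<in> ord_maps m n" and h: "h \<in> simplices (map_space K C) n"
    note h' = h[unfolded map_space_simplices]
    show "pull (map_space K C) l n (\<alpha> \<circ> \<beta>) h = pull (map_space K C) l m \<beta> (pull (map_space K C) m n \<alpha> h)"
    proof (rule smaps_eqI[OF closed[OF ord_maps_comp[OF \<beta> \<alpha>] h'] closed[OF \<beta> closed[OF \<alpha> h']]])
      fix k z assume "z \<in> simplices (sprod K (std_simplex l)) k"
      then obtain x \<tau> where z: "z = (x, \<tau>)" "x \<in> simplices K k" "\<tau> \<in> simplices (std_simplex l) k"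
        by (cases z) (auto simp: sprod_iff)
      have "restrict ((\<alpha> \<circ> \<beta>) \<circ> \<tau>) {..k} = restrict (\<alpha> \<circ> restrict (\<beta> \<circ> \<tau>) {..k}) {..k}"
        by (auto simp: fun_eq_iff)
      with z show "pull (map_space K C) l n (\<alpha> \<circ> \<beta>) h k z
          = pull (map_space K C) l m \<beta> (pull (map_space K C) m n \<alpha> h) k z"
        by (simp add: map_space_pull_apply std_simplex_postcomp[OF \<beta>])
    qed
  next
    fix m n \<alpha> \<beta> h
    assume \<alpha>: "\<alpha> \<in> ord_maps m n" and h: "h \<in> simplices (map_space K C) n"
      and eq: "\<And>i. i \<le> m \<Longrightarrow> \<alpha> i = \<beta> i"
    note h' = h[unfolded map_space_simplices]
    show "pull (map_space K C) m n \<alpha> h = pull (map_space K C) m n \<beta> h"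
    proof (rule smaps_eqI[OF closed[OF \<alpha> h'] closed[OF ord_maps_cong[OF \<alpha> eq] h']])
      fix k z assume "z \<in> simplices (sprod K (std_simplex m)) k"
      then obtain x \<tau> where z: "z = (x, \<tau>)" "x \<in> simplices K k" "\<tau> \<in> simplices (std_simplex m) k"
        by (cases z) (auto simp: sprod_iff)
      have "restrict (\<alpha> \<circ> \<tau>) {..k} = restrict (\<beta> \<circ> \<tau>) {..k}"
        using z(3) eq by (auto simp: fun_eq_iff std_simplex_iff dest: ord_maps_le)
      with z show "pull (map_space K C) m n \<alpha> h k z = pull (map_space K C) m n \<beta> h k z"
        by (simp add: map_space_pull_apply)
    qed auto
  qed
qed

abbreviation prism :: "nat \<Rightarrow> ((nat \<Rightarrow> nat) \<times> (nat \<Rightarrow> nat)) sset" where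
  "prism n \<equiv> sprod (std_simplex 1) (std_simplex n)"

abbreviation prism_end :: "nat \<Rightarrow> nat \<Rightarrow> (nat \<Rightarrow> nat) \<times> (nat \<Rightarrow> nat)" where
  "prism_end e n \<equiv> (restrict (\<lambda>_. e) {..n}, restrict id {..n})"

lemma comma_iff:
  "(a, h, b) \<in> simplices (comma A f B g C) n \<longleftrightarrow>
    a \<in> simplices A n \<and> b \<in> simplices B n \<and> h \<in> smaps (prism n) C \<and>
    h n (prism_end 0 n) = f n a \<and> h n (prism_end 1 n) = g n b"
  by (auto simp: comma_def fibre_prod_def ev_end_def map_space_simplices)

lemma comma_pull:
  "pull (comma A f B g C) m n \<alpha> (a, h, b) =
    (pull A m n \<alpha> a, pull (map_space (std_simplex 1) C) m n \<alpha> h, pull B m n \<alpha> b)"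
  by (simp add: comma_def fibre_prod_def sprod_pull)

lemma prism_end_simplex: "e \<le> 1 \<Longrightarrow> prism_end e n \<in> simplices (prism n) n"
  by (simp add: sprod_iff restrict_std_simplex const_ord_maps id_ord_maps)

lemma simplicial_set_prism: "simplicial_set (prism n)"
  by (intro simplicial_set_sprod simplicial_set_std_simplex)

text \<open>All simplices of the side over \<open>e\<close> are pullbacks of
  \<open>prism_end e n\<close>, so the single value read by \<open>ev_end\<close> determines the map
  on the whole side.\<close>

lemma smaps_prism_const:
  assumes h: "smap h (prism n) C" and \<sigma>: "\<sigma> \<in> ord_maps k n" and e: "e \<le> 1"
  shows "h k (restrict (\<lambda>_. e) {..k}, restrict \<sigma> {..k}) = pull C k n \<sigma> (h n (prism_end e n))"
proof -
  have "pull (prism n) k n \<sigma> (prism_end e n) = (restrict (\<lambda>_. e) {..k}, restrict \<sigma> {..k})"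
    using ord_maps_le[OF \<sigma>] by (auto simp: sprod_pull std_simplex_pull fun_eq_iff)
  then show ?thesis using smap_pull[OF h \<sigma> prism_end_simplex[OF e]] by simp
qed

lemma map_space_prism_end:
  assumes h: "h \<in> smaps (prism n) C" and \<alpha>: "\<alpha> \<in> ord_maps m n" and e: "e \<le> 1"
  shows "pull (map_space (std_simplex 1) C) m n \<alpha> h m (prism_end e m) = pull C m n \<alpha> (h n (prism_end e n))"
proof -
  have "restrict (\<alpha> \<circ> restrict id {..m}) {..m} = restrict \<alpha> {..m}" by (auto simp: fun_eq_iff)
  then show ?thesis
    using prism_end_simplex[OF e, of m] smaps_prism_const[OF smapsD[OF h] \<alpha> e]
    by (simp add: map_space_pull_apply sprod_iff)
qed

lemma simplicial_set_comma:
  assumes A: "simplicial_set A" and B: "simplicial_set B"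
    and f: "smap f A C" and g: "smap g B C"
  shows "simplicial_set (comma A f B g C)"
proof -
  interpret A: simplicial_set A by fact
  interpret B: simplicial_set B by fact
  interpret E: simplicial_set "map_space (std_simplex 1) C"
    by (rule simplicial_set_map_space[OF simplicial_set_std_simplex])
  show ?thesis
  proof
    fix m k \<alpha> x assume \<alpha>: "\<alpha> \<in> ord_maps m k" and "x \<in> simplices (comma A f B g C) k"
    moreover obtain a h b where x: "x = (a, h, b)" by (cases x) auto
    ultimately have *: "a \<in> simplices A k" "b \<in> simplices B k" "h \<in> smaps (prism k) C"
      "h k (prism_end 0 k) = f k a" "h k (prism_end 1 k) = g k b" by (auto simp: comma_iff)
    then show "pull (comma A f B g C) m k \<alpha> x \<in> simplices (comma A f B g C) m"
      using E.pull_closed[OF \<alpha>, of h] smap_pull[OF f \<alpha>, of a] smap_pull[OF g \<alpha>, of b]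
      by (simp add: x comma_pull comma_iff A.pull_closed[OF \<alpha>] B.pull_closed[OF \<alpha>]
          map_space_simplices map_space_prism_end[OF _ \<alpha>])
  next
    fix k x assume "x \<in> simplices (comma A f B g C) k"
    then show "pull (comma A f B g C) k k id x = x"
      by (cases x) (auto simp: comma_iff comma_pull A.pull_id B.pull_id E.pull_id map_space_simplices)
  next
    fix l m k \<beta> \<alpha> x assume "\<beta> \<in> ord_maps l m" "\<alpha> \<in> ord_maps m k" "x \<in> simplices (comma A f B g C) k"
    then show "pull (comma A f B g C) l k (\<alpha> \<circ> \<beta>) x
        = pull (comma A f B g C) l m \<beta> (pull (comma A f B g C) m k \<alpha> x)"
      by (cases x) (auto simp: comma_iff comma_pull A.pull_comp B.pull_comp E.pull_comp map_space_simplices)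
  next
    fix m k \<alpha> \<beta> x
    assume *: "\<alpha> \<in> ord_maps m k" "x \<in> simplices (comma A f B g C) k" "\<And>i. i \<le> m \<Longrightarrow> \<alpha> i = \<beta> i"
    then show "pull (comma A f B g C) m k \<alpha> x = pull (comma A f B g C) m k \<beta> x"
      using A.pull_cong[OF *(1) _ *(3)] B.pull_cong[OF *(1) _ *(3)] E.pull_cong[OF *(1) _ *(3)]
      by (cases x) (auto simp: comma_iff comma_pull map_space_simplices)
  qed
qed

section \<open>Transposition between cylinders and path spaces\<close>

text \<open>The exponential transpose of a homotopy \<open>W\<close>, evaluated at \<open>y\<close>:
  an \<open>n\<close>-simplex \<open>y\<close> is a map from \<Delta>[n] to \<open>B\<close>, and
  its product with \<Delta>[1] is followed by \<open>W\<close>.\<close>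

definition cyl_transpose ::
    "'b sset \<Rightarrow> (nat \<Rightarrow> 'b \<times> (nat \<Rightarrow> nat) \<Rightarrow> 'c) \<Rightarrow> nat \<Rightarrow> 'b
      \<Rightarrow> nat \<Rightarrow> (nat \<Rightarrow> nat) \<times> (nat \<Rightarrow> nat) \<Rightarrow> 'c" where
  "cyl_transpose B W n y k = restrict (\<lambda>(\<tau>, \<sigma>). W k (pull B k n \<sigma> y, \<tau>)) (simplices (prism n) k)"

lemma cyl_transpose_smaps:
  assumes B: "simplicial_set B" and W: "smap W (sprod B (std_simplex 1)) C" and y: "y \<in> simplices B n"
  shows "cyl_transpose B W n y \<in> smaps (prism n) C"
proof -
  interpret B: simplicial_set B by fact
  have "smap (\<lambda>k (\<tau>, \<sigma>). W k (pull B k n \<sigma> y, \<tau>)) (prism n) C"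
  proof (rule smapI)
    fix k z assume "z \<in> simplices (prism n) k"
    then show "(case z of (\<tau>, \<sigma>) \<Rightarrow> W k (pull B k n \<sigma> y, \<tau>)) \<in> simplices C k"
      using y by (auto simp: sprod_iff std_simplex_iff B.pull_closed intro!: smap_closed[OF W] split: prod.split)
  next
    fix m k \<alpha> z assume \<alpha>: "\<alpha> \<in> ord_maps m k" and "z \<in> simplices (prism n) k"
    then obtain \<tau> \<sigma> where z: "z = (\<tau>, \<sigma>)" "\<tau> \<in> simplices (std_simplex 1) k" "\<sigma> \<in> ord_maps k n"
      by (cases z) (auto simp: sprod_iff std_simplex_iff)
    have "pull B m n (restrict (\<sigma> \<circ> \<alpha>) {..m}) y = pull B m k \<alpha> (pull B k n \<sigma> y)"
      using B.pull_cong[OF ord_maps_comp[OF \<alpha> z(3)] y, of "restrict (\<sigma> \<circ> \<alpha>) {..m}"]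
        B.pull_comp[OF \<alpha> z(3) y] by auto
    then show "(case pull (prism n) m k \<alpha> z of (\<tau>, \<sigma>) \<Rightarrow> W m (pull B m n \<sigma> y, \<tau>))
      = pull C m k \<alpha> (case z of (\<tau>, \<sigma>) \<Rightarrow> W k (pull B k n \<sigma> y, \<tau>))"
      using smap_pull[OF W \<alpha>, of "(pull B k n \<sigma> y, \<tau>)"] z B.pull_closed[OF z(3) y]
      by (simp add: sprod_pull sprod_iff std_simplex_pull)
  qed
  from restrict_smaps[OF this simplicial_set_prism] show ?thesis
    by (simp add: cyl_transpose_def[abs_def])
qed

lemma cyl_transpose_apply:
  "\<tau> \<in> simplices (std_simplex 1) k \<Longrightarrow> \<sigma> \<in> simplices (std_simplex n) k \<Longrightarrow>
    cyl_transpose B W n y k (\<tau>, \<sigma>) = W k (pull B k n \<sigma> y, \<tau>)"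
  by (simp add: cyl_transpose_def sprod_iff)

lemma cyl_transpose_end:
  assumes B: "simplicial_set B" and y: "y \<in> simplices B n" and e: "e \<le> 1"
  shows "cyl_transpose B W n y n (prism_end e n) = W n (y, restrict (\<lambda>_. e) {..n})"
  using simplicial_set.pull_cong[OF B id_ord_maps[OF order_refl] y, of "restrict id {..n}"]
    prism_end_simplex[OF e, of n]
  by (simp add: cyl_transpose_apply sprod_iff simplicial_set.pull_id[OF B y])

text \<open>The universal property of the comma object in the direction needed later: a homotopy
  between the two composites into \<open>C\<close> assembles with \<beta> and \<gamma> to a
  map.\<close>

lemma smap_into_comma:
  assumes B: "simplicial_set B" and W: "smap W (sprod B (std_simplex 1)) C"
    and \<beta>: "smap \<beta> B X" and \<gamma>: "smap \<gamma> B Y"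
    and W0: "\<And>n y. y \<in> simplices B n \<Longrightarrow> W n (y, restrict (\<lambda>_. 0) {..n}) = f n (\<beta> n y)"
    and W1: "\<And>n y. y \<in> simplices B n \<Longrightarrow> W n (y, restrict (\<lambda>_. 1) {..n}) = g n (\<gamma> n y)"
  shows "smap (\<lambda>n y. (\<beta> n y, cyl_transpose B W n y, \<gamma> n y)) B (comma X f Y g C)"
proof (rule smapI)
  fix n y assume y: "y \<in> simplices B n"
  then show "(\<beta> n y, cyl_transpose B W n y, \<gamma> n y) \<in> simplices (comma X f Y g C) n"
    using cyl_transpose_end[OF B y, of 0 W] cyl_transpose_end[OF B y, of 1 W]
    by (simp add: comma_iff smap_closed[OF \<beta>] smap_closed[OF \<gamma>] cyl_transpose_smaps[OF B W] W0 W1)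
next
  interpret B: simplicial_set B by fact
  interpret E: simplicial_set "map_space (std_simplex 1) C"
    by (rule simplicial_set_map_space[OF simplicial_set_std_simplex])
  fix m n \<alpha> y assume \<alpha>: "\<alpha> \<in> ord_maps m n" and y: "y \<in> simplices B n"
  have "cyl_transpose B W m (pull B m n \<alpha> y) = pull (map_space (std_simplex 1) C) m n \<alpha> (cyl_transpose B W n y)"
  proof (rule smaps_eqI)
    show "cyl_transpose B W m (pull B m n \<alpha> y) \<in> smaps (prism m) C"
      by (intro cyl_transpose_smaps B W B.pull_closed[OF \<alpha> y])
    show "pull (map_space (std_simplex 1) C) m n \<alpha> (cyl_transpose B W n y) \<in> smaps (prism m) C"
      using E.pull_closed[OF \<alpha>] cyl_transpose_smaps[OF B W y] by (simp add: map_space_simplices)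
    fix k z assume "z \<in> simplices (prism m) k"
    then obtain \<tau> \<sigma> where z: "z = (\<tau>, \<sigma>)" "\<tau> \<in> simplices (std_simplex 1) k"
        "\<sigma> \<in> simplices (std_simplex m) k" "\<sigma> \<in> ord_maps k m"
      by (cases z) (auto simp: sprod_iff std_simplex_iff)
    have "pull B k m \<sigma> (pull B m n \<alpha> y) = pull B k n (restrict (\<alpha> \<circ> \<sigma>) {..k}) y"
      using B.pull_cong[OF ord_maps_comp[OF z(4) \<alpha>] y, of "restrict (\<alpha> \<circ> \<sigma>) {..k}"]
        B.pull_comp[OF z(4) \<alpha> y] by auto
    then show "cyl_transpose B W m (pull B m n \<alpha> y) k z
        = pull (map_space (std_simplex 1) C) m n \<alpha> (cyl_transpose B W n y) k z"
      using z std_simplex_postcomp[OF \<alpha> z(3)]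
      by (simp add: cyl_transpose_apply map_space_pull_apply)
  qed
  then show "(\<beta> m (pull B m n \<alpha> y), cyl_transpose B W m (pull B m n \<alpha> y), \<gamma> m (pull B m n \<alpha> y)) =
       pull (comma X f Y g C) m n \<alpha> (\<beta> n y, cyl_transpose B W n y, \<gamma> n y)"
    by (simp add: comma_pull smap_pull[OF \<beta> \<alpha> y] smap_pull[OF \<gamma> \<alpha> y])
qed

section \<open>Extending maps along cylinders\<close>

text \<open>A simplicial subset of \<open>Z\<close>, kept as a bare family of sets so that unions
  are immediate; a map defined on it is an \<open>smap\<close> out of \<open>Z\<close> with its
  \<open>simplices\<close> replaced.\<close>

definition sieve :: "'z sset \<Rightarrow> (nat \<Rightarrow> 'z set) \<Rightarrow> bool" where
  "sieve Z P \<longleftrightarrow> (\<forall>k. P k \<subseteq> simplices Z k) \<and>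
    (\<forall>m k. \<forall>\<alpha>\<in>ord_maps m k. \<forall>z\<in>P k. pull Z m k \<alpha> z \<in> P m)"

definition generated :: "'z sset \<Rightarrow> nat \<Rightarrow> 'z set \<Rightarrow> nat \<Rightarrow> 'z set" where
  "generated Z m X k = {pull Z k m \<alpha> x | \<alpha> x. \<alpha> \<in> ord_maps k m \<and> x \<in> X}"

lemma sieve_subset: "sieve Z P \<Longrightarrow> z \<in> P k \<Longrightarrow> z \<in> simplices Z k"
  by (auto simp: sieve_def)

lemma sieve_pull: "sieve Z P \<Longrightarrow> \<alpha> \<in> ord_maps m k \<Longrightarrow> z \<in> P k \<Longrightarrow> pull Z m k \<alpha> z \<in> P m"
  by (auto simp: sieve_def)

lemma generatedI: "\<alpha> \<in> ord_maps k m \<Longrightarrow> x \<in> X \<Longrightarrow> pull Z k m \<alpha> x \<in> generated Z m X k"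
  by (auto simp: generated_def)

lemma sieve_generated:
  assumes "simplicial_set Z" "X \<subseteq> simplices Z m"
  shows "sieve Z (generated Z m X)"
proof -
  interpret Z: simplicial_set Z by fact
  show ?thesis
    unfolding sieve_def generated_def
  proof (safe)
    fix k l \<beta> \<alpha> x assume *: "\<beta> \<in> ord_maps l k" "\<alpha> \<in> ord_maps k m" "x \<in> X"
    then have "pull Z l k \<beta> (pull Z k m \<alpha> x) = pull Z l m (\<alpha> \<circ> \<beta>) x"
      using assms(2) by (simp add: Z.pull_comp subset_iff)
    then show "\<exists>\<alpha>' x'. pull Z l k \<beta> (pull Z k m \<alpha> x) = pull Z l m \<alpha>' x' \<and> \<alpha>' \<in> ord_maps l m \<and> x' \<in> X"
      using * ord_maps_comp by blast
  qed (use assms Z.pull_closed in blast)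
qed

lemma sieve_Un: "sieve Z P \<Longrightarrow> sieve Z Q \<Longrightarrow> sieve Z (\<lambda>k. P k \<union> Q k)"
  unfolding sieve_def by (auto 0 3)

lemma sieve_UN: "(\<And>i. i \<in> I \<Longrightarrow> sieve Z (P i)) \<Longrightarrow> sieve Z (\<lambda>k. \<Union>i\<in>I. P i k)"
  unfolding sieve_def[of Z "\<lambda>k. \<Union>i\<in>I. P i k"] by (blast dest: sieve_subset intro: sieve_pull)

lemma smap_sieve_mono:
  "smap f (Z\<lparr>simplices := Q\<rparr>) N \<Longrightarrow> (\<And>k. P k \<subseteq> Q k) \<Longrightarrow> smap f (Z\<lparr>simplices := P\<rparr>) N"
  by (fastforce simp: smap_def)

text \<open>The simplices \<open>X\<close> are glued to \<open>P\<close> with prescribed values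
  \<open>e\<close>. On \<alpha>-pullbacks the value has to be the \<alpha>-pullback of
  \<open>e x\<close>; \<open>compat\<close> makes this agree with \<phi> on \<open>P\<close>, and
  \<open>uniq\<close> makes it independent of the presentation elsewhere.\<close>

lemma attach_simplices:
  assumes Z: "simplicial_set Z" and N: "simplicial_set N" and P: "sieve Z P"
    and X: "X \<subseteq> simplices Z m" and e: "\<And>x. x \<in> X \<Longrightarrow> e x \<in> simplices N m"
    and \<phi>: "smap \<phi> (Z\<lparr>simplices := P\<rparr>) N"
    and compat: "\<And>x k \<alpha>. x \<in> X \<Longrightarrow> \<alpha> \<in> ord_maps k m \<Longrightarrow> pull Z k m \<alpha> x \<in> P k \<Longrightarrow>
      \<phi> k (pull Z k m \<alpha> x) = pull N k m \<alpha> (e x)"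
    and uniq: "\<And>x x' k \<alpha> \<beta>. x \<in> X \<Longrightarrow> x' \<in> X \<Longrightarrow> \<alpha> \<in> ord_maps k m \<Longrightarrow> \<beta> \<in> ord_maps k m \<Longrightarrow>
      pull Z k m \<alpha> x = pull Z k m \<beta> x' \<Longrightarrow> pull Z k m \<alpha> x \<notin> P k \<Longrightarrow> x = x' \<and> (\<forall>t\<le>k. \<alpha> t = \<beta> t)"
  shows "\<exists>\<phi>'. smap \<phi>' (Z\<lparr>simplices := \<lambda>k. P k \<union> generated Z m X k\<rparr>) N \<and> (\<forall>k. \<forall>z\<in>P k. \<phi>' k z = \<phi> k z)"
proof -
  interpret Z: simplicial_set Z by fact
  interpret N: simplicial_set N by fact
  define \<phi>' where "\<phi>' k z = (if z \<in> P k then \<phi> k z else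
    (case SOME (\<alpha>, x). \<alpha> \<in> ord_maps k m \<and> x \<in> X \<and> z = pull Z k m \<alpha> x of (\<alpha>, x) \<Rightarrow> pull N k m \<alpha> (e x)))" for k z
  have gen: "\<phi>' k (pull Z k m \<alpha> x) = pull N k m \<alpha> (e x)" if \<alpha>: "\<alpha> \<in> ord_maps k m" and x: "x \<in> X" for k \<alpha> x
  proof (cases "pull Z k m \<alpha> x \<in> P k")
    case True
    then show ?thesis by (simp add: \<phi>'_def compat[OF x \<alpha>])
  next
    case False
    obtain \<beta> y where some: "(SOME (\<beta>, y). \<beta> \<in> ord_maps k m \<and> y \<in> X \<and> pull Z k m \<alpha> x = pull Z k m \<beta> y) = (\<beta>, y)"
      by (rule prod.exhaust)
    have "\<exists>p. case p of (\<beta>, y) \<Rightarrow> \<beta> \<in> ord_maps k m \<and> y \<in> X \<and> pull Z k m \<alpha> x = pull Z k m \<beta> y"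
      using \<alpha> x by auto
    from someI_ex[OF this] have \<beta>: "\<beta> \<in> ord_maps k m" "y \<in> X" "pull Z k m \<alpha> x = pull Z k m \<beta> y"
      by (simp_all add: some)
    from uniq[OF x \<beta>(2) \<alpha> \<beta>(1) \<beta>(3) False] have "y = x" "\<forall>t\<le>k. \<alpha> t = \<beta> t" by auto
    then have "pull N k m \<beta> (e y) = pull N k m \<alpha> (e x)"
      using N.pull_cong[OF \<alpha> e[OF x], of \<beta>] by simp
    then show ?thesis using False by (simp add: \<phi>'_def some)
  qed
  have old: "z \<in> P k \<Longrightarrow> \<phi>' k z = \<phi> k z" for k z by (simp add: \<phi>'_def)
  have "smap \<phi>' (Z\<lparr>simplices := \<lambda>k. P k \<union> generated Z m X k\<rparr>) N"
  proof (rule smapI)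
    fix k z assume "z \<in> simplices (Z\<lparr>simplices := \<lambda>k. P k \<union> generated Z m X k\<rparr>) k"
    then show "\<phi>' k z \<in> simplices N k"
      using smap_closed[OF \<phi>, of z k] by (auto simp: old gen generated_def N.pull_closed e)
  next
    fix l k \<alpha> z assume \<alpha>: "\<alpha> \<in> ord_maps l k"
      and z: "z \<in> simplices (Z\<lparr>simplices := \<lambda>k. P k \<union> generated Z m X k\<rparr>) k"
    from z consider "z \<in> P k" | \<beta> x where "\<beta> \<in> ord_maps k m" "x \<in> X" "z = pull Z k m \<beta> x"
      by (auto simp: generated_def)
    then show "\<phi>' l (pull (Z\<lparr>simplices := \<lambda>k. P k \<union> generated Z m X k\<rparr>) l k \<alpha> z) = pull N l k \<alpha> (\<phi>' k z)"
    proof cases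
      case 1
      then show ?thesis using smap_pull[OF \<phi> \<alpha>, of z] by (simp add: old sieve_pull[OF P \<alpha>])
    next
      case 2
      have "pull Z l k \<alpha> z = pull Z l m (\<beta> \<circ> \<alpha>) x"
        using 2 X Z.pull_comp[OF \<alpha> 2(1)] by auto
      then show ?thesis
        using 2 gen[OF ord_maps_comp[OF \<alpha> 2(1)] 2(2)] N.pull_comp[OF \<alpha> 2(1) e[OF 2(2)]]
        by (simp add: gen)
    qed
  qed
  with old show ?thesis by blast
qed

text \<open>By \<open>horn\<close>, each new simplex meets \<open>P\<close> exactly in its
  \<open>i\<close>-th horn, so \<phi> defines a horn in \<open>N\<close> for it. The fillers, chosen
  separately for each \<open>x\<close>, supply the values that \<open>attach_simplices\<close>
  requires.\<close>

lemma attach_along_horn: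
  assumes Z: "simplicial_set Z" and N: "simplicial_set N" and P: "sieve Z P"
    and X: "X \<subseteq> simplices Z m" and fill: "fills_horn N m i"
    and \<phi>: "smap \<phi> (Z\<lparr>simplices := P\<rparr>) N"
    and horn: "\<And>x k \<alpha>. x \<in> X \<Longrightarrow> \<alpha> \<in> ord_maps k m \<Longrightarrow>
      pull Z k m \<alpha> x \<in> P k \<longleftrightarrow> (\<exists>v\<le>m. v \<noteq> i \<and> v \<notin> \<alpha> ` {..k})"
    and uniq: "\<And>x x' k \<alpha> \<beta>. x \<in> X \<Longrightarrow> x' \<in> X \<Longrightarrow> \<alpha> \<in> ord_maps k m \<Longrightarrow> \<beta> \<in> ord_maps k m \<Longrightarrow>
      pull Z k m \<alpha> x = pull Z k m \<beta> x' \<Longrightarrow> pull Z k m \<alpha> x \<notin> P k \<Longrightarrow> x = x' \<and> (\<forall>t\<le>k. \<alpha> t = \<beta> t)"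
  shows "\<exists>\<phi>'. smap \<phi>' (Z\<lparr>simplices := \<lambda>k. P k \<union> generated Z m X k\<rparr>) N \<and> (\<forall>k. \<forall>z\<in>P k. \<phi>' k z = \<phi> k z)"
proof -
  interpret Z: simplicial_set Z by fact
  interpret N: simplicial_set N by fact
  have ex: "\<exists>e\<in>simplices N m. \<forall>k. \<forall>\<alpha>\<in>ord_maps k m. pull Z k m \<alpha> x \<in> P k \<longrightarrow>
      \<phi> k (pull Z k m \<alpha> x) = pull N k m \<alpha> e" if x: "x \<in> X" for x
  proof -
    have xm: "x \<in> simplices Z m" using x X by auto
    have "smap (\<lambda>k \<tau>. \<phi> k (pull Z k m \<tau> x)) (horn m i) N"
    proof (rule smapI)
      fix k \<tau> assume "\<tau> \<in> simplices (horn m i) k"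
      then show "\<phi> k (pull Z k m \<tau> x) \<in> simplices N k"
        using horn[OF x, of \<tau> k] by (auto simp: horn_def std_simplex_iff intro!: smap_closed[OF \<phi>])
    next
      fix l k \<alpha> \<tau> assume \<alpha>: "\<alpha> \<in> ord_maps l k" and "\<tau> \<in> simplices (horn m i) k"
      then have \<tau>: "\<tau> \<in> ord_maps k m" and "pull Z k m \<tau> x \<in> P k"
        using horn[OF x, of \<tau> k] by (auto simp: horn_def std_simplex_iff)
      moreover have "pull Z l m (restrict (\<tau> \<circ> \<alpha>) {..l}) x = pull Z l k \<alpha> (pull Z k m \<tau> x)"
        using Z.pull_cong[OF ord_maps_comp[OF \<alpha> \<tau>] xm, of "restrict (\<tau> \<circ> \<alpha>) {..l}"]
          Z.pull_comp[OF \<alpha> \<tau> xm] by simp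
      ultimately show "\<phi> l (pull Z l m (pull (horn m i) l k \<alpha> \<tau>) x) = pull N l k \<alpha> (\<phi> k (pull Z k m \<tau> x))"
        using smap_pull[OF \<phi> \<alpha>, of "pull Z k m \<tau> x"] by (simp add: horn_def std_simplex_pull)
    qed
    with fill obtain w where w: "smap w (std_simplex m) N"
      and wu: "\<And>k \<tau>. \<tau> \<in> simplices (horn m i) k \<Longrightarrow> w k \<tau> = \<phi> k (pull Z k m \<tau> x)"
      unfolding fills_horn_def by blast
    \<comment> \<open>This is the nondegenerate \<open>m\<close>-simplex of \<Delta>[m]; its image
      under the filler is the simplex of \<open>N\<close> that \<open>w\<close> classifies.\<close>
    have id: "restrict id {..m} \<in> simplices (std_simplex m) m"
      by (intro restrict_std_simplex id_ord_maps) simp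
    show ?thesis
    proof (intro bexI ballI allI impI)
      show "w m (restrict id {..m}) \<in> simplices N m" by (rule smap_closed[OF w id])
      fix k \<alpha> assume \<alpha>: "\<alpha> \<in> ord_maps k m" and "pull Z k m \<alpha> x \<in> P k"
      then have h: "restrict \<alpha> {..k} \<in> simplices (horn m i) k"
        using horn[OF x \<alpha>] restrict_std_simplex[OF \<alpha>] by (auto simp: horn_def)
      have "restrict (restrict id {..m} \<circ> \<alpha>) {..k} = restrict \<alpha> {..k}"
        using ord_maps_le[OF \<alpha>] by (auto simp: fun_eq_iff)
      moreover have "pull Z k m (restrict \<alpha> {..k}) x = pull Z k m \<alpha> x"
        using Z.pull_cong[OF \<alpha> xm, of "restrict \<alpha> {..k}"] by simp
      ultimately show "\<phi> k (pull Z k m \<alpha> x) = pull N k m \<alpha> (w m (restrict id {..m}))"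
        using smap_pull[OF w \<alpha> id] wu[OF h] by (simp add: std_simplex_pull)
    qed
  qed
  then obtain e where e: "\<And>x. x \<in> X \<Longrightarrow> e x \<in> simplices N m"
      "\<And>x k \<alpha>. x \<in> X \<Longrightarrow> \<alpha> \<in> ord_maps k m \<Longrightarrow> pull Z k m \<alpha> x \<in> P k \<Longrightarrow>
        \<phi> k (pull Z k m \<alpha> x) = pull N k m \<alpha> (e x)" by metis
  show ?thesis by (rule attach_simplices[OF Z N P X e(1) \<phi> e(2) uniq])
qed

text \<open>A chain in the product of two ordinals extends to a maximal chain. Maximal chains in
  \<Delta>[1] x \<Delta>[n] are indexed by the level \<open>i\<close> at which they change
  sides.\<close>

lemma prism_factor:
  assumes \<tau>: "\<tau> \<in> ord_maps k 1" and \<beta>: "\<beta> \<in> ord_maps k n"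
  obtains i \<alpha> where "i \<le> n" "\<alpha> \<in> ord_maps k (Suc n)"
    "\<And>t. t \<le> k \<Longrightarrow> codegen i (\<alpha> t) = \<beta> t" "\<And>t. t \<le> k \<Longrightarrow> \<alpha> t \<le> i \<longleftrightarrow> \<tau> t = 0"
proof -
  \<comment> \<open>A suitable level is the second coordinate of the first vertex on side 1, or
    \<open>n\<close> if the chain stays on side 0.\<close>
  have "\<exists>i\<le>n. \<forall>t\<le>k. if \<tau> t = 0 then \<beta> t \<le> i else i \<le> \<beta> t"
  proof (cases "\<exists>t\<le>k. \<tau> t \<noteq> 0")
    case True
    define s where "s = (LEAST t. t \<le> k \<and> \<tau> t \<noteq> 0)"
    have s: "s \<le> k" "\<tau> s \<noteq> 0" using LeastI_ex[OF True] by (auto simp: s_def)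
    have "if \<tau> t = 0 then \<beta> t \<le> \<beta> s else \<beta> s \<le> \<beta> t" if t: "t \<le> k" for t
    proof (cases "\<tau> t = 0")
      case True
      then have "t \<le> s" using ord_maps_mono[OF \<tau>, of s t] t s by force
      with True show ?thesis using ord_maps_mono[OF \<beta>, of t s] s(1) by simp
    next
      case False
      then have "s \<le> t" unfolding s_def by (intro Least_le) (use t in simp)
      with False show ?thesis using ord_maps_mono[OF \<beta>, of s t] t by simp
    qed
    then show ?thesis using ord_maps_le[OF \<beta> s(1)] by blast
  qed (use ord_maps_le[OF \<beta>] in auto)
  then obtain i where i: "i \<le> n" "\<And>t. t \<le> k \<Longrightarrow> if \<tau> t = 0 then \<beta> t \<le> i else i \<le> \<beta> t"
    by blast
  \<comment> \<open>Shifting the vertices of side 1 by one undoes the collapse by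
    \<open>codegen i\<close> and makes the side visible as a comparison of \<alpha> with
    \<open>i\<close>.\<close>
  define \<alpha> where "\<alpha> t = (if \<tau> t = 0 then \<beta> t else Suc (\<beta> t))" for t
  show ?thesis
  proof (rule that[OF i(1), of \<alpha>])
    show "\<alpha> \<in> ord_maps k (Suc n)"
    proof (rule ord_mapsI)
      fix t u assume "t \<le> u" "u \<le> k"
      then show "\<alpha> t \<le> \<alpha> u"
        using ord_maps_mono[OF \<beta>, of t u] ord_maps_mono[OF \<tau>, of t u] by (auto simp: \<alpha>_def)
    qed (use ord_maps_le[OF \<beta>] in \<open>auto simp: \<alpha>_def le_SucI\<close>)
    show "t \<le> k \<Longrightarrow> codegen i (\<alpha> t) = \<beta> t" for t
      using i(2)[of t] by (auto simp: \<alpha>_def codegen_def split: if_splits)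
    show "t \<le> k \<Longrightarrow> \<alpha> t \<le> i \<longleftrightarrow> \<tau> t = 0" for t
      using i(2)[of t] by (auto simp: \<alpha>_def split: if_splits)
  qed
qed

text \<open>\<open>B x {0}\<close> united with \<open>A x \<Delta>[1]\<close>, the domain of a
  homotopy extension problem.\<close>

definition cyl_sieve :: "'b sset \<Rightarrow> (nat \<Rightarrow> 'b set) \<Rightarrow> nat \<Rightarrow> ('b \<times> (nat \<Rightarrow> nat)) set" where
  "cyl_sieve B A k = {(y, \<tau>) \<in> simplices (sprod B (std_simplex 1)) k. y \<in> A k \<or> (\<forall>t\<le>k. \<tau> t = 0)}"

lemma sieve_cyl_sieve:
  assumes B: "simplicial_set B" and A: "sieve B A"
  shows "sieve (sprod B (std_simplex 1)) (cyl_sieve B A)"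
proof -
  interpret Z: simplicial_set "sprod B (std_simplex 1)"
    by (rule simplicial_set_sprod[OF B simplicial_set_std_simplex])
  show ?thesis
    unfolding sieve_def
  proof (intro conjI allI ballI)
    fix m k \<alpha> z assume \<alpha>: "\<alpha> \<in> ord_maps m k" and z: "z \<in> cyl_sieve B A k"
    then show "pull (sprod B (std_simplex 1)) m k \<alpha> z \<in> cyl_sieve B A m"
      using Z.pull_closed[OF \<alpha>, of z] sieve_pull[OF A \<alpha>] ord_maps_le[OF \<alpha>]
      by (cases z) (auto simp: cyl_sieve_def sprod_pull std_simplex_pull)
  qed (auto simp: cyl_sieve_def)
qed

section \<open>Filling prisms over cells of least dimension\<close>

text \<open>All simplices below dimension \<open>n\<close> are in \<open>A\<close>, so an
  \<open>n\<close>-simplex outside \<open>A\<close> is nondegenerate and has its whole boundary in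
  \<open>A\<close>. Such simplices are the cells to be attached next.\<close>

locale minimal_cells = simplicial_set B for B :: "'b sset" +
  fixes A :: "nat \<Rightarrow> 'b set" and n :: nat
  assumes A: "sieve B A" and lower: "\<And>k. k < n \<Longrightarrow> simplices B k \<subseteq> A k"
begin

text \<open>A map missing \<open>v\<close> factors through the face opposite \<open>v\<close>, which
  has dimension \<open>n - 1\<close> and hence lies in \<open>A\<close>. For \<open>n = 0\<close> no
  vertex can be missed.\<close>

lemma nonsurj_in:
  assumes \<alpha>: "\<alpha> \<in> ord_maps k n" and x: "x \<in> simplices B n" and v: "v \<le> n" "v \<notin> \<alpha> ` {..k}"
  shows "pull B k n \<alpha> x \<in> A k"
proof (cases n)
  case 0
  with v ord_maps_le[OF \<alpha>, of 0] show ?thesis by auto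
next
  case (Suc n')
  let ?\<alpha> = "\<lambda>t. if \<alpha> t < v then \<alpha> t else \<alpha> t - 1"
  have skip: "\<And>s. s \<le> k \<Longrightarrow> \<alpha> s \<noteq> v" using v(2) by auto
  note \<alpha>' = ord_maps_skip[OF \<alpha>[unfolded Suc] skip v(1)[unfolded Suc], simplified]
  have "pull B k n \<alpha> x = pull B k n (coface v \<circ> ?\<alpha>) x"
    by (rule pull_cong[OF \<alpha> x]) (simp add: \<alpha>'(2)[symmetric])
  also have "\<dots> = pull B k n' ?\<alpha> (pull B n' n (coface v) x)"
    unfolding Suc by (rule pull_comp[OF \<alpha>'(1) coface_ord_maps x[unfolded Suc]])
  also have "\<dots> \<in> A k"
    by (rule sieve_pull[OF A \<alpha>'(1)])
      (use lower[of n'] pull_closed[OF coface_ord_maps x[unfolded Suc]] Suc in auto)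
  finally show ?thesis .
qed

text \<open>Pulling back along a section of \<alpha> recovers \<open>x\<close>, so membership in
  \<open>A\<close> would pass back to \<open>x\<close> itself.\<close>

lemma surj_not_in:
  assumes \<alpha>: "\<alpha> \<in> ord_maps k n" and x: "x \<in> simplices B n" "x \<notin> A n"
    and surj: "\<And>v. v \<le> n \<Longrightarrow> v \<in> \<alpha> ` {..k}"
  shows "pull B k n \<alpha> x \<notin> A k"
proof
  assume *: "pull B k n \<alpha> x \<in> A k"
  have "\<And>v. v \<le> n \<Longrightarrow> \<exists>s\<le>k. \<alpha> s = v" using surj by force
  then obtain \<delta> where \<delta>: "\<delta> \<in> ord_maps n k" "\<And>v. v \<le> n \<Longrightarrow> \<alpha> (\<delta> v) = v"
    using ord_maps_section[OF \<alpha>, of 0] by blast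
  have "x = pull B n n (\<alpha> \<circ> \<delta>) x"
    using pull_cong[OF ord_maps_comp[OF \<delta>(1) \<alpha>] x(1), of id] pull_id[OF x(1)] \<delta>(2) by simp
  also have "\<dots> = pull B n k \<delta> (pull B k n \<alpha> x)" by (rule pull_comp[OF \<delta>(1) \<alpha> x(1)])
  finally have "x \<in> A n" using sieve_pull[OF A \<delta>(1) *] by simp
  with x(2) show False ..
qed

text \<open>If two presentations of one simplex differed, composing with a section of one of them would
  express its cell through a proper face.\<close>

lemma presentation_unique:
  assumes \<alpha>: "\<alpha> \<in> ord_maps k n" and \<beta>: "\<beta> \<in> ord_maps k n"
    and x: "x \<in> simplices B n" and y: "y \<in> simplices B n" "y \<notin> A n"
    and eq: "pull B k n \<alpha> x = pull B k n \<beta> y" and notin: "pull B k n \<alpha> x \<notin> A k"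
  shows "x = y \<and> (\<forall>t\<le>k. \<alpha> t = \<beta> t)"
proof -
  have surj: "\<exists>s\<le>k. \<beta> s = v" if "v \<le> n" for v
    using nonsurj_in[OF \<beta> y(1) that] eq notin by force
  have main: "x = y \<and> \<alpha> t = \<beta> t" if t: "t \<le> k" for t
  proof -
    \<comment> \<open>The section passes through \<open>t\<close>, so that once
      \<open>\<alpha> \<circ> \<delta>\<close> is known to be the identity, its value at
      \<open>\<beta> t\<close> reads \<open>\<alpha> t = \<beta> t\<close>.\<close>
    obtain \<delta> where \<delta>: "\<delta> \<in> ord_maps n k" "\<And>v. v \<le> n \<Longrightarrow> \<beta> (\<delta> v) = v" "\<delta> (\<beta> t) = t"
      using ord_maps_section[OF \<beta> surj t] by blast
    note \<alpha>\<delta> = ord_maps_comp[OF \<delta>(1) \<alpha>]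
    have "y = pull B n n (\<beta> \<circ> \<delta>) y"
      using pull_cong[OF ord_maps_comp[OF \<delta>(1) \<beta>] y(1), of id] pull_id[OF y(1)] \<delta>(2) by simp
    also have "\<dots> = pull B n k \<delta> (pull B k n \<alpha> x)"
      by (simp add: pull_comp[OF \<delta>(1) \<beta> y(1)] eq)
    also have "\<dots> = pull B n n (\<alpha> \<circ> \<delta>) x" by (rule pull_comp[OF \<delta>(1) \<alpha> x, symmetric])
    finally have y': "y = pull B n n (\<alpha> \<circ> \<delta>) x" .
    have "\<exists>s\<le>n. (\<alpha> \<circ> \<delta>) s = v" if "v \<le> n" for v
      using nonsurj_in[OF \<alpha>\<delta> x that] y(2) y' by force
    then have id: "s \<le> n \<Longrightarrow> (\<alpha> \<circ> \<delta>) s = s" for s by (rule ord_maps_endo_surj_id[OF \<alpha>\<delta>])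
    have "y = x" using y' pull_cong[OF \<alpha>\<delta> x, of id] pull_id[OF x] id by simp
    moreover have "\<alpha> t = \<beta> t" using id[OF ord_maps_le[OF \<beta> t]] \<delta>(3) by simp
    ultimately show ?thesis by simp
  qed
  from main[of 0] main show ?thesis by simp
qed

abbreviation "cyl \<equiv> sprod B (std_simplex 1)"

text \<open>The maximal simplex of the prism over \<open>x\<close> that changes sides after its
  vertex \<open>i\<close>. It is the product of \<open>x\<close> and \<Delta>[1] applied to
  \<open>prism_simplex n (Suc i)\<close>.\<close>

definition cell :: "nat \<Rightarrow> 'b \<Rightarrow> 'b \<times> (nat \<Rightarrow> nat)" where
  "cell i x = (pull B (Suc n) n (codegen i) x, restrict (\<lambda>t. if t \<le> i then 0 else 1) {..Suc n})"

text \<open>Indices decrease while filling: \<open>stage (Suc n)\<close> is just the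
  \<open>cyl_sieve\<close>, because the index range is then empty, and \<open>stage 0\<close>
  contains the prisms over all new cells.\<close>

definition stage :: "nat \<Rightarrow> nat \<Rightarrow> ('b \<times> (nat \<Rightarrow> nat)) set" where
  "stage i k = cyl_sieve B A k \<union> (\<Union>j\<in>{i..n}. generated cyl (Suc n) (cell j ` (simplices B n - A n)) k)"

lemma cell_simplex: "i \<le> n \<Longrightarrow> x \<in> simplices B n \<Longrightarrow> cell i x \<in> simplices cyl (Suc n)"
  by (simp add: cell_def sprod_iff codegen_ord_maps pull_closed restrict_std_simplex ord_mapsI)

lemma pull_cell:
  assumes "i \<le> n" "\<alpha> \<in> ord_maps k (Suc n)" "x \<in> simplices B n"
  shows "pull cyl k (Suc n) \<alpha> (cell i x) =
    (pull B k n (codegen i \<circ> \<alpha>) x, restrict (\<lambda>t. if \<alpha> t \<le> i then 0 else 1) {..k})"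
  using assms pull_comp[OF assms(2) codegen_ord_maps[OF assms(1)] assms(3)] ord_maps_le[OF assms(2)]
  by (auto simp: cell_def sprod_pull std_simplex_pull)

text \<open>The prism over an \<open>n\<close>-cell is filled by \<open>cell n, \<dots>, cell 0\<close> in this order. The face of \<open>cell i\<close> opposite
  to its vertex \<open>i\<close> is shared with \<open>cell (i - 1)\<close>, or is the free end \<open>\<tau> = 1\<close> if \<open>i = 0\<close>; all other faces
  are present already, so \<open>cell i\<close> is attached along the \<open>i\<close>-th horn.\<close>

lemma cell_face_iff:
  assumes i: "i \<le> n" and \<alpha>: "\<alpha> \<in> ord_maps k (Suc n)" and x: "x \<in> simplices B n" "x \<notin> A n"
  shows "pull cyl k (Suc n) \<alpha> (cell i x) \<in> stage (Suc i) k \<longleftrightarrow>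
    (\<exists>v\<le>Suc n. v \<noteq> i \<and> v \<notin> \<alpha> ` {..k})" (is "?z \<in> _ \<longleftrightarrow> ?R")
proof
  note s = ord_maps_comp[OF \<alpha> codegen_ord_maps[OF i]]
  interpret Z: simplicial_set cyl
    by (rule simplicial_set_sprod[OF simplicial_set_axioms simplicial_set_std_simplex])
  have z: "?z \<in> simplices cyl k" by (rule Z.pull_closed[OF \<alpha> cell_simplex[OF i x(1)]])
  have inA: "pull B k n (codegen i \<circ> \<alpha>) x \<in> A k \<Longrightarrow> ?z \<in> stage (Suc i) k"
    using z by (simp add: stage_def cyl_sieve_def pull_cell[OF i \<alpha> x(1)])
  assume ?R
  then obtain v where v: "v \<le> Suc n" "v \<noteq> i" "\<And>t. t \<le> k \<Longrightarrow> \<alpha> t \<noteq> v" by auto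
  \<comment> \<open>If \<open>v\<close> is neither \<open>i\<close> nor \<open>Suc i\<close>, then
    \<open>codegen i \<circ> \<alpha>\<close> misses a vertex and the base coordinate falls into
    \<open>A\<close>. If \<open>v = Suc i\<close>, the face lies on the bottom for
    \<open>i = n\<close> and is shared with the next cell otherwise.\<close>
  consider "v < i" | "v = Suc i" "i = n" | "v = Suc i" "i < n" | "Suc i < v" using v(1,2) i by linarith
  then show "?z \<in> stage (Suc i) k"
  proof cases
    case 1
    have "v \<notin> (codegen i \<circ> \<alpha>) ` {..k}" using v(3) 1 by (auto simp: codegen_def split: if_splits)
    then show ?thesis using inA nonsurj_in[OF s x(1), of v] 1 i by simp
  next
    case 2
    then have "\<forall>t\<le>k. \<alpha> t \<le> i" using v(3) ord_maps_le[OF \<alpha>] by (metis le_SucE)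
    then show ?thesis using z by (simp add: stage_def cyl_sieve_def pull_cell[OF i \<alpha> x(1)])
  next
    case 3
    have eq: "(codegen i \<circ> \<alpha>) t = (codegen (Suc i) \<circ> \<alpha>) t" "\<alpha> t \<le> i \<longleftrightarrow> \<alpha> t \<le> Suc i" if "t \<le> k" for t
      using v(3)[OF that] 3(1) by (auto simp: codegen_def)
    have "pull B k n (codegen i \<circ> \<alpha>) x = pull B k n (codegen (Suc i) \<circ> \<alpha>) x"
      by (rule pull_cong[OF s x(1) eq(1)])
    then have "?z = pull cyl k (Suc n) \<alpha> (cell (Suc i) x)"
      using 3(2) eq(2) by (auto simp: pull_cell[OF i \<alpha> x(1)] pull_cell[OF _ \<alpha> x(1)] fun_eq_iff)
    moreover have "pull cyl k (Suc n) \<alpha> (cell (Suc i) x) \<in>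
        generated cyl (Suc n) (cell (Suc i) ` (simplices B n - A n)) k"
      using x by (intro generatedI \<alpha>) auto
    ultimately show ?thesis using 3(2) by (auto simp: stage_def)
  next
    case 4
    have "v - 1 \<notin> (codegen i \<circ> \<alpha>) ` {..k}"
    proof
      assume "v - 1 \<in> (codegen i \<circ> \<alpha>) ` {..k}"
      then obtain t where t: "t \<le> k" "v - 1 = codegen i (\<alpha> t)" by auto
      with 4 have "\<alpha> t = v" by (simp add: codegen_def split: if_splits)
      with v(3)[OF t(1)] show False ..
    qed
    then show ?thesis using inA nonsurj_in[OF s x(1), of "v - 1"] v(1) by simp
  qed
next
  note s = ord_maps_comp[OF \<alpha> codegen_ord_maps[OF i]]
  assume L: "?z \<in> stage (Suc i) k"
  show ?R
  proof (rule ccontr)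
    assume "\<not> ?R"
    then have hit: "\<exists>t\<le>k. \<alpha> t = v" if "v \<le> Suc n" "v \<noteq> i" for v using that by force
    have "v \<in> (codegen i \<circ> \<alpha>) ` {..k}" if "v \<le> n" for v
    proof -
      \<comment> \<open>Vertices \<open>i\<close> and \<open>Suc i\<close> collapse to the same
        vertex. Taking \<open>Suc v\<close> when \<open>v = i\<close> avoids vertex
        \<open>i\<close>, the only one that \<alpha> may miss.\<close>
      have "\<exists>t\<le>k. \<alpha> t = (if v < i then v else Suc v)" using that by (intro hit) auto
      then obtain t where "t \<le> k" "\<alpha> t = (if v < i then v else Suc v)" by blast
      then show ?thesis by (intro image_eqI[of _ _ t]) (auto simp: codegen_def)
    qed
    then have notA: "pull B k n (codegen i \<circ> \<alpha>) x \<notin> A k" by (rule surj_not_in[OF s x])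
    obtain t where "t \<le> k" "\<alpha> t = Suc n" using hit[of "Suc n"] i by auto
    with i have "\<not> (\<forall>t\<le>k. \<alpha> t \<le> i)" by auto
    with notA have "?z \<notin> cyl_sieve B A k" by (auto simp: cyl_sieve_def pull_cell[OF i \<alpha> x(1)])
    with L obtain j \<beta> y where j: "Suc i \<le> j" "j \<le> n" and \<beta>: "\<beta> \<in> ord_maps k (Suc n)"
      and y: "y \<in> simplices B n" "y \<notin> A n" and eq: "?z = pull cyl k (Suc n) \<beta> (cell j y)"
      by (auto simp: stage_def generated_def)
    have eq': "pull B k n (codegen i \<circ> \<alpha>) x = pull B k n (codegen j \<circ> \<beta>) y"
      and eq1: "\<And>t. t \<le> k \<Longrightarrow> \<alpha> t \<le> i \<longleftrightarrow> \<beta> t \<le> j"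
      using eq by (auto simp: pull_cell[OF i \<alpha> x(1)] pull_cell[OF j(2) \<beta> y(1)] fun_eq_iff restrict_def
          split: if_splits)
    \<comment> \<open>This vertex is on side 1 with base vertex \<open>i\<close>. In a cell of
      larger index \<open>j\<close>, a vertex on side 1 has base vertex at least \<open>j\<close>,
      so the two presentations cannot agree.\<close>
    obtain t where t: "t \<le> k" "\<alpha> t = Suc i" using hit[of "Suc i"] i by auto
    have "codegen i (\<alpha> t) = codegen j (\<beta> t)"
      using presentation_unique[OF s ord_maps_comp[OF \<beta> codegen_ord_maps[OF j(2)]] x(1) y eq' notA] t(1)
      by auto
    then show False using eq1[OF t(1)] t(2) j(1) by (auto simp: codegen_def split: if_splits)
  qed
qed

text \<open>The cells of one index are attached simultaneously. Outside the previous stage the base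
  coordinate lies outside \<open>A\<close>, so \<open>presentation_unique\<close> applies to it, and
  the side coordinate then determines the map into the cell.\<close>

lemma stage_step:
  assumes N: "kan_complex N" and i: "i \<le> n" and \<phi>: "smap \<phi> (cyl\<lparr>simplices := stage (Suc i)\<rparr>) N"
  shows "\<exists>\<phi>'. smap \<phi>' (cyl\<lparr>simplices := stage i\<rparr>) N \<and> (\<forall>k. \<forall>z\<in>stage (Suc i) k. \<phi>' k z = \<phi> k z)"
proof -
  have Z: "simplicial_set cyl"
    by (rule simplicial_set_sprod[OF simplicial_set_axioms simplicial_set_std_simplex])
  let ?X = "cell i ` (simplices B n - A n)"
  have stage: "stage i = (\<lambda>k. stage (Suc i) k \<union> generated cyl (Suc n) ?X k)"
  proof -
    have "{i..n} = insert i {Suc i..n}" using i by auto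
    then show ?thesis by (auto simp: stage_def fun_eq_iff)
  qed
  have sv: "sieve cyl (stage (Suc i))"
    unfolding stage_def[abs_def]
    by (intro sieve_Un sieve_UN sieve_cyl_sieve[OF simplicial_set_axioms A] sieve_generated[OF Z])
      (auto simp: cell_simplex)
  have uniq: "x = x' \<and> (\<forall>t\<le>k. \<alpha> t = \<beta> t)"
    if X: "x \<in> ?X" "x' \<in> ?X" and \<alpha>: "\<alpha> \<in> ord_maps k (Suc n)" and \<beta>: "\<beta> \<in> ord_maps k (Suc n)"
      and eq: "pull cyl k (Suc n) \<alpha> x = pull cyl k (Suc n) \<beta> x'"
      and notin: "pull cyl k (Suc n) \<alpha> x \<notin> stage (Suc i) k" for x x' k \<alpha> \<beta>
  proof -
    obtain y y' where y: "y \<in> simplices B n" "x = cell i y" and y': "y' \<in> simplices B n" "y' \<notin> A n" "x' = cell i y'"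
      using X by auto
    have c: "pull cyl k (Suc n) \<alpha> x \<in> simplices cyl k"
      unfolding y(2) by (rule simplicial_set.pull_closed[OF Z \<alpha> cell_simplex[OF i y(1)]])
    then have "pull B k n (codegen i \<circ> \<alpha>) y \<notin> A k"
      using notin by (simp add: stage_def cyl_sieve_def y pull_cell[OF i \<alpha> y(1)])
    moreover have "pull B k n (codegen i \<circ> \<alpha>) y = pull B k n (codegen i \<circ> \<beta>) y'"
      and eq1: "\<And>t. t \<le> k \<Longrightarrow> \<alpha> t \<le> i \<longleftrightarrow> \<beta> t \<le> i"
      using eq unfolding y(2) y'(3)
      by (auto simp: pull_cell[OF i \<alpha> y(1)] pull_cell[OF i \<beta> y'(1)] fun_eq_iff restrict_def
          split: if_splits)
    ultimately have "y = y' \<and> (\<forall>t\<le>k. (codegen i \<circ> \<alpha>) t = (codegen i \<circ> \<beta>) t)"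
      by (intro presentation_unique[OF ord_maps_comp[OF \<alpha> codegen_ord_maps[OF i]]
            ord_maps_comp[OF \<beta> codegen_ord_maps[OF i]] y(1) y'(1,2)])
    \<comment> \<open>\<open>codegen i\<close> is injective on the vertices up to \<open>i\<close>
      and on those beyond \<open>i\<close>; by \<open>eq1\<close> both maps use the same of these
      two ranges.\<close>
    moreover have "\<alpha> t = \<beta> t" if "codegen i (\<alpha> t) = codegen i (\<beta> t)" "t \<le> k" for t
      using that eq1[OF that(2)] by (auto simp: codegen_def split: if_splits)
    ultimately show ?thesis by (simp add: y y')
  qed
  \<comment> \<open>For \<open>0 < i\<close> these horns are inner; for \<open>i = 0\<close> the
    horn is outer, and its filling rests on \<open>N\<close> being a Kan complex.\<close>
  have fill: "fills_horn N (Suc n) i" "simplicial_set N"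
    using N i by (auto simp: kan_complex_def)
  show ?thesis
    unfolding stage
  proof (rule attach_along_horn[OF Z fill(2) sv _ fill(1) \<phi> _ uniq])
    show "?X \<subseteq> simplices cyl (Suc n)" using cell_simplex[OF i] by auto
    fix x k \<alpha> assume "x \<in> ?X" "\<alpha> \<in> ord_maps k (Suc n)"
    then show "pull cyl k (Suc n) \<alpha> x \<in> stage (Suc i) k \<longleftrightarrow> (\<exists>v\<le>Suc n. v \<noteq> i \<and> v \<notin> \<alpha> ` {..k})"
      using cell_face_iff[OF i] by blast
  qed
qed

text \<open>A simplex that is neither over \<open>A\<close> nor on the bottom lies in the prism over
  a new cell, and \<open>prism_factor\<close> finds a maximal simplex of that prism containing
  it.\<close>

lemma cylinder_covered:
  "cyl_sieve B (\<lambda>k. A k \<union> generated B n (simplices B n - A n) k) k \<subseteq> stage 0 k"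
proof
  fix z assume z: "z \<in> cyl_sieve B (\<lambda>k. A k \<union> generated B n (simplices B n - A n) k) k"
  show "z \<in> stage 0 k"
  proof (cases "z \<in> cyl_sieve B A k")
    case False
    obtain y \<tau> where zy: "z = (y, \<tau>)" by (cases z)
    with z False have "y \<in> generated B n (simplices B n - A n) k"
      and \<tau>: "\<tau> \<in> simplices (std_simplex 1) k" and nz: "\<exists>t\<le>k. \<tau> t \<noteq> 0"
      by (auto simp: cyl_sieve_def sprod_iff)
    then obtain \<beta> x where zx: "z = (pull B k n \<beta> x, \<tau>)" and \<beta>: "\<beta> \<in> ord_maps k n"
      and x: "x \<in> simplices B n" "x \<notin> A n"
      by (auto simp: generated_def zy)
    have \<tau>': "\<tau> \<in> ord_maps k 1" "\<tau> \<in> extensional {..k}" using \<tau> by (auto simp: std_simplex_iff)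
    obtain i \<alpha> where i: "i \<le> n" and \<alpha>: "\<alpha> \<in> ord_maps k (Suc n)"
      and code: "\<And>t. t \<le> k \<Longrightarrow> codegen i (\<alpha> t) = \<beta> t" "\<And>t. t \<le> k \<Longrightarrow> \<alpha> t \<le> i \<longleftrightarrow> \<tau> t = 0"
      using prism_factor[OF \<tau>'(1) \<beta>] by metis
    have "(codegen i \<circ> \<alpha>) t = \<beta> t" if "t \<le> k" for t
      using code(1)[OF that] by simp
    then have "pull B k n (codegen i \<circ> \<alpha>) x = pull B k n \<beta> x"
      by (intro pull_cong[OF ord_maps_comp[OF \<alpha> codegen_ord_maps[OF i]] x(1)])
    moreover have "restrict (\<lambda>t. if \<alpha> t \<le> i then 0 else 1) {..k} = \<tau>"
    proof (rule extensionalityI[where A = "{..k}"])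
      fix t assume t: "t \<in> {..k}"
      then show "restrict (\<lambda>t. if \<alpha> t \<le> i then 0 else 1) {..k} t = \<tau> t"
        using code(2)[of t] ord_maps_le[OF \<tau>'(1), of t] by auto
    qed (use \<tau>'(2) in auto)
    ultimately have "z = pull cyl k (Suc n) \<alpha> (cell i x)"
      by (simp add: zx pull_cell[OF i \<alpha> x(1)])
    then show ?thesis using i x \<alpha> by (auto simp: stage_def intro!: generatedI)
  qed (simp add: stage_def)
qed

lemma extend_over_cells:
  assumes N: "kan_complex N" and \<phi>: "smap \<phi> (cyl\<lparr>simplices := cyl_sieve B A\<rparr>) N"
  shows "\<exists>\<phi>'. smap \<phi>' (cyl\<lparr>simplices := cyl_sieve B (\<lambda>k. A k \<union> generated B n (simplices B n - A n) k)\<rparr>) N \<and>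
    (\<forall>k. \<forall>z\<in>cyl_sieve B A k. \<phi>' k z = \<phi> k z)"
proof -
  have "\<exists>\<phi>'. smap \<phi>' (cyl\<lparr>simplices := stage 0\<rparr>) N \<and> (\<forall>k. \<forall>z\<in>cyl_sieve B A k. \<phi>' k z = \<phi> k z)"
  proof (rule inc_induct[of 0 "Suc n"])
    show "\<exists>\<phi>'. smap \<phi>' (cyl\<lparr>simplices := stage (Suc n)\<rparr>) N \<and> (\<forall>k. \<forall>z\<in>cyl_sieve B A k. \<phi>' k z = \<phi> k z)"
      using \<phi> by (intro exI[of _ \<phi>]) (simp add: stage_def[abs_def])
  next
    fix i assume "i < Suc n"
      and "\<exists>\<phi>'. smap \<phi>' (cyl\<lparr>simplices := stage (Suc i)\<rparr>) N \<and> (\<forall>k. \<forall>z\<in>cyl_sieve B A k. \<phi>' k z = \<phi> k z)"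
    then obtain \<phi>' where \<phi>': "smap \<phi>' (cyl\<lparr>simplices := stage (Suc i)\<rparr>) N"
      "\<And>k z. z \<in> cyl_sieve B A k \<Longrightarrow> \<phi>' k z = \<phi> k z" and i: "i \<le> n" by auto
    from stage_step[OF N i \<phi>'(1)] obtain \<phi>'' where "smap \<phi>'' (cyl\<lparr>simplices := stage i\<rparr>) N"
      "\<And>k z. z \<in> stage (Suc i) k \<Longrightarrow> \<phi>'' k z = \<phi>' k z" by blast
    with \<phi>'(2) show "\<exists>\<phi>'. smap \<phi>' (cyl\<lparr>simplices := stage i\<rparr>) N \<and> (\<forall>k. \<forall>z\<in>cyl_sieve B A k. \<phi>' k z = \<phi> k z)"
      by (intro exI[of _ \<phi>'']) (auto simp: stage_def)
  qed simp
  then show ?thesis using smap_sieve_mono cylinder_covered by blast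
qed

end

section \<open>Homotopy extension into Kan complexes\<close>

text \<open>Extensions over successive relative skeleta are chosen one after another. Values on
  \<open>k\<close>-simplices no longer change from stage \<open>Suc k\<close> on, so the limit is
  read off there.\<close>

theorem homotopy_extension:
  assumes B: "simplicial_set B" and N: "kan_complex N" and A: "sieve B A"
    and \<psi>: "smap \<psi> ((sprod B (std_simplex 1))\<lparr>simplices := cyl_sieve B A\<rparr>) N"
  obtains W where "smap W (sprod B (std_simplex 1)) N"
    "\<And>k z. z \<in> cyl_sieve B A k \<Longrightarrow> W k z = \<psi> k z"
proof -
  interpret B: simplicial_set B by fact
  let ?Z = "sprod B (std_simplex 1)"
  interpret Z: simplicial_set ?Z
    by (rule simplicial_set_sprod[OF B simplicial_set_std_simplex])
  \<comment> \<open>The relative skeleton shifted by one: only dimensions strictly below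
    \<open>n\<close> are added to \<open>A\<close>, so \<open>Sk 0\<close> is \<open>A\<close> and
    \<open>minimal_cells\<close> applies to \<open>Sk n\<close> in dimension
    \<open>n\<close>.\<close>
  define Sk where "Sk n k = A k \<union> (\<Union>d\<in>{..<n}. generated B d (simplices B d) k)" for n k
  have Sk: "sieve B (Sk n)" for n
    unfolding Sk_def[abs_def] by (intro sieve_Un A sieve_UN sieve_generated[OF B]) auto
  have full: "simplices B k \<subseteq> Sk n k" if "k < n" for k n
  proof
    fix y assume "y \<in> simplices B k"
    then have "y \<in> generated B k (simplices B k) k"
      using generatedI[OF id_ord_maps[of k k], of y "simplices B k" B] by (simp add: B.pull_id)
    then show "y \<in> Sk n k" using that by (auto simp: Sk_def)
  qed
  have gen_le: "generated B n (simplices B n) k \<subseteq> Sk n k \<union> generated B n (simplices B n - Sk n n) k" for n k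
  proof
    fix y assume "y \<in> generated B n (simplices B n) k"
    then obtain \<alpha> x where "y = pull B k n \<alpha> x" "\<alpha> \<in> ord_maps k n" "x \<in> simplices B n"
      by (auto simp: generated_def)
    then show "y \<in> Sk n k \<union> generated B n (simplices B n - Sk n n) k"
      using sieve_pull[OF Sk] by (cases "x \<in> Sk n n") (auto intro: generatedI)
  qed
  have gen_mono: "generated B n (simplices B n - Sk n n) k \<subseteq> generated B n (simplices B n) k" for n k
    by (auto simp: generated_def)
  \<comment> \<open>A simplex that is already in the sieve generates nothing new, so only the
    missing ones have to be attached to reach the next skeleton.\<close>
  have step: "Sk (Suc n) = (\<lambda>k. Sk n k \<union> generated B n (simplices B n - Sk n n) k)" for n
  proof
    fix k
    have "Sk (Suc n) k = Sk n k \<union> generated B n (simplices B n) k"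
      by (auto simp: Sk_def lessThan_Suc)
    then show "Sk (Suc n) k = Sk n k \<union> generated B n (simplices B n - Sk n n) k"
      using gen_le[of n k] gen_mono[of n k] by auto
  qed
  \<comment> \<open>The clause for \<open>n = 0\<close> anchors the chosen sequence at
    \<psi>.\<close>
  let ?P = "\<lambda>n \<phi>. smap \<phi> (?Z\<lparr>simplices := cyl_sieve B (Sk n)\<rparr>) N \<and> (n = 0 \<longrightarrow> \<phi> = \<psi>)"
  let ?Q = "\<lambda>n \<phi> \<phi>'. \<forall>k. \<forall>z\<in>cyl_sieve B (Sk n) k. \<phi>' k z = \<phi> k z"
  have "\<exists>f. \<forall>n. ?P n (f n) \<and> ?Q n (f n) (f (Suc n))"
  proof (rule dependent_nat_choice)
    show "\<exists>\<phi>. ?P 0 \<phi>" using \<psi> by (simp add: Sk_def[abs_def])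
    fix \<phi> n assume *: "?P n \<phi>"
    interpret minimal_cells B "Sk n" n
      by unfold_locales (use Sk full in auto)
    show "\<exists>\<phi>'. ?P (Suc n) \<phi>' \<and> ?Q n \<phi> \<phi>'"
      using extend_over_cells[OF N] * by (simp add: step)
  qed
  then obtain f where f: "\<And>n. smap (f n) (?Z\<lparr>simplices := cyl_sieve B (Sk n)\<rparr>) N" "f 0 = \<psi>"
    "\<And>n k z. z \<in> cyl_sieve B (Sk n) k \<Longrightarrow> f (Suc n) k z = f n k z" by blast
  have mono: "cyl_sieve B (Sk i) k \<subseteq> cyl_sieve B (Sk n) k" if "i \<le> n" for i n k
    using that by (auto simp: cyl_sieve_def Sk_def)
  have stable: "f n k z = f i k z" if "i \<le> n" and z: "z \<in> cyl_sieve B (Sk i) k" for i n k z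
    using that(1)
  proof (induction n rule: dec_induct)
    case (step n)
    then show ?case using f(3)[of z n k] mono[OF step(1), of k] z by auto
  qed simp
  have all: "z \<in> cyl_sieve B (Sk n) k" if "z \<in> simplices ?Z k" "k < n" for z k n
    using that full[of k n] by (auto simp: cyl_sieve_def sprod_iff)
  have W: "f (Suc k) k z = f n k z" if "z \<in> simplices ?Z k" "k < n" for z k n
    using stable[of "Suc k" n z k] all[OF that(1), of "Suc k"] that(2) by simp
  show ?thesis
  proof (rule that)
    show "smap (\<lambda>k. f (Suc k) k) ?Z N"
    proof (rule smapI)
      fix k z assume z: "z \<in> simplices ?Z k"
      then show "f (Suc k) k z \<in> simplices N k"
        using smap_closed[OF f(1)[of "Suc k"], of z k] all[OF z, of "Suc k"] by simp
    next
      fix m k \<alpha> z assume \<alpha>: "\<alpha> \<in> ord_maps m k" and z: "z \<in> simplices ?Z k"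
      \<comment> \<open>The values at \<open>z\<close> and at its pullback come from different
        stages. Naturality is checked at a later stage that covers both dimensions.\<close>
      let ?n = "Suc (m + k)"
      show "f (Suc m) m (pull ?Z m k \<alpha> z) = pull N m k \<alpha> (f (Suc k) k z)"
        using smap_pull[OF f(1)[of ?n] \<alpha>, of z] all[OF z, of ?n]
          W[OF z, of ?n] W[OF Z.pull_closed[OF \<alpha> z], of ?n] by simp
    qed
    fix k z assume z: "z \<in> cyl_sieve B A k"
    then have "z \<in> cyl_sieve B (Sk 0) k" by (simp add: Sk_def[abs_def])
    from stable[OF _ this, of "Suc k"] show "f (Suc k) k z = \<psi> k z" by (simp add: f(2))
  qed
qed

section \<open>Equivalences from coherent homotopies\<close>

text \<open>The nerve of the contractible groupoid on two objects. A map out of \<open>X \<times> codiscrete\<close> packages an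
  isomorphism in \<open>Fun(X, Y)\<close> together with its inverse and both composition triangles.\<close>

definition codiscrete :: "(nat \<Rightarrow> nat) sset" where
  "codiscrete = \<lparr>simplices = (\<lambda>k. {..k} \<rightarrow>\<^sub>E {0, 1}), pull = (\<lambda>m k \<alpha> \<chi>. restrict (\<chi> \<circ> \<alpha>) {..m})\<rparr>"

lemma codiscrete_iff:
  "\<chi> \<in> simplices codiscrete k \<longleftrightarrow> (\<forall>t\<le>k. \<chi> t = 0 \<or> \<chi> t = 1) \<and> \<chi> \<in> extensional {..k}"
  by (auto simp: codiscrete_def PiE_def Pi_def)

lemma codiscrete_pull: "pull codiscrete m k \<alpha> \<chi> = restrict (\<chi> \<circ> \<alpha>) {..m}"
  by (simp add: codiscrete_def)

lemma simplicial_set_codiscrete: "simplicial_set codiscrete"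
proof
  fix m k \<alpha> \<chi> assume "\<alpha> \<in> ord_maps m k" "\<chi> \<in> simplices codiscrete k"
  then show "pull codiscrete m k \<alpha> \<chi> \<in> simplices codiscrete m"
    by (auto simp: codiscrete_pull codiscrete_iff dest: ord_maps_le)
next
  fix k \<chi> assume "\<chi> \<in> simplices codiscrete k"
  then show "pull codiscrete k k id \<chi> = \<chi>"
    by (auto simp: codiscrete_pull codiscrete_iff intro: extensional_restrict)
next
  fix l m k \<beta> \<alpha> \<chi> assume "\<beta> \<in> ord_maps l m" "\<alpha> \<in> ord_maps m k" "\<chi> \<in> simplices codiscrete k"
  then show "pull codiscrete l k (\<alpha> \<circ> \<beta>) \<chi> = pull codiscrete l m \<beta> (pull codiscrete m k \<alpha> \<chi>)"
    by (auto simp: codiscrete_pull fun_eq_iff restrict_def dest: ord_maps_le)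
next
  fix m k :: nat and \<alpha> \<beta> \<chi> :: "nat \<Rightarrow> nat"
  assume "\<And>i. i \<le> m \<Longrightarrow> \<alpha> i = \<beta> i"
  then show "pull codiscrete m k \<alpha> \<chi> = pull codiscrete m k \<beta> \<chi>"
    by (auto simp: codiscrete_pull fun_eq_iff restrict_def)
qed

text \<open>Any labelling of the vertices of \<Delta>[n] by 0 and 1, monotone or not, is a simplex
  of \<open>codiscrete\<close>. Composing with \<open>F\<close> turns it into an
  \<open>n\<close>-simplex of the mapping space whose faces are given by restricting the
  labelling.\<close>

lemma isomorphic_in_map_space:
  assumes X: "simplicial_set X" and F: "smap F (sprod X codiscrete) Y"
    and F0: "\<And>k x. x \<in> simplices X k \<Longrightarrow> F k (x, restrict (\<lambda>_. 0) {..k}) = f k x"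
    and F1: "\<And>k x. x \<in> simplices X k \<Longrightarrow> F k (x, restrict (\<lambda>_. 1) {..k}) = g k x"
  shows "isomorphic_in (map_space X Y) (map_vertex X f) (map_vertex X g)"
proof -
  define s where "s n c k = restrict (\<lambda>(x, \<rho>). F k (x, restrict (c \<circ> \<rho>) {..k}))
    (simplices (sprod X (std_simplex n)) k)" for n k and c :: "nat \<Rightarrow> nat"
  have s_apply: "s n c k (x, \<rho>) = F k (x, restrict (c \<circ> \<rho>) {..k})"
    if "x \<in> simplices X k" "\<rho> \<in> simplices (std_simplex n) k" for n c k x \<rho>
    using that by (simp add: s_def sprod_iff)
  have s: "s n c \<in> smaps (sprod X (std_simplex n)) Y" if c: "\<And>t. t \<le> n \<Longrightarrow> c t = 0 \<or> c t = 1" for n c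
  proof -
    have "smap (\<lambda>k (x, \<rho>). F k (x, restrict (c \<circ> \<rho>) {..k})) (sprod X (std_simplex n)) Y"
    proof (rule smapI)
      fix k z assume "z \<in> simplices (sprod X (std_simplex n)) k"
      then show "(case z of (x, \<rho>) \<Rightarrow> F k (x, restrict (c \<circ> \<rho>) {..k})) \<in> simplices Y k"
        by (auto simp: sprod_iff std_simplex_iff codiscrete_iff intro!: smap_closed[OF F] split: prod.split)
          (metis c ord_maps_le)
    next
      fix m k \<alpha> z assume \<alpha>: "\<alpha> \<in> ord_maps m k" and "z \<in> simplices (sprod X (std_simplex n)) k"
      then obtain x \<rho> where z: "z = (x, \<rho>)" "x \<in> simplices X k" "\<rho> \<in> ord_maps k n"
        by (cases z) (auto simp: sprod_iff std_simplex_iff)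
      have "restrict (c \<circ> restrict (\<rho> \<circ> \<alpha>) {..m}) {..m} = restrict (restrict (c \<circ> \<rho>) {..k} \<circ> \<alpha>) {..m}"
        using ord_maps_le[OF \<alpha>] by (auto simp: fun_eq_iff)
      moreover have "restrict (c \<circ> \<rho>) {..k} \<in> simplices codiscrete k"
        using c ord_maps_le[OF z(3)] by (auto simp: codiscrete_iff)
      ultimately show "(case pull (sprod X (std_simplex n)) m k \<alpha> z of (x, \<rho>) \<Rightarrow> F m (x, restrict (c \<circ> \<rho>) {..m}))
        = pull Y m k \<alpha> (case z of (x, \<rho>) \<Rightarrow> F k (x, restrict (c \<circ> \<rho>) {..k}))"
        using smap_pull[OF F \<alpha>, of "(x, restrict (c \<circ> \<rho>) {..k})"] z
        by (simp add: sprod_pull sprod_iff std_simplex_pull codiscrete_pull)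
    qed
    from restrict_smaps[OF this simplicial_set_sprod[OF X simplicial_set_std_simplex]] show ?thesis
      by (simp add: s_def[abs_def])
  qed
  have s_cong: "s n c = s n d" if "\<And>t. t \<le> n \<Longrightarrow> c t = d t" for n c d
  proof (intro ext)
    fix k z
    show "s n c k z = s n d k z"
    proof (cases "z \<in> simplices (sprod X (std_simplex n)) k")
      case True
      then obtain x \<rho> where z: "z = (x, \<rho>)" "x \<in> simplices X k" "\<rho> \<in> simplices (std_simplex n) k"
        by (cases z) (auto simp: sprod_iff)
      then have "restrict (c \<circ> \<rho>) {..k} = restrict (d \<circ> \<rho>) {..k}"
        using that by (auto simp: fun_eq_iff std_simplex_iff dest: ord_maps_le)
      with z show ?thesis by (simp add: s_apply)
    qed (simp add: s_def)
  qed
  have s_pull: "pull (map_space X Y) m n \<alpha> (s n c) = s m d"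
    if \<alpha>: "\<alpha> \<in> ord_maps m n" and d: "\<And>t. t \<le> m \<Longrightarrow> c (\<alpha> t) = d t" for m n \<alpha> c d
  proof -
    have "pull (map_space X Y) m n \<alpha> (s n c) = s m (c \<circ> \<alpha>)"
    proof (intro ext)
      fix k z
      show "pull (map_space X Y) m n \<alpha> (s n c) k z = s m (c \<circ> \<alpha>) k z"
      proof (cases "z \<in> simplices (sprod X (std_simplex m)) k")
        case True
        then obtain x \<rho> where z: "z = (x, \<rho>)" "x \<in> simplices X k" "\<rho> \<in> simplices (std_simplex m) k"
          by (cases z) (auto simp: sprod_iff)
        have "restrict (c \<circ> restrict (\<alpha> \<circ> \<rho>) {..k}) {..k} = restrict (c \<circ> \<alpha> \<circ> \<rho>) {..k}"
          by (auto simp: fun_eq_iff)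
        with z show ?thesis
          by (simp add: map_space_pull_apply s_apply std_simplex_postcomp[OF \<alpha>])
      qed (simp add: map_space_def s_def)
    qed
    also have "\<dots> = s m d" by (rule s_cong) (simp add: d)
    finally show ?thesis .
  qed
  have v: "map_vertex X h = s 0 (\<lambda>_. e)"
    if "\<And>k x. x \<in> simplices X k \<Longrightarrow> F k (x, restrict (\<lambda>_. e) {..k}) = h k x" for e h
  proof (intro ext)
    fix k z
    show "map_vertex X h k z = s 0 (\<lambda>_. e) k z"
      using that[of "fst z" k] by (cases z) (auto simp: map_vertex_def s_def sprod_iff restrict_def comp_def)
  qed
  have vf: "map_vertex X f = s 0 (\<lambda>_. 0)" by (rule v[OF F0])
  have vg: "map_vertex X g = s 0 (\<lambda>_. 1)" by (rule v[OF F1])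
  have faces: "face (map_space X Y) (Suc n) i (s (Suc n) c) = s n d"
    if "\<And>t. t \<le> n \<Longrightarrow> c (coface i t) = d t" for n i c d
    unfolding face_def diff_Suc_1 by (rule s_pull[where c = c and d = d, OF coface_ord_maps that])
  note faces1 = faces[of 0, unfolded One_nat_def[symmetric]]
  note faces2 = faces[of 1, simplified, folded numeral_2_eq_2]
  \<comment> \<open>The edges have labels 01 and 10, the triangles 010 and 101; their middle faces
    carry constant labels and are therefore degenerate.\<close>
  let ?u = "s 1 id" and ?v = "s 1 (\<lambda>t. 1 - t)"
  let ?\<sigma> = "s 2 (\<lambda>t. if t = 1 then 1 else 0)" and ?\<tau> = "s 2 (\<lambda>t. if t = 1 then 0 else 1)"
  have deg: "degen (map_space X Y) 0 0 (s 0 (\<lambda>_. e)) = s 1 (\<lambda>_. e)" for e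
    unfolding degen_def One_nat_def by (rule s_pull[where c = "\<lambda>_. e" and d = "\<lambda>_. e", OF codegen_ord_maps]) auto
  have le1: "t \<le> 1 \<longleftrightarrow> t = 0 \<or> t = 1" for t :: nat by auto
  have le2: "t \<le> Suc 1 \<longleftrightarrow> t = 0 \<or> t = 1 \<or> t = 2" for t :: nat by auto
  have "?u \<in> simplices (map_space X Y) 1" "?v \<in> simplices (map_space X Y) 1"
    "?\<sigma> \<in> simplices (map_space X Y) 2" "?\<tau> \<in> simplices (map_space X Y) 2"
    "s 0 (\<lambda>_. 0) \<in> simplices (map_space X Y) 0" "s 0 (\<lambda>_. 1) \<in> simplices (map_space X Y) 0"
    unfolding map_space_simplices by (intro s; auto simp: le1)+
  moreover have "face (map_space X Y) 1 1 ?u = s 0 (\<lambda>_. 0)" "face (map_space X Y) 1 0 ?u = s 0 (\<lambda>_. 1)"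
    "face (map_space X Y) 1 1 ?v = s 0 (\<lambda>_. 1)" "face (map_space X Y) 1 0 ?v = s 0 (\<lambda>_. 0)"
    by (rule faces1; simp add: coface_def)+
  moreover have "face (map_space X Y) 2 2 ?\<sigma> = ?u" "face (map_space X Y) 2 0 ?\<sigma> = ?v"
    "face (map_space X Y) 2 1 ?\<sigma> = s 1 (\<lambda>_. 0)"
    "face (map_space X Y) 2 2 ?\<tau> = ?v" "face (map_space X Y) 2 0 ?\<tau> = ?u"
    "face (map_space X Y) 2 1 ?\<tau> = s 1 (\<lambda>_. 1)"
    by (rule faces2; auto simp: coface_def le1)+
  ultimately show ?thesis
    unfolding isomorphic_in_def vf vg deg by blast
qed

lemma equivalenceI:
  assumes X: "simplicial_set X" and Y: "simplicial_set Y" and f: "smap f X Y" and g: "smap g Y X"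
    and F: "smap F (sprod X codiscrete) X"
      "\<And>k x. x \<in> simplices X k \<Longrightarrow> F k (x, restrict (\<lambda>_. 0) {..k}) = g k (f k x)"
      "\<And>k x. x \<in> simplices X k \<Longrightarrow> F k (x, restrict (\<lambda>_. 1) {..k}) = x"
    and G: "smap G (sprod Y codiscrete) Y"
      "\<And>k y. y \<in> simplices Y k \<Longrightarrow> G k (y, restrict (\<lambda>_. 0) {..k}) = f k (g k y)"
      "\<And>k y. y \<in> simplices Y k \<Longrightarrow> G k (y, restrict (\<lambda>_. 1) {..k}) = y"
  shows "equivalence f X Y"
  unfolding equivalence_def
  by (intro conjI f exI[of _ g] g isomorphic_in_map_space[OF X F(1)] isomorphic_in_map_space[OF Y G(1)])
    (simp_all add: F G)

lemma smap_fst: "smap (\<lambda>_. fst) (sprod X Y) X"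
  by (rule smapI) (auto simp: sprod_iff sprod_def)

text \<open>The inverse is strict, so the projections serve as constant homotopies.\<close>

lemma siso_imp_equivalence:
  assumes f: "siso f X Y" and X: "simplicial_set X" and Y: "simplicial_set Y"
  shows "equivalence f X Y"
proof -
  note inv = siso_inverse[OF f X]
  show ?thesis
    by (rule equivalenceI[OF X Y, where F = "\<lambda>_. fst" and G = "\<lambda>_. fst"])
      (use f inv in \<open>auto simp: siso_def smap_fst\<close>)
qed

section \<open>The exit path category\<close>

text \<open>For an up-closed \<open>P\<close>, the simplex of \<open>ExitCat S\<close> on the simplex \<open>\<gamma>\<close> of \<open>N_of S\<close> whose vertices in
  \<open>N_of S\<close> are those satisfying \<open>P\<close>.\<close>

definition exit_value ::
    "('m, 'l, 'n) sspan \<Rightarrow> nat \<Rightarrow> (nat \<Rightarrow> bool) \<Rightarrow> 'n \<Rightarrow> ('m, 'n) ex_simplex" where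
  "exit_value S m P \<gamma> =
    (if \<forall>i\<le>m. \<not> P i then In_M (pi_of S m (the_inv_into (simplices (L_of S) m) (iota_of S m) \<gamma>))
     else if P 0 then In_N \<gamma> else Exit \<gamma> (LEAST i. i \<le> m \<and> P i))"

text \<open>A simplex of \<open>M\<close> does not remember a simplex of \<open>N\<close>, hence the
  \<open>undefined\<close>. The proofs read \<open>under\<close> only at simplices whose last vertex
  lies in \<open>N\<close>.\<close>

definition under :: "('m, 'n) ex_simplex \<Rightarrow> 'n" where
  "under x = (case x of In_M a \<Rightarrow> undefined | Exit \<gamma> j \<Rightarrow> \<gamma> | In_N c \<Rightarrow> c)"

lemma under_simps [simp]: "under (Exit \<gamma> j) = \<gamma>" "under (In_N c) = c"
  by (simp_all add: under_def)

lemma exit_value_cong: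
  assumes "\<And>i. i \<le> m \<Longrightarrow> P i \<longleftrightarrow> Q i"
  shows "exit_value S m P \<gamma> = exit_value S m Q \<gamma>"
proof -
  have "(\<lambda>i. i \<le> m \<and> P i) = (\<lambda>i. i \<le> m \<and> Q i)" using assms by auto
  then show ?thesis using assms by (simp add: exit_value_def)
qed

lemma exit_value_N: "P 0 \<Longrightarrow> exit_value S m P \<gamma> = In_N \<gamma>"
  unfolding exit_value_def by (metis zero_le)

lemma exit_value_Exit:
  "\<not> P 0 \<Longrightarrow> \<not> (\<forall>i\<le>m. \<not> P i) \<Longrightarrow> exit_value S m P \<gamma> = Exit \<gamma> (LEAST i. i \<le> m \<and> P i)"
  unfolding exit_value_def by (simp only: if_False)

lemma under_exit_value: "i \<le> m \<Longrightarrow> P i \<Longrightarrow> under (exit_value S m P \<gamma>) = \<gamma>"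
  by (auto simp: exit_value_def)

lemma pull_In_M: "pull (ExitCat S) m k \<alpha> (In_M a) = In_M (pull (M_of S) m k \<alpha> a)"
  by (simp add: ExitCat_def)

lemma pull_In_N: "pull (ExitCat S) m k \<alpha> (In_N c) = In_N (pull (N_of S) m k \<alpha> c)"
  by (simp add: ExitCat_def)

text \<open>The three cases in the definition of \<open>ExitCat\<close> are those of
  \<open>exit_value\<close>, for the set of vertices that \<alpha> sends to \<open>j\<close> or
  beyond.\<close>

lemma pull_Exit:
  "pull (ExitCat S) m k \<alpha> (Exit \<gamma> j) = exit_value S m (\<lambda>i. j \<le> \<alpha> i) (pull (N_of S) m k \<alpha> \<gamma>)"
  by (simp add: ExitCat_def exit_value_def Let_def not_le)

lemma In_M_simplex: "In_M a \<in> simplices (ExitCat S) k \<longleftrightarrow> a \<in> simplices (M_of S) k"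
  by (auto simp: ExitCat_def)

lemma In_N_simplex: "In_N c \<in> simplices (ExitCat S) k \<longleftrightarrow> c \<in> simplices (N_of S) k"
  by (auto simp: ExitCat_def)

lemma Exit_simplex: "Exit \<gamma> j \<in> simplices (ExitCat S) k \<longleftrightarrow>
    \<gamma> \<in> simplices (N_of S) k \<and> 1 \<le> j \<and> j \<le> k \<and>
    pull (N_of S) (j - 1) k id \<gamma> \<in> iota_of S (j - 1) ` simplices (L_of S) (j - 1)"
  by (auto simp: ExitCat_def exit_paths_def)

locale linked =
  fixes S :: "('m, 'l, 'n) sspan"
  assumes linked: "linked_category S"
begin

abbreviation "M \<equiv> M_of S"
abbreviation "L \<equiv> L_of S"
abbreviation "N \<equiv> N_of S"
abbreviation "\<pi> \<equiv> pi_of S"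
abbreviation "\<iota> \<equiv> iota_of S"
abbreviation "\<E> \<equiv> ExitCat S"

sublocale M: simplicial_set M using linked by (simp add: linked_category_def quasi_category_def)
sublocale L: simplicial_set L using linked by (simp add: linked_category_def quasi_category_def)
sublocale N: simplicial_set N using linked by (simp add: linked_category_def quasi_category_def)

lemma smap_pi: "smap \<pi> L M" using linked by (simp add: linked_category_def right_fibration_def)

lemma smap_iota: "smap \<iota> L N" using linked by (simp add: linked_category_def smono_def)

lemma iota_inj: "inj_on (\<iota> k) (simplices L k)" using linked by (simp add: linked_category_def smono_def)

lemma iota_inv: "b \<in> simplices L k \<Longrightarrow> the_inv_into (simplices L k) (\<iota> k) (\<iota> k b) = b"
  by (simp add: the_inv_into_f_f[OF iota_inj])

text \<open>The condition under which \<open>exit_value\<close> is meaningful: it gives the lift if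
  no vertex satisfies \<open>P\<close>, the link condition of an exit path in the mixed case, and is
  vacuous if \<open>P 0\<close>.\<close>

definition link_below :: "nat \<Rightarrow> (nat \<Rightarrow> bool) \<Rightarrow> 'n \<Rightarrow> bool" where
  "link_below k P \<gamma> \<longleftrightarrow> (\<forall>j\<le>k. (\<forall>i\<le>j. \<not> P i) \<longrightarrow> pull N j k id \<gamma> \<in> \<iota> j ` simplices L j)"

text \<open>In the mixed case the least vertex \<open>j\<close> with \<open>P j\<close> is positive.
  The face on the vertices up to \<open>j - 1\<close> is the largest initial face avoiding
  \<open>P\<close>, and this is the face that index \<open>j\<close> requires to lie in
  \<open>L\<close>.\<close>

lemma exit_value_closed:
  assumes \<gamma>: "\<gamma> \<in> simplices N k" and low: "link_below k P \<gamma>"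
  shows "exit_value S k P \<gamma> \<in> simplices \<E> k"
proof (cases "\<forall>i\<le>k. \<not> P i")
  case True
  then obtain b where "b \<in> simplices L k" "\<gamma> = \<iota> k b"
    using low[unfolded link_below_def, rule_format, of k] N.pull_id[OF \<gamma>] by auto
  with True show ?thesis
    by (simp add: exit_value_def In_M_simplex iota_inv smap_closed[OF smap_pi])
next
  case False
  show ?thesis
  proof (cases "P 0")
    case True
    with \<gamma> show ?thesis by (simp only: exit_value_N In_N_simplex)
  next
    case nP: False
    define j where "j = (LEAST i. i \<le> k \<and> P i)"
    have j: "j \<le> k" "P j" using LeastI_ex[of "\<lambda>i. i \<le> k \<and> P i"] False by (auto simp: j_def)
    then have j0: "1 \<le> j" using nP by (cases j) auto
    have "\<not> P i" if "i < j" for i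
      using not_less_Least[of i "\<lambda>i. i \<le> k \<and> P i"] that j(1) by (simp add: j_def[symmetric])
    then have "\<forall>i\<le>j - 1. \<not> P i" using j0 by simp
    moreover have "j - 1 \<le> k" using j(1) by simp
    ultimately have "pull N (j - 1) k id \<gamma> \<in> \<iota> (j - 1) ` simplices L (j - 1)"
      using low unfolding link_below_def by blast
    moreover have "exit_value S k P \<gamma> = Exit \<gamma> j" unfolding j_def by (rule exit_value_Exit[OF nP False])
    ultimately show ?thesis using \<gamma> j(1) j0 by (simp only: Exit_simplex)
  qed
qed

text \<open>An initial segment ending at \<open>j\<close> maps into the one ending at
  \<open>\<alpha> j\<close>, where \<open>P\<close> still fails throughout by upward closedness.
  Pulling back its lift gives the lift required.\<close>

lemma link_below_pull:
  assumes \<alpha>: "\<alpha> \<in> ord_maps m k" and up: "\<And>s t. s \<le> t \<Longrightarrow> t \<le> k \<Longrightarrow> P s \<Longrightarrow> P t"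
    and \<gamma>: "\<gamma> \<in> simplices N k" and low: "link_below k P \<gamma>"
  shows "link_below m (P \<circ> \<alpha>) (pull N m k \<alpha> \<gamma>)"
  unfolding link_below_def
proof (intro allI impI)
  fix j assume j: "j \<le> m" and "\<forall>i\<le>j. \<not> (P \<circ> \<alpha>) i"
  then have "\<not> P (\<alpha> j)" by simp
  have \<alpha>j: "\<alpha> j \<le> k" by (rule ord_maps_le[OF \<alpha> j])
  then have "\<forall>i\<le>\<alpha> j. \<not> P i" using up \<open>\<not> P (\<alpha> j)\<close> by blast
  then obtain b where b: "b \<in> simplices L (\<alpha> j)" "pull N (\<alpha> j) k id \<gamma> = \<iota> (\<alpha> j) b"
    using low \<alpha>j by (auto simp: link_below_def)
  have \<alpha>': "\<alpha> \<in> ord_maps j (\<alpha> j)"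
    by (rule ord_mapsI) (use ord_maps_mono[OF \<alpha>] j in auto)
  have "pull N j m id (pull N m k \<alpha> \<gamma>) = pull N j k (\<alpha> \<circ> id) \<gamma>"
    by (rule N.pull_comp[OF id_ord_maps[OF j] \<alpha> \<gamma>, symmetric])
  also have "\<dots> = pull N j (\<alpha> j) \<alpha> (pull N (\<alpha> j) k id \<gamma>)"
    using N.pull_comp[OF \<alpha>' id_ord_maps[OF \<alpha>j] \<gamma>] by simp
  also have "\<dots> = \<iota> j (pull L j (\<alpha> j) \<alpha> b)"
    by (simp add: b smap_pull[OF smap_iota \<alpha>' b(1)])
  finally show "pull N j m id (pull N m k \<alpha> \<gamma>) \<in> \<iota> j ` simplices L j"
    using L.pull_closed[OF \<alpha>' b(1)] by simp
qed

text \<open>The functoriality that the encoding is made for. If no vertex satisfies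
  \<open>P\<close>, inverting \<iota> commutes with pulling back because \<iota> is injective and
  simplicial; otherwise the index is recovered from upward closedness.\<close>

lemma pull_exit_value:
  assumes \<alpha>: "\<alpha> \<in> ord_maps m k" and up: "\<And>s t. s \<le> t \<Longrightarrow> t \<le> k \<Longrightarrow> P s \<Longrightarrow> P t"
    and \<gamma>: "\<gamma> \<in> simplices N k" and low: "link_below k P \<gamma>"
  shows "pull \<E> m k \<alpha> (exit_value S k P \<gamma>) = exit_value S m (P \<circ> \<alpha>) (pull N m k \<alpha> \<gamma>)"
proof (cases "\<forall>i\<le>k. \<not> P i")
  case True
  then obtain b where b: "b \<in> simplices L k" "\<gamma> = \<iota> k b"
    using low[unfolded link_below_def, rule_format, of k] N.pull_id[OF \<gamma>] by auto
  have "pull N m k \<alpha> \<gamma> = \<iota> m (pull L m k \<alpha> b)" by (simp add: b smap_pull[OF smap_iota \<alpha> b(1)])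
  moreover have "\<forall>i\<le>m. \<not> P (\<alpha> i)" using True ord_maps_le[OF \<alpha>] by blast
  ultimately show ?thesis
    using True b by (simp add: exit_value_def pull_In_M iota_inv L.pull_closed[OF \<alpha> b(1)] smap_pull[OF smap_pi \<alpha> b(1)])
next
  case False
  show ?thesis
  proof (cases "P 0")
    case True
    then have "P (\<alpha> 0)" using up[of 0 "\<alpha> 0"] ord_maps_le[OF \<alpha>, of 0] by simp
    with True show ?thesis by (simp only: exit_value_N comp_apply pull_In_N)
  next
    case nP: False
    let ?j = "LEAST i. i \<le> k \<and> P i"
    have j: "?j \<le> k" "P ?j" using LeastI_ex[of "\<lambda>i. i \<le> k \<and> P i"] False by auto
    have "?j \<le> t \<longleftrightarrow> P t" if "t \<le> k" for t
      using up[of ?j t] j that Least_le[of "\<lambda>i. i \<le> k \<and> P i" t] by auto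
    then have "exit_value S m (\<lambda>i. ?j \<le> \<alpha> i) (pull N m k \<alpha> \<gamma>) = exit_value S m (P \<circ> \<alpha>) (pull N m k \<alpha> \<gamma>)"
      by (intro exit_value_cong) (simp add: ord_maps_le[OF \<alpha>])
    then show ?thesis by (simp only: exit_value_Exit[OF nP False] pull_Exit)
  qed
qed

lemma Exit_eq_exit_value:
  assumes "Exit \<gamma> j \<in> simplices \<E> k"
  shows "Exit \<gamma> j = exit_value S k (\<lambda>i. j \<le> i) \<gamma>" and "link_below k (\<lambda>i. j \<le> i) \<gamma>"
proof -
  from assms have \<gamma>: "\<gamma> \<in> simplices N k" and j: "1 \<le> j" "j \<le> k" and
    b: "pull N (j - 1) k id \<gamma> \<in> \<iota> (j - 1) ` simplices L (j - 1)" by (auto simp: Exit_simplex)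
  have "(LEAST i. i \<le> k \<and> j \<le> i) = j" by (rule Least_equality) (use j in auto)
  with j show "Exit \<gamma> j = exit_value S k (\<lambda>i. j \<le> i) \<gamma>" by (auto simp: exit_value_def)
  show "link_below k (\<lambda>i. j \<le> i) \<gamma>"
    unfolding link_below_def
  proof (intro allI impI)
    fix t assume "t \<le> k" "\<forall>i\<le>t. \<not> j \<le> i"
    then have "\<not> j \<le> t" by blast
    then have t: "t \<le> j - 1" by simp
    from b obtain b' where b': "b' \<in> simplices L (j - 1)" "pull N (j - 1) k id \<gamma> = \<iota> (j - 1) b'" by auto
    have "pull N t k id \<gamma> = pull N t (j - 1) id (pull N (j - 1) k id \<gamma>)"
      using N.pull_comp[OF id_ord_maps[OF t] id_ord_maps[of "j - 1" k] \<gamma>] j by simp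
    also have "\<dots> = \<iota> t (pull L t (j - 1) id b')"
      by (simp add: b' smap_pull[OF smap_iota id_ord_maps[OF t] b'(1)])
    finally show "pull N t k id \<gamma> \<in> \<iota> t ` simplices L t"
      using L.pull_closed[OF id_ord_maps[OF t] b'(1)] by simp
  qed
qed

lemma exit_cat_cases:
  assumes "x \<in> simplices \<E> k"
  obtains (In_M) a where "x = In_M a" "a \<in> simplices M k"
    | (In_N) c where "x = In_N c" "c \<in> simplices N k"
    | (Exit) \<gamma> j where "x = Exit \<gamma> j" "\<gamma> \<in> simplices N k" "1 \<le> j" "j \<le> k"
      "x = exit_value S k (\<lambda>i. j \<le> i) \<gamma>" "link_below k (\<lambda>i. j \<le> i) \<gamma>"
proof (cases x)
  case (Exit \<gamma> j)
  then show ?thesis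
    using assms that(3)[of \<gamma> j] Exit_eq_exit_value[of \<gamma> j k] by (auto simp: Exit_simplex)
qed (use assms that in \<open>auto simp: In_M_simplex In_N_simplex\<close>)

sublocale \<E>: simplicial_set \<E>
proof
  fix m k \<alpha> x assume \<alpha>: "\<alpha> \<in> ord_maps m k" and "x \<in> simplices \<E> k"
  from this(2) show "pull \<E> m k \<alpha> x \<in> simplices \<E> m"
  proof (cases rule: exit_cat_cases)
    case (Exit \<gamma> j)
    then show ?thesis
      using exit_value_closed[OF N.pull_closed[OF \<alpha> Exit(2)] link_below_pull[OF \<alpha> _ Exit(2,6)]]
        pull_exit_value[OF \<alpha> _ Exit(2,6)] by simp
  qed (simp_all add: pull_In_M pull_In_N In_M_simplex In_N_simplex M.pull_closed[OF \<alpha>] N.pull_closed[OF \<alpha>])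
next
  fix k x assume "x \<in> simplices \<E> k"
  then show "pull \<E> k k id x = x"
  proof (cases rule: exit_cat_cases)
    case (Exit \<gamma> j)
    then show ?thesis by (simp add: pull_Exit N.pull_id)
  qed (simp_all add: pull_In_M pull_In_N M.pull_id N.pull_id)
next
  fix l m k \<beta> \<alpha> x assume \<beta>: "\<beta> \<in> ord_maps l m" and \<alpha>: "\<alpha> \<in> ord_maps m k" and "x \<in> simplices \<E> k"
  from this(3) show "pull \<E> l k (\<alpha> \<circ> \<beta>) x = pull \<E> l m \<beta> (pull \<E> m k \<alpha> x)"
  proof (cases rule: exit_cat_cases)
    case (Exit \<gamma> j)
    let ?P = "\<lambda>i. j \<le> i"
    have up: "\<And>s t. s \<le> t \<Longrightarrow> t \<le> m \<Longrightarrow> (?P \<circ> \<alpha>) s \<Longrightarrow> (?P \<circ> \<alpha>) t"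
      using ord_maps_mono[OF \<alpha>] by (simp, meson order_trans)
    have "pull \<E> l m \<beta> (exit_value S m (?P \<circ> \<alpha>) (pull N m k \<alpha> \<gamma>))
        = exit_value S l ((?P \<circ> \<alpha>) \<circ> \<beta>) (pull N l m \<beta> (pull N m k \<alpha> \<gamma>))"
      by (rule pull_exit_value[OF \<beta> up N.pull_closed[OF \<alpha> Exit(2)] link_below_pull[OF \<alpha> _ Exit(2,6)]]) auto
    then show ?thesis
      using N.pull_comp[OF \<beta> \<alpha> Exit(2)] by (simp add: Exit(1) pull_Exit comp_def)
  qed (simp_all add: pull_In_M pull_In_N M.pull_comp[OF \<beta> \<alpha>] N.pull_comp[OF \<beta> \<alpha>])
next
  fix m k \<alpha> \<beta> x
  assume \<alpha>: "\<alpha> \<in> ord_maps m k" and "x \<in> simplices \<E> k" and eq: "\<And>i. i \<le> m \<Longrightarrow> \<alpha> i = \<beta> i"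
  from this(2) show "pull \<E> m k \<alpha> x = pull \<E> m k \<beta> x"
  proof (cases rule: exit_cat_cases)
    case (Exit \<gamma> j)
    have "exit_value S m (\<lambda>i. j \<le> \<alpha> i) \<delta> = exit_value S m (\<lambda>i. j \<le> \<beta> i) \<delta>" for \<delta>
      by (rule exit_value_cong) (simp add: eq)
    with Exit(1) show ?thesis using N.pull_cong[OF \<alpha> Exit(2) eq] by (simp add: pull_Exit)
  next
    case (In_M a)
    with M.pull_cong[OF \<alpha> In_M(2) eq] show ?thesis by (simp add: pull_In_M)
  next
    case (In_N c)
    with N.pull_cong[OF \<alpha> In_N(2) eq] show ?thesis by (simp add: pull_In_N)
  qed
qed

section \<open>Objects, full subcategories and directions of morphisms\<close>

lemma smap_In_M: "smap (\<lambda>_. In_M) M \<E>"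
  by (rule smapI) (simp_all add: In_M_simplex pull_In_M)

lemma smap_In_N: "smap (\<lambda>_. In_N) N \<E>"
  by (rule smapI) (simp_all add: In_N_simplex pull_In_N)

lemma vertex_Exit:
  assumes "Exit \<gamma> j \<in> simplices \<E> k" "i \<le> k"
  shows "j \<le> i \<Longrightarrow> vertex \<E> k i (Exit \<gamma> j) \<in> range In_N"
    and "i < j \<Longrightarrow> vertex \<E> k i (Exit \<gamma> j) \<in> range In_M"
  by (auto simp: vertex_def pull_Exit exit_value_def)

lemma objects: "simplices \<E> 0 = In_M ` simplices M 0 \<union> In_N ` simplices N 0"
  by (auto elim!: exit_cat_cases simp: In_M_simplex In_N_simplex)

text \<open>An exit path has \<open>1 \<le> j \<le> k\<close>, so its vertex \<open>k\<close> is in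
  \<open>N\<close> and its vertex \<open>0\<close> is in \<open>M\<close>. The former makes
  \<open>M\<close> full, the latter makes \<open>N\<close> full and excludes morphisms from
  \<open>N\<close> to \<open>M\<close>.\<close>

lemma full_M: "full_subcategory (\<lambda>_. In_M) M \<E>"
  unfolding full_subcategory_def smono_def
proof (intro conjI allI ballI impI)
  fix k x assume x: "x \<in> simplices \<E> k" and v: "\<forall>v\<le>k. vertex \<E> k v x \<in> In_M ` simplices M 0"
  from x show "x \<in> In_M ` simplices M k"
  proof (cases rule: exit_cat_cases)
    case (Exit \<gamma> j)
    with x have "vertex \<E> k k x \<in> range In_N" by (simp add: vertex_Exit)
    with v show ?thesis by auto
  next
    case (In_N c)
    then have "vertex \<E> k 0 x \<in> range In_N" by (simp add: vertex_def pull_In_N)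
    with v show ?thesis by auto
  qed simp
qed (use linked in \<open>auto simp: linked_category_def smap_In_M inj_on_def \<E>.simplicial_set_axioms\<close>)

lemma full_N: "full_subcategory (\<lambda>_. In_N) N \<E>"
  unfolding full_subcategory_def smono_def
proof (intro conjI allI ballI impI)
  fix k x assume x: "x \<in> simplices \<E> k" and v: "\<forall>v\<le>k. vertex \<E> k v x \<in> In_N ` simplices N 0"
  from x show "x \<in> In_N ` simplices N k"
  proof (cases rule: exit_cat_cases)
    case (Exit \<gamma> j)
    with x have "vertex \<E> k 0 x \<in> range In_M" by (simp add: vertex_Exit)
    with v show ?thesis by auto
  next
    case (In_M a)
    then have "vertex \<E> k 0 x \<in> range In_M" by (simp add: vertex_def pull_In_M)
    with v show ?thesis by auto
  qed simp
qed (use linked in \<open>auto simp: linked_category_def smap_In_N inj_on_def \<E>.simplicial_set_axioms\<close>)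

lemma no_morphism_N_to_M:
  "\<not> (\<exists>e\<in>simplices \<E> 1. vertex \<E> 1 0 e \<in> In_N ` simplices N 0 \<and> vertex \<E> 1 1 e \<in> In_M ` simplices M 0)"
proof
  assume "\<exists>e\<in>simplices \<E> 1. vertex \<E> 1 0 e \<in> In_N ` simplices N 0 \<and> vertex \<E> 1 1 e \<in> In_M ` simplices M 0"
  then obtain e where e: "e \<in> simplices \<E> 1" and
    v: "vertex \<E> 1 0 e \<in> range In_N" "vertex \<E> 1 1 e \<in> range In_M" by auto
  from e show False
  proof (cases rule: exit_cat_cases)
    case (Exit \<gamma> j)
    with e have "vertex \<E> 1 0 e \<in> range In_M" by (simp add: vertex_Exit)
    with v show ?thesis by auto
  qed (use v in \<open>auto simp: vertex_def pull_In_M pull_In_N\<close>)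
qed

end

section \<open>Exit paths out of \<open>M\<close> and paths out of \<open>L\<close>\<close>

text \<open>Appending \<open>(1, n)\<close> rather than \<open>(1, \<sigma> k)\<close> is what makes coning natural in the simplex.\<close>

definition cone :: "nat \<Rightarrow> nat \<Rightarrow> (nat \<Rightarrow> nat) \<times> (nat \<Rightarrow> nat) \<Rightarrow> (nat \<Rightarrow> nat) \<times> (nat \<Rightarrow> nat)" where
  "cone n k = (\<lambda>(\<tau>, \<sigma>). (restrict (\<lambda>t. if t \<le> k then \<tau> t else 1) {..Suc k},
                        restrict (\<lambda>t. if t \<le> k then \<sigma> t else n) {..Suc k}))"

lemma cone_simplex:
  assumes "z \<in> simplices (prism n) k"
  shows "cone n k z \<in> simplices (prism n) (Suc k)"
proof -
  obtain \<tau> \<sigma> where z: "z = (\<tau>, \<sigma>)" by (cases z)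
  with assms have \<tau>: "\<tau> \<in> ord_maps k 1" and \<sigma>: "\<sigma> \<in> ord_maps k n"
    by (auto simp: sprod_iff std_simplex_iff)
  have "(\<lambda>t. if t \<le> k then \<tau> t else 1) \<in> ord_maps (Suc k) 1"
    by (rule ord_mapsI) (use ord_maps_le[OF \<tau>] ord_maps_mono[OF \<tau>] in auto)
  moreover have "(\<lambda>t. if t \<le> k then \<sigma> t else n) \<in> ord_maps (Suc k) n"
    by (rule ord_mapsI) (use ord_maps_le[OF \<sigma>] ord_maps_mono[OF \<sigma>] in auto)
  ultimately show ?thesis by (simp add: z cone_def sprod_iff restrict_std_simplex)
qed

lemma pull_id_cone: "z \<in> simplices (prism n) k \<Longrightarrow> pull (prism n) k (Suc k) id (cone n k z) = z"
  by (cases z) (auto simp: cone_def sprod_pull std_simplex_pull sprod_iff std_simplex_iff fun_eq_iff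
      restrict_def extensional_def)

lemma cone_pull:
  assumes \<alpha>: "\<alpha> \<in> ord_maps m k"
  shows "(\<lambda>t. if t \<le> m then \<alpha> t else Suc k) \<in> ord_maps (Suc m) (Suc k)"
    and "cone n m (pull (prism n) m k \<alpha> z) =
      pull (prism n) (Suc m) (Suc k) (\<lambda>t. if t \<le> m then \<alpha> t else Suc k) (cone n k z)"
proof -
  show "(\<lambda>t. if t \<le> m then \<alpha> t else Suc k) \<in> ord_maps (Suc m) (Suc k)"
    by (rule ord_mapsI) (use ord_maps_le[OF \<alpha>] ord_maps_mono[OF \<alpha>] in \<open>auto simp: le_SucI\<close>)
  show "cone n m (pull (prism n) m k \<alpha> z) =
      pull (prism n) (Suc m) (Suc k) (\<lambda>t. if t \<le> m then \<alpha> t else Suc k) (cone n k z)"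
    using ord_maps_le[OF \<alpha>]
    by (cases z) (auto simp: cone_def sprod_pull std_simplex_pull fun_eq_iff le_SucI)
qed

text \<open>The start in \<open>L\<close> is no argument: on side 0 the values of \<open>h\<close>
  are in the image of \<iota>, and \<open>exit_value\<close> recovers the lift from there by
  injectivity.\<close>

definition exit_lift :: "('m, 'l, 'n) sspan \<Rightarrow> nat \<Rightarrow> (nat \<Rightarrow> (nat \<Rightarrow> nat) \<times> (nat \<Rightarrow> nat) \<Rightarrow> 'n)
    \<Rightarrow> nat \<Rightarrow> (nat \<Rightarrow> nat) \<times> (nat \<Rightarrow> nat) \<Rightarrow> ('m, 'n) ex_simplex" where
  "exit_lift S n h k =
    restrict (\<lambda>z. exit_value S k (\<lambda>i. fst z i = 1) (h k z)) (simplices (prism n) k)"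

context linked
begin

lemma up_closed_side:
  assumes "z \<in> simplices (prism n) k"
  shows "s \<le> t \<Longrightarrow> t \<le> k \<Longrightarrow> fst z s = 1 \<Longrightarrow> fst z t = 1"
proof -
  have "fst z \<in> ord_maps k 1" using assms by (cases z) (auto simp: sprod_iff std_simplex_iff)
  from ord_maps_le[OF this, of t] ord_maps_mono[OF this, of s t]
  show "s \<le> t \<Longrightarrow> t \<le> k \<Longrightarrow> fst z s = 1 \<Longrightarrow> fst z t = 1" by simp
qed

text \<open>An initial face before the exit lies over side 0, where \<open>h\<close> is determined
  by its starting simplex; so it is \<iota> of a pullback of \<open>b\<close>.\<close>

lemma exit_lift_smaps:
  assumes h: "h \<in> smaps (prism n) N" and b: "b \<in> simplices L n" and hb: "h n (prism_end 0 n) = \<iota> n b"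
  shows "exit_lift S n h \<in> smaps (prism n) \<E>"
proof -
  note h' = smapsD[OF h]
  have low: "link_below k (\<lambda>i. fst z i = 1) (h k z)" if z: "z \<in> simplices (prism n) k" for k z
    unfolding link_below_def
  proof (intro allI impI)
    fix j assume j: "j \<le> k" and n1: "\<forall>i\<le>j. fst z i \<noteq> 1"
    obtain \<tau> \<sigma> where zx: "z = (\<tau>, \<sigma>)" by (cases z)
    with z have \<tau>: "\<tau> \<in> ord_maps k 1" and \<sigma>: "\<sigma> \<in> ord_maps k n"
      by (auto simp: sprod_iff std_simplex_iff)
    have \<sigma>j: "\<sigma> \<in> ord_maps j n"
      by (rule ord_mapsI) (use j ord_maps_le[OF \<sigma>] ord_maps_mono[OF \<sigma>] in auto)
    have "\<tau> i = 0" if "i \<le> j" for i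
      using n1 ord_maps_le[OF \<tau>, of i] that j by (auto simp: zx le_Suc_eq One_nat_def)
    then have "pull (prism n) j k id z = (restrict (\<lambda>_. 0) {..j}, restrict \<sigma> {..j})"
      by (auto simp: zx sprod_pull std_simplex_pull fun_eq_iff)
    then have "pull N j k id (h k z) = h j (restrict (\<lambda>_. 0) {..j}, restrict \<sigma> {..j})"
      using smap_pull[OF h' id_ord_maps[OF j] z] by simp
    also have "\<dots> = \<iota> j (pull L j n \<sigma> b)"
      by (simp add: smaps_prism_const[OF h' \<sigma>j] hb smap_pull[OF smap_iota \<sigma>j b])
    finally show "pull N j k id (h k z) \<in> \<iota> j ` simplices L j"
      using L.pull_closed[OF \<sigma>j b] by simp
  qed
  have "smap (\<lambda>k z. exit_value S k (\<lambda>i. fst z i = 1) (h k z)) (prism n) \<E>"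
  proof (rule smapI)
    fix k z assume z: "z \<in> simplices (prism n) k"
    show "exit_value S k (\<lambda>i. fst z i = 1) (h k z) \<in> simplices \<E> k"
      by (rule exit_value_closed[OF smap_closed[OF h' z] low[OF z]])
  next
    fix m k \<alpha> z assume \<alpha>: "\<alpha> \<in> ord_maps m k" and z: "z \<in> simplices (prism n) k"
    have "exit_value S m (\<lambda>i. fst (pull (prism n) m k \<alpha> z) i = 1) \<gamma>
      = exit_value S m ((\<lambda>i. fst z i = 1) \<circ> \<alpha>) \<gamma>" for \<gamma>
      by (rule exit_value_cong) (cases z, simp add: sprod_pull std_simplex_pull)
    then show "exit_value S m (\<lambda>i. fst (pull (prism n) m k \<alpha> z) i = 1) (h m (pull (prism n) m k \<alpha> z))
        = pull \<E> m k \<alpha> (exit_value S k (\<lambda>i. fst z i = 1) (h k z))"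
      using pull_exit_value[OF \<alpha> up_closed_side[OF z] smap_closed[OF h' z] low[OF z]]
      by (simp add: smap_pull[OF h' \<alpha> z])
  qed
  from restrict_smaps[OF this simplicial_set_prism] show ?thesis
    by (simp add: exit_lift_def[abs_def])
qed

lemma exit_lift_apply:
  "z \<in> simplices (prism n) k \<Longrightarrow> exit_lift S n h k z = exit_value S k (\<lambda>i. fst z i = 1) (h k z)"
  by (simp add: exit_lift_def)

lemma exit_lift_end0:
  assumes "h n (prism_end 0 n) = \<iota> n b" "b \<in> simplices L n"
  shows "exit_lift S n h n (prism_end 0 n) = In_M (\<pi> n b)"
  using assms by (simp add: exit_lift_apply[OF prism_end_simplex] exit_value_def iota_inv)

lemma exit_lift_end1: "exit_lift S n h n (prism_end 1 n) = In_N (h n (prism_end 1 n))"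
  by (simp add: exit_lift_apply[OF prism_end_simplex] exit_value_N)

text \<open>Values on side 0 retain only their image in \<open>M\<close>. On the cone the apex lies
  on side 1, so the underlying simplex is retained there, and \<open>h\<close> is its face opposite
  the apex.\<close>

lemma exit_lift_inj:
  assumes h: "h \<in> smaps (prism n) N" and h': "h' \<in> smaps (prism n) N"
    and eq: "exit_lift S n h = exit_lift S n h'"
  shows "h = h'"
proof (rule smaps_eqI[OF h h'])
  fix k z assume z: "z \<in> simplices (prism n) k"
  have "g k z = pull N k (Suc k) id (under (exit_lift S n g (Suc k) (cone n k z)))"
    if g: "g \<in> smaps (prism n) N" for g
  proof -
    have "fst (cone n k z) (Suc k) = 1" by (cases z) (simp add: cone_def)
    then have "under (exit_lift S n g (Suc k) (cone n k z)) = g (Suc k) (cone n k z)"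
      by (simp add: exit_lift_apply[OF cone_simplex[OF z]] under_exit_value[OF order_refl])
    then show ?thesis
      using smap_pull[OF smapsD[OF g] id_ord_maps cone_simplex[OF z], of k] pull_id_cone[OF z] by simp
  qed
  from this[OF h] this[OF h'] eq show "h k z = h' k z" by simp
qed

text \<open>A simplex of \<open>M\<close> in the image of \<open>H\<close> has no underlying simplex in \<open>N\<close>; its lift to \<open>L\<close> is recovered
  as a face of the exit path obtained by coning off to the terminal vertex of the prism.\<close>

lemma exit_lift_surj:
  assumes H: "H \<in> smaps (prism n) \<E>" and a: "H n (prism_end 0 n) = In_M a"
    and c: "H n (prism_end 1 n) = In_N c"
  obtains b h where "b \<in> simplices L n" "h \<in> smaps (prism n) N" "h n (prism_end 0 n) = \<iota> n b"
    "\<pi> n b = a" "h n (prism_end 1 n) = c" "exit_lift S n h = H"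
proof -
  note H' = smapsD[OF H]
  \<comment> \<open>A vertex of the prism belongs to one of its two ends, and \<open>a\<close> and
    \<open>c\<close> place these ends in \<open>M\<close> and in \<open>N\<close>.\<close>
  have vert: "vertex \<E> k i (H k z) \<in> (if fst z i = 1 then range In_N else range In_M)"
    if z: "z \<in> simplices (prism n) k" and i: "i \<le> k" for k i z
  proof -
    obtain \<tau> \<sigma> where zx: "z = (\<tau>, \<sigma>)" by (cases z)
    with z have \<tau>: "\<tau> \<in> ord_maps k 1" and \<sigma>: "\<sigma> \<in> ord_maps k n"
      by (auto simp: sprod_iff std_simplex_iff)
    have "vertex \<E> k i (H k z) = H 0 (pull (prism n) 0 k (\<lambda>_. i) z)"
      by (simp add: vertex_def smap_pull[OF H' const_ord_maps[OF i] z])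
    also have "pull (prism n) 0 k (\<lambda>_. i) z = (restrict (\<lambda>_. \<tau> i) {..0}, restrict (\<lambda>_. \<sigma> i) {..0})"
      by (auto simp: zx sprod_pull std_simplex_pull fun_eq_iff)
    also have "H 0 \<dots> = pull \<E> 0 n (\<lambda>_. \<sigma> i) (H n (prism_end (\<tau> i) n))"
      by (rule smaps_prism_const[OF H' const_ord_maps]) (use ord_maps_le[OF \<tau> i] ord_maps_le[OF \<sigma> i] in auto)
    finally show ?thesis
      using ord_maps_le[OF \<tau> i] a c by (auto simp: zx pull_In_M pull_In_N le_Suc_eq One_nat_def)
  qed
  \<comment> \<open>With the last vertex on side 1 the value cannot lie in \<open>M\<close>, so it
    carries a simplex of \<open>N\<close>, and \<open>vert\<close> fixes the index of exit.\<close>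
  have key: "under (H k z) \<in> simplices N k \<and> H k z = exit_value S k (\<lambda>i. fst z i = 1) (under (H k z)) \<and>
      link_below k (\<lambda>i. fst z i = 1) (under (H k z))"
    if z: "z \<in> simplices (prism n) k" and last: "fst z k = 1" for k z
    using smap_closed[OF H' z]
  proof (cases rule: exit_cat_cases)
    case (In_M a')
    then have "vertex \<E> k k (H k z) \<in> range In_M" by (simp add: vertex_def pull_In_M)
    with vert[OF z order_refl] last show ?thesis by auto
  next
    case (In_N c')
    then have "vertex \<E> k 0 (H k z) \<in> range In_N" by (simp add: vertex_def pull_In_N)
    with vert[OF z, of 0] have "fst z 0 = 1" by (auto split: if_splits)
    with In_N show ?thesis by (auto simp: exit_value_N link_below_def)
  next
    case (Exit \<gamma> j)
    have ji: "j \<le> i \<longleftrightarrow> fst z i = 1" if "i \<le> k" for i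
      using vert[OF z that] vertex_Exit[of \<gamma> j k i] smap_closed[OF H' z] Exit(1) that
      by (cases "j \<le> i") (auto split: if_splits)
    have "exit_value S k (\<lambda>i. fst z i = 1) \<gamma> = exit_value S k (\<lambda>i. j \<le> i) \<gamma>"
      by (rule exit_value_cong) (simp add: ji)
    moreover have "link_below k (\<lambda>i. fst z i = 1) \<gamma>"
      using Exit(6) ji by (auto simp: link_below_def)
    ultimately show ?thesis using Exit by simp
  qed
  define h where "h k = restrict (\<lambda>z. pull N k (Suc k) id (under (H (Suc k) (cone n k z)))) (simplices (prism n) k)" for k
  have last: "fst (cone n k z) (Suc k) = 1" for k z by (cases z) (simp add: cone_def)
  note key_cone = key[OF cone_simplex last]
  have Hz: "H k z = exit_value S k (\<lambda>i. fst z i = 1) (h k z)" if z: "z \<in> simplices (prism n) k" for k z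
  proof -
    let ?P = "\<lambda>i. fst (cone n k z) i = 1" and ?\<gamma> = "under (H (Suc k) (cone n k z))"
    have "H k z = pull \<E> k (Suc k) id (exit_value S (Suc k) ?P ?\<gamma>)"
      using smap_pull[OF H' id_ord_maps cone_simplex[OF z], of k] key_cone[OF z] pull_id_cone[OF z] by simp
    also have "\<dots> = exit_value S k (?P \<circ> id) (pull N k (Suc k) id ?\<gamma>)"
      by (rule pull_exit_value[OF id_ord_maps up_closed_side[OF cone_simplex[OF z]]]) (use key_cone[OF z] in auto)
    also have "\<dots> = exit_value S k (\<lambda>i. fst z i = 1) (h k z)"
      using z by (cases z) (auto simp: h_def cone_def intro!: exit_value_cong)
    finally show ?thesis .
  qed
  have h: "h \<in> smaps (prism n) N"
  proof -
    have "smap (\<lambda>k z. pull N k (Suc k) id (under (H (Suc k) (cone n k z)))) (prism n) N"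
    proof (rule smapI)
      fix k z assume "z \<in> simplices (prism n) k"
      then show "pull N k (Suc k) id (under (H (Suc k) (cone n k z))) \<in> simplices N k"
        using N.pull_closed[OF id_ord_maps] key_cone by simp
    next
      fix m k \<alpha> z assume \<alpha>: "\<alpha> \<in> ord_maps m k" and z: "z \<in> simplices (prism n) k"
      let ?\<alpha> = "\<lambda>t. if t \<le> m then \<alpha> t else Suc k"
      let ?P = "\<lambda>i. fst (cone n k z) i = 1" and ?\<gamma> = "under (H (Suc k) (cone n k z))"
      note \<alpha>' = cone_pull[OF \<alpha>]
      have \<gamma>: "?\<gamma> \<in> simplices N (Suc k)" using key_cone[OF z] by simp
      have "H (Suc m) (cone n m (pull (prism n) m k \<alpha> z)) = pull \<E> (Suc m) (Suc k) ?\<alpha> (exit_value S (Suc k) ?P ?\<gamma>)"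
        using smap_pull[OF H' \<alpha>'(1) cone_simplex[OF z]] key_cone[OF z] by (simp only: \<alpha>'(2))
      also have "\<dots> = exit_value S (Suc m) (?P \<circ> ?\<alpha>) (pull N (Suc m) (Suc k) ?\<alpha> ?\<gamma>)"
        by (rule pull_exit_value[OF \<alpha>'(1) up_closed_side[OF cone_simplex[OF z]]]) (use key_cone[OF z] in auto)
      finally have "under (H (Suc m) (cone n m (pull (prism n) m k \<alpha> z))) = pull N (Suc m) (Suc k) ?\<alpha> ?\<gamma>"
        by (simp add: under_exit_value[OF order_refl] last)
      then have "pull N m (Suc m) id (under (H (Suc m) (cone n m (pull (prism n) m k \<alpha> z))))
          = pull N m (Suc k) (?\<alpha> \<circ> id) ?\<gamma>"
        using N.pull_comp[OF id_ord_maps \<alpha>'(1) \<gamma>, of m] by simp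
      \<comment> \<open>Away from the apex the extended ordinal map is \<alpha> itself, so
        naturality on cones restricts to naturality of \<open>h\<close>.\<close>
      also have "\<dots> = pull N m (Suc k) (id \<circ> \<alpha>) ?\<gamma>"
        by (rule N.pull_cong[OF ord_maps_comp[OF id_ord_maps \<alpha>'(1)] \<gamma>]) auto
      also have "\<dots> = pull N m k \<alpha> (pull N k (Suc k) id ?\<gamma>)"
        by (rule N.pull_comp[OF \<alpha> id_ord_maps \<gamma>]) simp
      finally show "pull N m (Suc m) id (under (H (Suc m) (cone n m (pull (prism n) m k \<alpha> z))))
          = pull N m k \<alpha> (pull N k (Suc k) id ?\<gamma>)" .
    qed
    from restrict_smaps[OF this simplicial_set_prism] show ?thesis by (simp add: h_def[abs_def])
  qed
  have "exit_lift S n h = H"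
  proof (intro ext)
    fix k z show "exit_lift S n h k z = H k z"
      using H by (cases z; cases "z \<in> simplices (prism n) k")
        (auto simp: exit_lift_def Hz smaps_def extensional_def)
  qed
  moreover have "\<exists>b\<in>simplices L n. h n (prism_end 0 n) = \<iota> n b"
  proof -
    have z: "prism_end 0 n \<in> simplices (prism n) n" by (simp add: prism_end_simplex)
    \<comment> \<open>The cone on the starting end is an exit path of index \<open>Suc n\<close>.
      Its link condition says that the face opposite the apex, the start of \<open>h\<close>, comes
      from \<open>L\<close>.\<close>
    have "\<forall>i\<le>n. fst (cone n n (prism_end 0 n)) i \<noteq> 1" by (simp add: cone_def)
    then have "pull N n (Suc n) id (under (H (Suc n) (cone n n (prism_end 0 n)))) \<in> \<iota> n ` simplices L n"
      using key_cone[OF z] unfolding link_below_def by (meson le_SucI order_refl)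
    then show ?thesis using z by (auto simp: h_def)
  qed
  then obtain b where b: "b \<in> simplices L n" "h n (prism_end 0 n) = \<iota> n b" by blast
  moreover have "\<pi> n b = a"
    using exit_lift_end0[of h n b, OF b(2,1)] a \<open>exit_lift S n h = H\<close> by simp
  moreover have "h n (prism_end 1 n) = c"
    using exit_lift_end1[of n h] c \<open>exit_lift S n h = H\<close> by simp
  ultimately show ?thesis using that h by blast
qed

text \<open>Pulling back in a path space changes only the second prism coordinate, while the exit
  set depends on the first.\<close>

lemma exit_lift_pull:
  assumes \<alpha>: "\<alpha> \<in> ord_maps m n" and h: "h \<in> smaps (prism n) N" and b: "b \<in> simplices L n"
    and hb: "h n (prism_end 0 n) = \<iota> n b"
  shows "exit_lift S m (pull (map_space (std_simplex 1) N) m n \<alpha> h) =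
    pull (map_space (std_simplex 1) \<E>) m n \<alpha> (exit_lift S n h)"
proof (intro ext)
  fix k z
  show "exit_lift S m (pull (map_space (std_simplex 1) N) m n \<alpha> h) k z =
    pull (map_space (std_simplex 1) \<E>) m n \<alpha> (exit_lift S n h) k z"
  proof (cases "z \<in> simplices (prism m) k")
    case True
    then obtain \<tau> \<sigma> where z: "z = (\<tau>, \<sigma>)" "\<tau> \<in> simplices (std_simplex 1) k" "\<sigma> \<in> simplices (std_simplex m) k"
      by (cases z) (auto simp: sprod_iff)
    with True std_simplex_postcomp[OF \<alpha> z(3)] show ?thesis
      by (simp add: exit_lift_apply sprod_iff map_space_pull_apply)
  qed (simp add: exit_lift_def map_space_def)
qed

definition exit_map :: "nat \<Rightarrow> 'l \<times> (nat \<Rightarrow> (nat \<Rightarrow> nat) \<times> (nat \<Rightarrow> nat) \<Rightarrow> 'n) \<times> 'n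
    \<Rightarrow> 'm \<times> (nat \<Rightarrow> (nat \<Rightarrow> nat) \<times> (nat \<Rightarrow> nat) \<Rightarrow> ('m, 'n) ex_simplex) \<times> 'n" where
  "exit_map n = (\<lambda>(b, h, c). (\<pi> n b, exit_lift S n h, c))"

lemma LN_iff: "(b, h, c) \<in> simplices (LN_comma S) n \<longleftrightarrow>
    b \<in> simplices L n \<and> c \<in> simplices N n \<and> h \<in> smaps (prism n) N \<and>
    h n (prism_end 0 n) = \<iota> n b \<and> h n (prism_end 1 n) = c"
  by (simp add: LN_comma_def comma_iff)

lemma MN_iff: "(a, H, c) \<in> simplices (MN_comma S) n \<longleftrightarrow>
    a \<in> simplices M n \<and> c \<in> simplices N n \<and> H \<in> smaps (prism n) \<E> \<and>
    H n (prism_end 0 n) = In_M a \<and> H n (prism_end 1 n) = In_N c"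
  by (simp add: MN_comma_def comma_iff)

lemma LN_pull: "pull (LN_comma S) m n \<alpha> (b, h, c) =
    (pull L m n \<alpha> b, pull (map_space (std_simplex 1) N) m n \<alpha> h, pull N m n \<alpha> c)"
  by (simp add: LN_comma_def comma_pull)

lemma MN_pull: "pull (MN_comma S) m n \<alpha> (a, H, c) =
    (pull M m n \<alpha> a, pull (map_space (std_simplex 1) \<E>) m n \<alpha> H, pull N m n \<alpha> c)"
  by (simp add: MN_comma_def comma_pull)

lemma smap_id: "smap (\<lambda>_. id) X X"
  by (rule smapI) auto

lemma simplicial_set_LN: "simplicial_set (LN_comma S)"
  unfolding LN_comma_def
  by (intro simplicial_set_comma L.simplicial_set_axioms N.simplicial_set_axioms smap_iota smap_id)

lemma simplicial_set_MN: "simplicial_set (MN_comma S)"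
  unfolding MN_comma_def
  by (intro simplicial_set_comma M.simplicial_set_axioms N.simplicial_set_axioms smap_In_M smap_In_N)

lemma siso_exit_map: "siso exit_map (LN_comma S) (MN_comma S)"
  unfolding siso_def
proof (intro conjI allI)
  show sm: "smap exit_map (LN_comma S) (MN_comma S)"
  proof (rule smapI)
    fix k x assume "x \<in> simplices (LN_comma S) k"
    then show "exit_map k x \<in> simplices (MN_comma S) k"
      by (cases x) (auto simp: LN_iff MN_iff exit_map_def exit_lift_smaps exit_lift_end0 exit_lift_end1 smap_closed[OF smap_pi])
  next
    fix m n \<alpha> x assume \<alpha>: "\<alpha> \<in> ord_maps m n" and "x \<in> simplices (LN_comma S) n"
    then show "exit_map m (pull (LN_comma S) m n \<alpha> x) = pull (MN_comma S) m n \<alpha> (exit_map n x)"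
      by (cases x) (auto simp: LN_iff exit_map_def LN_pull MN_pull exit_lift_pull smap_pull[OF smap_pi])
  qed
  fix n
  show "bij_betw (exit_map n) (simplices (LN_comma S) n) (simplices (MN_comma S) n)"
  proof (rule bij_betwI')
    fix x y assume x: "x \<in> simplices (LN_comma S) n" and y: "y \<in> simplices (LN_comma S) n"
    obtain b h c where xb: "x = (b, h, c)" by (cases x) auto
    obtain b' h' c' where yb: "y = (b', h', c')" by (cases y) auto
    note xy = xb yb
    show "exit_map n x = exit_map n y \<longleftrightarrow> x = y"
    proof
      assume "exit_map n x = exit_map n y"
      \<comment> \<open>The component \<open>\<pi> n b\<close> need not determine \<open>b\<close>.
        The path is recovered before its start, and the start then gives \<open>b\<close> through
        injectivity of \<iota>.\<close>
      with x y have "h = h'" "c = c'" by (auto simp: xy LN_iff exit_map_def intro: exit_lift_inj)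
      with x y show "x = y" using inj_onD[OF iota_inj, of n b b'] by (simp add: xy LN_iff)
    qed simp
  next
    fix x assume "x \<in> simplices (LN_comma S) n"
    then show "exit_map n x \<in> simplices (MN_comma S) n" by (rule smap_closed[OF sm])
  next
    fix y assume y: "y \<in> simplices (MN_comma S) n"
    obtain a H c where yx: "y = (a, H, c)" by (cases y) auto
    with y have H: "H \<in> smaps (prism n) \<E>" "H n (prism_end 0 n) = In_M a" "H n (prism_end 1 n) = In_N c"
      and c: "c \<in> simplices N n" by (auto simp: MN_iff)
    from exit_lift_surj[OF H] obtain b h where "b \<in> simplices L n" "h \<in> smaps (prism n) N"
      "h n (prism_end 0 n) = \<iota> n b" "\<pi> n b = a" "h n (prism_end 1 n) = c" "exit_lift S n h = H" .
    with c show "\<exists>x\<in>simplices (LN_comma S) n. y = exit_map n x"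
      by (intro bexI[of _ "(b, h, c)"]) (simp_all add: LN_iff exit_map_def yx)
  qed
qed

section \<open>Mapping spaces from an object of \<open>M\<close> to an object of
  \<open>N\<close>\<close>

lemma simplicial_set_spoint:
  assumes "simplicial_set X" "x \<in> simplices X 0"
  shows "simplicial_set (spoint X x)" and "smap (\<lambda>_. id) (spoint X x) X"
proof -
  interpret X: simplicial_set X by fact
  have c: "(\<lambda>_. 0) \<in> ord_maps k 0" for k by (rule const_ord_maps) simp
  have pp: "pull X m k \<alpha> (pull X k 0 (\<lambda>_. 0) x) = pull X m 0 (\<lambda>_. 0) x" if "\<alpha> \<in> ord_maps m k" for m k \<alpha>
    using X.pull_comp[OF that c assms(2)] by (simp add: comp_def)
  show "simplicial_set (spoint X x)"
    by unfold_locales (auto simp: spoint_def pp ord_maps_comp id_ord_maps dest: ord_maps_cong)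
  show "smap (\<lambda>_. id) (spoint X x) X"
    by (rule smapI) (auto simp: spoint_def X.pull_closed[OF c assms(2)])
qed

end

lemma simplicial_set_fibre_prod:
  assumes A: "simplicial_set A" and B: "simplicial_set B" and f: "smap f A C" and g: "smap g B C"
  shows "simplicial_set (fibre_prod A f g B)"
proof -
  interpret P: simplicial_set "sprod A B" by (rule simplicial_set_sprod[OF A B])
  have sub: "x \<in> simplices (sprod A B) k" if "x \<in> simplices (fibre_prod A f g B) k" for x k
    using that by (auto simp: fibre_prod_def sprod_iff)
  have pull: "pull (fibre_prod A f g B) = pull (sprod A B)" by (simp add: fibre_prod_def)
  show ?thesis
  proof
    fix m k \<alpha> x assume \<alpha>: "\<alpha> \<in> ord_maps m k" and x: "x \<in> simplices (fibre_prod A f g B) k"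
    then show "pull (fibre_prod A f g B) m k \<alpha> x \<in> simplices (fibre_prod A f g B) m"
      using P.pull_closed[OF \<alpha> sub[OF x]]
      by (auto simp: fibre_prod_def sprod_pull sprod_iff smap_pull[OF f \<alpha>] smap_pull[OF g \<alpha>])
  qed (unfold pull, (blast intro: P.pull_id P.pull_comp P.pull_cong sub)+)
qed

context linked
begin

lemma link_fibre_iff: "(p', b) \<in> simplices (link_fibre S p) k \<longleftrightarrow>
    p' = pull M k 0 (\<lambda>_. 0) p \<and> b \<in> simplices L k \<and> p' = \<pi> k b"
  by (auto simp: link_fibre_def fibre_prod_def spoint_def)

lemma fibre_paths_iff: "((p', b), h, q') \<in> simplices (fibre_paths S p q) n \<longleftrightarrow>
    p' = pull M n 0 (\<lambda>_. 0) p \<and> p' = \<pi> n b \<and> q' = pull N n 0 (\<lambda>_. 0) q \<and>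
    b \<in> simplices L n \<and> h \<in> smaps (prism n) N \<and>
    h n (prism_end 0 n) = \<iota> n b \<and> h n (prism_end 1 n) = q'"
  by (auto simp: fibre_paths_def comma_iff link_fibre_iff spoint_def)

lemma fibre_paths_pull: "pull (fibre_paths S p q) m n \<alpha> ((p', b), h, q') =
    ((pull M m n \<alpha> p', pull L m n \<alpha> b), pull (map_space (std_simplex 1) N) m n \<alpha> h, pull N m n \<alpha> q')"
  by (simp add: fibre_paths_def comma_pull link_fibre_def fibre_prod_def spoint_def sprod_pull)

lemma hom_space_iff: "(a, H, c) \<in> simplices (hom_space \<E> (In_M p) (In_N q)) n \<longleftrightarrow>
    a = In_M (pull M n 0 (\<lambda>_. 0) p) \<and> c = In_N (pull N n 0 (\<lambda>_. 0) q) \<and>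
    H \<in> smaps (prism n) \<E> \<and> H n (prism_end 0 n) = a \<and> H n (prism_end 1 n) = c"
  by (auto simp: hom_space_def comma_iff spoint_def pull_In_M pull_In_N)

lemma hom_space_pull: "pull (hom_space \<E> (In_M p) (In_N q)) m n \<alpha> (a, H, c) =
    (pull \<E> m n \<alpha> a, pull (map_space (std_simplex 1) \<E>) m n \<alpha> H, pull \<E> m n \<alpha> c)"
  by (simp add: hom_space_def comma_pull spoint_def)

lemma simplicial_set_hom_space:
  assumes "p \<in> simplices M 0" "q \<in> simplices N 0"
  shows "simplicial_set (hom_space \<E> (In_M p) (In_N q))"
  unfolding hom_space_def using assms
  by (intro simplicial_set_comma simplicial_set_spoint \<E>.simplicial_set_axioms)
    (simp_all add: In_M_simplex In_N_simplex)

lemma simplicial_set_fibre_paths: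
  assumes p: "p \<in> simplices M 0" and q: "q \<in> simplices N 0"
  shows "simplicial_set (fibre_paths S p q)"
proof -
  have "simplicial_set (link_fibre S p)"
    unfolding link_fibre_def
    by (rule simplicial_set_fibre_prod[OF simplicial_set_spoint(1)[OF M.simplicial_set_axioms p]
          L.simplicial_set_axioms simplicial_set_spoint(2)[OF M.simplicial_set_axioms p] smap_pi])
  moreover have "smap (\<lambda>k. \<iota> k \<circ> snd) (link_fibre S p) N"
    by (rule smapI) (auto simp: link_fibre_iff link_fibre_def fibre_prod_def sprod_def smap_closed[OF smap_iota] smap_pull[OF smap_iota])
  ultimately show ?thesis
    unfolding fibre_paths_def
    by (intro simplicial_set_comma simplicial_set_spoint N.simplicial_set_axioms q)
qed

lemma hom_space_equivalence:
  assumes p: "p \<in> simplices M 0" and q: "q \<in> simplices N 0"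
  shows "\<exists>f. equivalence f (hom_space \<E> (In_M p) (In_N q)) (fibre_paths S p q)"
proof -
  let ?H = "hom_space \<E> (In_M p) (In_N q)" and ?F = "fibre_paths S p q"
  define \<Phi> where "\<Phi> n = (\<lambda>((p' :: 'm, b :: 'l), h, q' :: 'n). (In_M p' :: ('m, 'n) ex_simplex, exit_lift S n h,
    In_N q' :: ('m, 'n) ex_simplex))" for n
  have "siso \<Phi> ?F ?H"
    unfolding siso_def
  proof (intro conjI allI)
    show sm: "smap \<Phi> ?F ?H"
    proof (rule smapI)
      fix n x assume "x \<in> simplices ?F n"
      moreover obtain p' b h q' where x: "x = ((p', b), h, q')" by (cases x) auto
      ultimately show "\<Phi> n x \<in> simplices ?H n"
        using exit_lift_end0[of h n b] exit_lift_end1[of n h]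
        by (auto simp: fibre_paths_iff hom_space_iff \<Phi>_def intro: exit_lift_smaps)
    next
      fix m n \<alpha> x assume \<alpha>: "\<alpha> \<in> ord_maps m n" and "x \<in> simplices ?F n"
      moreover obtain p' b h q' where x: "x = ((p', b), h, q')" by (cases x) auto
      ultimately show "\<Phi> m (pull ?F m n \<alpha> x) = pull ?H m n \<alpha> (\<Phi> n x)"
        using exit_lift_pull[OF \<alpha>, of h b]
        by (auto simp: fibre_paths_iff fibre_paths_pull hom_space_pull \<Phi>_def pull_In_M pull_In_N)
    qed
    fix n
    show "bij_betw (\<Phi> n) (simplices ?F n) (simplices ?H n)"
    proof (rule bij_betwI')
      fix x y assume x: "x \<in> simplices ?F n" and y: "y \<in> simplices ?F n"
      obtain p' b h q' where xb: "x = ((p', b), h, q')" by (cases x) auto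
      obtain p'' b' h' q'' where yb: "y = ((p'', b'), h', q'')" by (cases y) auto
      note xy = xb yb
      show "\<Phi> n x = \<Phi> n y \<longleftrightarrow> x = y"
      proof
        assume "\<Phi> n x = \<Phi> n y"
        with x y have "h = h'" "p' = p''" "q' = q''"
          by (auto simp: xy fibre_paths_iff \<Phi>_def intro: exit_lift_inj)
        with x y show "x = y" using inj_onD[OF iota_inj, of n b b'] by (simp add: xy fibre_paths_iff)
      qed simp
    next
      fix x assume "x \<in> simplices ?F n"
      then show "\<Phi> n x \<in> simplices ?H n" by (rule smap_closed[OF sm])
    next
      fix y assume y: "y \<in> simplices ?H n"
      obtain a H c where yx: "y = (a, H, c)" by (cases y) auto
      let ?p = "pull M n 0 (\<lambda>_. 0) p" and ?q = "pull N n 0 (\<lambda>_. 0) q"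
      from y have H: "H \<in> smaps (prism n) \<E>" "H n (prism_end 0 n) = In_M ?p" "H n (prism_end 1 n) = In_N ?q"
        and ac: "a = In_M ?p" "c = In_N ?q" by (auto simp: yx hom_space_iff)
      from exit_lift_surj[OF H] obtain b h where "b \<in> simplices L n" "h \<in> smaps (prism n) N"
        "h n (prism_end 0 n) = \<iota> n b" "\<pi> n b = ?p" "h n (prism_end 1 n) = ?q" "exit_lift S n h = H" .
      then show "\<exists>x\<in>simplices ?F n. y = \<Phi> n x"
        by (intro bexI[of _ "((?p, b), h, ?q)"]) (simp_all add: fibre_paths_iff \<Phi>_def yx ac)
    qed
  qed
  note F = simplicial_set_fibre_paths[OF p q]
  from siso_imp_equivalence[OF siso_inverse(1)[OF \<open>siso \<Phi> ?F ?H\<close> F] simplicial_set_hom_space[OF p q] F]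
  show ?thesis by blast
qed

section \<open>Constant exit loops\<close>

text \<open>The transpose of the projection from \<open>L x \<Delta>[1]\<close> to \<open>L\<close>
  followed by \<iota>; simpliciality thus comes from \<open>smap_into_comma\<close>.\<close>

definition const_paths :: "nat \<Rightarrow> 'l \<Rightarrow> 'l \<times> (nat \<Rightarrow> (nat \<Rightarrow> nat) \<times> (nat \<Rightarrow> nat) \<Rightarrow> 'n) \<times> 'n" where
  "const_paths n b = (b, cyl_transpose L (\<lambda>k z. \<iota> k (fst z)) n b, \<iota> n b)"

lemma smap_const_cyl: "smap (\<lambda>k z. \<iota> k (fst z)) (sprod L (std_simplex 1)) N"
  using smap_comp[OF smap_fst smap_iota] by (simp add: comp_def)

lemma smap_const_paths: "smap const_paths L (LN_comma S)"
  unfolding const_paths_def[abs_def] LN_comma_def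
  using smap_into_comma[OF L.simplicial_set_axioms smap_const_cyl smap_id smap_iota, of \<iota> "\<lambda>_. id"] by simp

lemma prism_simplex_simplex:
  assumes "j \<in> {1..Suc n}"
  shows "prism_simplex n j \<in> simplices (prism n) (Suc n)"
  using assms unfolding prism_simplex_def sprod_iff
  by (intro conjI restrict_std_simplex ord_mapsI) auto

text \<open>The level \<open>i\<close> of \<open>prism_factor\<close> counts from 0 the last vertex
  on side 0, whereas \<open>prism_simplex\<close> is indexed by the first vertex on side 1, hence
  \<open>j = Suc i\<close>.\<close>

lemma prism_covered:
  assumes z: "z \<in> simplices (prism n) k"
  obtains j \<alpha> where "j \<in> {1..Suc n}" "\<alpha> \<in> ord_maps k (Suc n)" "z = pull (prism n) k (Suc n) \<alpha> (prism_simplex n j)"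
proof -
  obtain \<tau> \<sigma> where zx: "z = (\<tau>, \<sigma>)" by (cases z)
  with z have \<tau>: "\<tau> \<in> ord_maps k 1" "\<tau> \<in> extensional {..k}" and \<sigma>: "\<sigma> \<in> ord_maps k n" "\<sigma> \<in> extensional {..k}"
    by (auto simp: sprod_iff std_simplex_iff)
  obtain i \<alpha> where i: "i \<le> n" and \<alpha>: "\<alpha> \<in> ord_maps k (Suc n)"
    and eq: "\<And>t. t \<le> k \<Longrightarrow> codegen i (\<alpha> t) = \<sigma> t" "\<And>t. t \<le> k \<Longrightarrow> \<alpha> t \<le> i \<longleftrightarrow> \<tau> t = 0"
    using prism_factor[OF \<tau>(1) \<sigma>(1)] by metis
  have "restrict (restrict (\<lambda>s. if s < Suc i then 0 else 1) {..Suc n} \<circ> \<alpha>) {..k} = \<tau>"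
  proof (rule extensionalityI[where A = "{..k}"])
    fix t assume "t \<in> {..k}"
    then show "restrict (restrict (\<lambda>s. if s < Suc i then 0 else 1) {..Suc n} \<circ> \<alpha>) {..k} t = \<tau> t"
      using eq(2)[of t] ord_maps_le[OF \<tau>(1), of t] ord_maps_le[OF \<alpha>, of t] by auto
  qed (use \<tau> in auto)
  moreover have "restrict (restrict (\<lambda>s. if s < Suc i then s else s - 1) {..Suc n} \<circ> \<alpha>) {..k} = \<sigma>"
  proof (rule extensionalityI[where A = "{..k}"])
    fix t assume "t \<in> {..k}"
    then show "restrict (restrict (\<lambda>s. if s < Suc i then s else s - 1) {..Suc n} \<circ> \<alpha>) {..k} t = \<sigma> t"
      using eq(1)[of t] ord_maps_le[OF \<alpha>, of t] by (auto simp: codegen_def)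
  qed (use \<sigma> in auto)
  ultimately show ?thesis
    using that[of "Suc i" \<alpha>] i \<alpha> by (simp add: zx prism_simplex_def sprod_pull std_simplex_pull)
qed

text \<open>The exit lift of the constant path has the prescribed values, and there is no other such
  map because the simplices \<S>\<open>_j\<close> cover the prism. This determines the description
  operator in \<open>Box\<close>.\<close>

lemma constant_exit_loop_iff:
  assumes b: "b \<in> simplices L n"
  shows "constant_exit_loop S n b h \<longleftrightarrow> h = exit_lift S n (fst (snd (const_paths n b)))"
proof -
  let ?c = "fst (snd (const_paths n b))"
  have c: "?c \<in> smaps (prism n) N" "?c n (prism_end 0 n) = \<iota> n b"
    using smap_closed[OF smap_const_paths b] by (simp_all add: const_paths_def LN_iff)
  have H: "exit_lift S n ?c \<in> smaps (prism n) \<E>" by (rule exit_lift_smaps[OF c(1) b c(2)])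
  have loop: "exit_lift S n ?c (Suc n) (prism_simplex n j) = Exit (degen N n (j - 1) (\<iota> n b)) j"
    if j: "j \<in> {1..Suc n}" for j
  proof -
    let ?\<sigma> = "restrict (\<lambda>i. if i < j then i else i - 1) {..Suc n}"
    have jn: "j - 1 \<le> n" using j by auto
    have s: "prism_simplex n j \<in> simplices (prism n) (Suc n)" by (rule prism_simplex_simplex[OF j])
    \<comment> \<open>On its domain the second coordinate of \<open>prism_simplex n j\<close> is the
      codegeneracy \<open>codegen (j - 1)\<close>, the origin of the degeneracy in the constant
      loop.\<close>
    have "pull L (Suc n) n ?\<sigma> b = pull L (Suc n) n (codegen (j - 1)) b"
      by (rule L.pull_cong[OF codegen_ord_maps[OF jn] b, symmetric]) (use j in \<open>auto simp: codegen_def\<close>)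
    then have "?c (Suc n) (prism_simplex n j) = degen N n (j - 1) (\<iota> n b)"
      using s smap_pull[OF smap_iota codegen_ord_maps[OF jn] b]
      by (simp add: const_paths_def prism_simplex_def sprod_iff cyl_transpose_apply degen_def)
    moreover have "exit_value S (Suc n) (\<lambda>i. fst (prism_simplex n j) i = 1) \<gamma> = Exit \<gamma> j" for \<gamma>
    proof -
      have "exit_value S (Suc n) (\<lambda>i. fst (prism_simplex n j) i = 1) \<gamma> = exit_value S (Suc n) (\<lambda>i. j \<le> i) \<gamma>"
        by (rule exit_value_cong) (simp add: prism_simplex_def)
      also have "\<dots> = Exit \<gamma> (LEAST i. i \<le> Suc n \<and> j \<le> i)"
        by (rule exit_value_Exit) (use j in auto)
      also have "(LEAST i. i \<le> Suc n \<and> j \<le> i) = j"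
        by (rule Least_equality) (use j in auto)
      finally show ?thesis .
    qed
    ultimately show ?thesis by (simp add: exit_lift_apply[OF s])
  qed
  show ?thesis
  proof
    assume h: "constant_exit_loop S n b h"
    then have hs: "h \<in> smaps (prism n) \<E>" by (simp add: constant_exit_loop_def)
    show "h = exit_lift S n ?c"
    proof (rule smaps_eqI[OF hs H])
      fix k z assume "z \<in> simplices (prism n) k"
      then obtain j \<alpha> where j: "j \<in> {1..Suc n}" and \<alpha>: "\<alpha> \<in> ord_maps k (Suc n)"
        and z: "z = pull (prism n) k (Suc n) \<alpha> (prism_simplex n j)" by (rule prism_covered)
      then show "h k z = exit_lift S n ?c k z"
        using h smap_pull[OF smapsD[OF hs] \<alpha> prism_simplex_simplex[OF j]]
          smap_pull[OF smapsD[OF H] \<alpha> prism_simplex_simplex[OF j]] loop[OF j]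
        by (simp add: constant_exit_loop_def)
    qed
  next
    assume "h = exit_lift S n ?c"
    then show "constant_exit_loop S n b h" using H loop by (simp add: constant_exit_loop_def)
  qed
qed

lemma constant_exit_loop_unique: "b \<in> simplices L n \<Longrightarrow> \<exists>!h. constant_exit_loop S n b h"
  by (simp add: constant_exit_loop_iff)

lemma Box_eq: "b \<in> simplices L n \<Longrightarrow> Box S n b = exit_map n (const_paths n b)"
  by (simp add: Box_def constant_exit_loop_iff exit_map_def const_paths_def)

lemma smono_Box: "smono (Box S) L (MN_comma S)"
  unfolding smono_def
proof (intro conjI allI)
  have "smap exit_map (LN_comma S) (MN_comma S)" using siso_exit_map by (simp add: siso_def)
  then have "smap (\<lambda>n. exit_map n \<circ> const_paths n) L (MN_comma S)"
    by (rule smap_comp[OF smap_const_paths])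
  then show "smap (Box S) L (MN_comma S)"
    by (rule smap_cong_simplices[OF _ L.simplicial_set_axioms]) (simp add: Box_eq)
  show "inj_on (Box S k) (simplices L k)" for k
    using iota_inj[of k] by (simp add: inj_on_def Box_def)
qed

text \<open>Homotopy extension along the two ends of \<open>codiscrete\<close> contracts each path in \<open>N\<close> coherently to the
  constant path at its starting point, keeping that point fixed.\<close>

lemma path_contraction:
  assumes N: "kan_complex N"
  obtains G where "smap G (sprod (LN_comma S) codiscrete) (LN_comma S)"
    "\<And>n y. y \<in> simplices (LN_comma S) n \<Longrightarrow> G n (y, restrict (\<lambda>_. 0) {..n}) = const_paths n (fst y)"
    "\<And>n y. y \<in> simplices (LN_comma S) n \<Longrightarrow> G n (y, restrict (\<lambda>_. 1) {..n}) = y"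
proof -
  let ?Y = "LN_comma S" and ?B = "sprod (LN_comma S) codiscrete"
  interpret Y: simplicial_set ?Y by (rule simplicial_set_LN)
  have B: "simplicial_set ?B" by (rule simplicial_set_sprod[OF simplicial_set_LN simplicial_set_codiscrete])
  interpret B: simplicial_set ?B by (rule B)
  \<comment> \<open>The two ends of the groupoid direction: a simplex of \<open>codiscrete\<close>
    lies in an end exactly if its labels are constant.\<close>
  define A where "A k = {(y, \<chi>) \<in> simplices ?B k. \<exists>e. \<forall>t\<le>k. \<chi> t = e}" for k
  \<comment> \<open>On the ends the label \<open>\<chi> 0\<close> tells which end is meant: the
    constant path for 0, the given path for 1. On the bottom the labels may vary, but only the
    starting point is used.\<close>
  define \<psi> :: "nat \<Rightarrow> (('l \<times> (nat \<Rightarrow> (nat \<Rightarrow> nat) \<times> (nat \<Rightarrow> nat) \<Rightarrow> 'n) \<times> 'n) \<times> (nat \<Rightarrow> nat)) \<times> (nat \<Rightarrow> nat) \<Rightarrow> 'n"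
    where "\<psi> k = (\<lambda>(((b, h, c), \<chi>), \<tau>). if \<chi> 0 = 0 \<or> (\<forall>t\<le>k. \<tau> t = 0) then \<iota> k b
      else h k (\<tau>, restrict id {..k}))" for k
  have A: "sieve ?B A"
    unfolding sieve_def
  proof (intro conjI allI ballI)
    fix m k \<alpha> z assume \<alpha>: "\<alpha> \<in> ord_maps m k" and "z \<in> A k"
    moreover obtain y \<chi> where "z = (y, \<chi>)" by (cases z)
    ultimately show "pull ?B m k \<alpha> z \<in> A m"
      using B.pull_closed[OF \<alpha>, of z] ord_maps_le[OF \<alpha>]
      by (auto simp: A_def sprod_pull codiscrete_pull)
  qed (auto simp: A_def)
  \<comment> \<open>On side 0 a path agrees with its recorded start; this reconciles the two clauses
    of \<psi> where they overlap.\<close>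
  have restr: "h k (\<tau>, restrict \<sigma> {..k}) = \<iota> k (pull L k n \<sigma> b)"
    if y: "(b, h, c) \<in> simplices ?Y n" and \<tau>: "\<tau> \<in> simplices (std_simplex 1) k" and \<sigma>: "\<sigma> \<in> ord_maps k n"
      and 0: "\<forall>t\<le>k. \<tau> t = 0" for b h c n k \<sigma> \<tau>
  proof -
    have "\<tau> = restrict (\<lambda>_. 0) {..k}"
      by (rule extensionalityI[where A = "{..k}"]) (use \<tau> 0 in \<open>auto simp: std_simplex_iff\<close>)
    then show ?thesis
      using y smaps_prism_const[OF smapsD \<sigma>, of h N 0] by (simp add: LN_iff smap_pull[OF smap_iota \<sigma>])
  qed
  have \<psi>: "smap \<psi> ((sprod ?B (std_simplex 1))\<lparr>simplices := cyl_sieve ?B A\<rparr>) N"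
  proof (rule smapI)
    fix k z assume "z \<in> simplices ((sprod ?B (std_simplex 1))\<lparr>simplices := cyl_sieve ?B A\<rparr>) k"
    moreover obtain b h c \<chi> \<tau> where z: "z = (((b, h, c), \<chi>), \<tau>)" by (cases z) auto
    ultimately have b: "b \<in> simplices L k" and h: "h \<in> smaps (prism k) N" and \<tau>: "\<tau> \<in> simplices (std_simplex 1) k"
      by (simp_all add: cyl_sieve_def sprod_iff LN_iff)
    have "h k (\<tau>, restrict id {..k}) \<in> simplices N k"
      by (rule smap_closed[OF smapsD[OF h]]) (simp add: sprod_iff \<tau> restrict_std_simplex id_ord_maps)
    then show "\<psi> k z \<in> simplices N k"
      using smap_closed[OF smap_iota b] by (simp add: z \<psi>_def)
  next
    fix m k \<alpha> z assume \<alpha>: "\<alpha> \<in> ord_maps m k"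
      and "z \<in> simplices ((sprod ?B (std_simplex 1))\<lparr>simplices := cyl_sieve ?B A\<rparr>) k"
    moreover obtain b h c \<chi> \<tau> where z: "z = (((b, h, c), \<chi>), \<tau>)" by (cases z) auto
    ultimately have y: "(b, h, c) \<in> simplices ?Y k" and \<tau>: "\<tau> \<in> simplices (std_simplex 1) k"
      and z': "(\<exists>e. \<forall>t\<le>k. \<chi> t = e) \<or> (\<forall>t\<le>k. \<tau> t = 0)"
      by (auto simp: cyl_sieve_def sprod_iff A_def)
    have b: "b \<in> simplices L k" and h: "h \<in> smaps (prism k) N" using y by (auto simp: LN_iff)
    have id: "restrict id {..k} \<in> simplices (std_simplex k) k" "restrict id {..m} \<in> simplices (std_simplex m) m"
      by (auto intro!: restrict_std_simplex id_ord_maps)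
    let ?\<tau> = "restrict (\<tau> \<circ> \<alpha>) {..m}"
    have \<tau>\<alpha>: "?\<tau> \<in> simplices (std_simplex 1) m"
      using simplicial_set.pull_closed[OF simplicial_set_std_simplex \<alpha> \<tau>] by (simp add: std_simplex_pull)
    have "restrict (restrict id {..k} \<circ> \<alpha>) {..m} = restrict \<alpha> {..m}"
      using ord_maps_le[OF \<alpha>] by (auto simp: fun_eq_iff)
    then have hp: "pull N m k \<alpha> (h k (\<tau>, restrict id {..k})) = h m (?\<tau>, restrict \<alpha> {..m})"
      using smap_pull[OF smapsD[OF h] \<alpha>, of "(\<tau>, restrict id {..k})"] \<tau> id
      by (simp add: sprod_iff sprod_pull std_simplex_pull)
    have "restrict (\<alpha> \<circ> restrict id {..m}) {..m} = restrict \<alpha> {..m}" by (auto simp: fun_eq_iff)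
    then have ph: "pull (map_space (std_simplex 1) N) m k \<alpha> h m (?\<tau>, restrict id {..m}) = h m (?\<tau>, restrict \<alpha> {..m})"
      by (simp add: map_space_pull_apply[OF \<tau>\<alpha> id(2)])
    have "\<psi> m (pull (sprod ?B (std_simplex 1)) m k \<alpha> z) =
      (if \<chi> (\<alpha> 0) = 0 \<or> (\<forall>t\<le>m. \<tau> (\<alpha> t) = 0) then \<iota> m (pull L m k \<alpha> b) else h m (?\<tau>, restrict \<alpha> {..m}))"
      by (auto simp: z \<psi>_def sprod_pull LN_pull codiscrete_pull std_simplex_pull ph)
    also have "\<dots> = pull N m k \<alpha> (\<psi> k z)"
    proof (cases "\<forall>t\<le>k. \<tau> t = 0")
      case True
      then have "\<chi> (\<alpha> 0) = 0 \<or> (\<forall>t\<le>m. \<tau> (\<alpha> t) = 0)" using ord_maps_le[OF \<alpha>] by blast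
      moreover have "\<psi> k z = \<iota> k b" using True by (simp add: z \<psi>_def)
      ultimately show ?thesis by (simp only: if_True smap_pull[OF smap_iota \<alpha> b])
    next
      case False
      \<comment> \<open>Off the bottom the labels are constant, so the end is unchanged by pulling
        back. The pullback itself may still fall into the bottom, and \<open>restr\<close> covers
        that case.\<close>
      with z' have "\<chi> (\<alpha> 0) = \<chi> 0" using ord_maps_le[OF \<alpha>, of 0] by auto
      moreover have "h m (?\<tau>, restrict \<alpha> {..m}) = \<iota> m (pull L m k \<alpha> b)" if "\<forall>t\<le>m. \<tau> (\<alpha> t) = 0"
        by (rule restr[OF y \<tau>\<alpha> \<alpha>]) (simp add: that)
      ultimately show ?thesis using False by (auto simp: z \<psi>_def smap_pull[OF smap_iota \<alpha> b] hp)
    qed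
    finally show "\<psi> m (pull ((sprod ?B (std_simplex 1))\<lparr>simplices := cyl_sieve ?B A\<rparr>) m k \<alpha> z) = pull N m k \<alpha> (\<psi> k z)"
      by simp
  qed
  obtain W where W: "smap W (sprod ?B (std_simplex 1)) N"
    and W\<psi>: "\<And>k z. z \<in> cyl_sieve ?B A k \<Longrightarrow> W k z = \<psi> k z"
    using homotopy_extension[OF B N A \<psi>] by blast
  have const: "restrict (\<lambda>_. e) {..k} \<in> simplices codiscrete k" if "e = 0 \<or> e = 1" for e k
    using that by (auto simp: codiscrete_iff)
  have ends: "restrict (\<lambda>_. e) {..k} \<in> simplices (std_simplex 1) k" if "e = 0 \<or> e = 1" for e k
    using that by (auto intro!: restrict_std_simplex const_ord_maps)
  have W_const: "W k ((y, restrict (\<lambda>_. e) {..k}), \<tau>) = \<psi> k ((y, restrict (\<lambda>_. e) {..k}), \<tau>)"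
    if "e = 0 \<or> e = 1" "y \<in> simplices ?Y k" "\<tau> \<in> simplices (std_simplex 1) k" for e k y \<tau>
    by (rule W\<psi>) (use that const in \<open>auto simp: cyl_sieve_def sprod_iff A_def\<close>)
  have W1: "smap (\<lambda>n y. W n (y, restrict (\<lambda>_. 1) {..n})) ?B N"
  proof (rule smapI)
    fix k y assume "y \<in> simplices ?B k"
    then show "W k (y, restrict (\<lambda>_. 1) {..k}) \<in> simplices N k"
      using ends by (cases y) (auto simp: sprod_iff intro!: smap_closed[OF W])
  next
    fix m k \<alpha> y assume \<alpha>: "\<alpha> \<in> ord_maps m k" and y: "y \<in> simplices ?B k"
    have "restrict (restrict (\<lambda>_. 1) {..k} \<circ> \<alpha>) {..m} = (restrict (\<lambda>_. 1) {..m} :: nat \<Rightarrow> nat)"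
      using ord_maps_le[OF \<alpha>] by (auto simp: fun_eq_iff)
    then show "W m (pull ?B m k \<alpha> y, restrict (\<lambda>_. 1) {..m}) = pull N m k \<alpha> (W k (y, restrict (\<lambda>_. 1) {..k}))"
      using smap_pull[OF W \<alpha>, of "(y, restrict (\<lambda>_. 1) {..k})"] y ends[of 1 k]
      by (cases y) (simp add: sprod_pull std_simplex_pull sprod_iff)
  qed
  have \<beta>: "smap (\<lambda>_ z. fst (fst z)) ?B L"
    by (rule smapI) (auto simp: sprod_def LN_comma_def comma_def fibre_prod_def)
  \<comment> \<open>The start in \<open>L\<close> is kept, and the new endpoint is where the
    extended path arrives at side 1.\<close>
  define G where "G n y = (fst (fst y), cyl_transpose ?B W n y, W n (y, restrict (\<lambda>_. 1) {..n}))" for n y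
  have G: "smap G ?B ?Y"
    unfolding G_def LN_comma_def[of S]
  proof (rule smap_into_comma[OF B W \<beta> W1, unfolded LN_comma_def])
    fix n y assume y: "y \<in> simplices (sprod (comma L \<iota> N (\<lambda>_. id) N) codiscrete) n"
    obtain b h c \<chi> where yx: "y = ((b, h, c), \<chi>)" by (cases y) auto
    have "(y, restrict (\<lambda>_. 0) {..n}) \<in> cyl_sieve ?B A n"
      using y ends[of 0 n] by (simp add: cyl_sieve_def LN_comma_def yx sprod_iff)
    from W\<psi>[OF this] show "W n (y, restrict (\<lambda>_. 0) {..n}) = \<iota> n (fst (fst y))"
      by (simp add: \<psi>_def yx)
  qed simp
  have trans: "cyl_transpose ?B W n (y, restrict (\<lambda>_. e) {..n}) k (\<tau>, \<sigma>) =
      \<psi> k ((pull ?Y k n \<sigma> y, restrict (\<lambda>_. e) {..k}), \<tau>)"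
    if e: "e = 0 \<or> e = 1" and y: "y \<in> simplices ?Y n" and \<tau>: "\<tau> \<in> simplices (std_simplex 1) k"
      and \<sigma>: "\<sigma> \<in> simplices (std_simplex n) k" for e n y k \<tau> \<sigma>
  proof -
    have \<sigma>': "\<sigma> \<in> ord_maps k n" using \<sigma> by (simp add: std_simplex_iff)
    have "restrict (restrict (\<lambda>_. e) {..n} \<circ> \<sigma>) {..k} = restrict (\<lambda>_. e) {..k}"
      using ord_maps_le[OF \<sigma>'] by (auto simp: fun_eq_iff)
    then show ?thesis
      using W_const[OF e Y.pull_closed[OF \<sigma>' y] \<tau>]
      by (simp add: cyl_transpose_apply[OF \<tau> \<sigma>] sprod_pull codiscrete_pull)
  qed
  have tr: "cyl_transpose ?B W n (y, restrict (\<lambda>_. e) {..n}) \<in> smaps (prism n) N"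
    if "e = 0 \<or> e = 1" "y \<in> simplices ?Y n" for e n y
    by (rule cyl_transpose_smaps[OF B W]) (use that const in \<open>simp add: sprod_iff\<close>)
  show ?thesis
  proof (rule that[OF G])
    fix n y assume y: "y \<in> simplices ?Y n"
    obtain b h c where yx: "y = (b, h, c)" by (cases y) auto
    have b: "b \<in> simplices L n" and h: "h \<in> smaps (prism n) N" and c: "h n (prism_end 1 n) = c"
      using y by (auto simp: yx LN_iff)
    have fst_y: "fst y = b" by (simp add: yx)
    have ct0: "cyl_transpose ?B W n (y, restrict (\<lambda>_. 0) {..n}) = cyl_transpose L (\<lambda>k z. \<iota> k (fst z)) n b"
    proof (rule smaps_eqI[OF tr[OF _ y] cyl_transpose_smaps[OF L.simplicial_set_axioms smap_const_cyl b]])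
      fix k z assume "z \<in> simplices (prism n) k"
      then obtain \<tau> \<sigma> where z: "z = (\<tau>, \<sigma>)" "\<tau> \<in> simplices (std_simplex 1) k" "\<sigma> \<in> simplices (std_simplex n) k"
        by (cases z) (auto simp: sprod_iff)
      have "cyl_transpose ?B W n (y, restrict (\<lambda>_. 0) {..n}) k (\<tau>, \<sigma>) =
          \<psi> k ((pull ?Y k n \<sigma> y, restrict (\<lambda>_. 0) {..k}), \<tau>)"
        by (rule trans[OF _ y z(2,3)]) simp
      also have "\<dots> = \<iota> k (pull L k n \<sigma> b)" by (simp add: \<psi>_def yx LN_pull)
      finally show "cyl_transpose ?B W n (y, restrict (\<lambda>_. 0) {..n}) k z = cyl_transpose L (\<lambda>k z. \<iota> k (fst z)) n b k z"
        by (simp add: z(1) cyl_transpose_apply[OF z(2,3), of L])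
    qed simp
    have "W n ((y, restrict (\<lambda>_. 0) {..n}), restrict (\<lambda>_. 1) {..n}) =
        \<psi> n ((y, restrict (\<lambda>_. 0) {..n}), restrict (\<lambda>_. 1) {..n})"
      by (rule W_const[OF _ y ends]) simp_all
    also have "\<dots> = \<iota> n b" by (simp add: \<psi>_def yx)
    finally show "G n (y, restrict (\<lambda>_. 0) {..n}) = const_paths n (fst y)"
      by (simp add: G_def const_paths_def fst_y ct0)
    have ct1: "cyl_transpose ?B W n (y, restrict (\<lambda>_. 1) {..n}) = h"
    proof (rule smaps_eqI[OF tr[OF _ y] h])
      fix k z assume "z \<in> simplices (prism n) k"
      then obtain \<tau> \<sigma> where z: "z = (\<tau>, \<sigma>)" "\<tau> \<in> simplices (std_simplex 1) k" "\<sigma> \<in> simplices (std_simplex n) k"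
        by (cases z) (auto simp: sprod_iff)
      have \<sigma>: "\<sigma> \<in> ord_maps k n" "restrict \<sigma> {..k} = \<sigma>"
        using z(3) by (auto simp: std_simplex_iff intro: extensional_restrict)
      have id: "restrict id {..k} \<in> simplices (std_simplex k) k"
        by (intro restrict_std_simplex id_ord_maps order_refl)
      have "restrict (\<sigma> \<circ> restrict id {..k}) {..k} = restrict \<sigma> {..k}" by (auto simp: fun_eq_iff)
      then have hp: "pull (map_space (std_simplex 1) N) k n \<sigma> h k (\<tau>, restrict id {..k}) = h k (\<tau>, \<sigma>)"
        by (simp only: map_space_pull_apply[OF z(2) id] \<sigma>(2))
      have "cyl_transpose ?B W n (y, restrict (\<lambda>_. 1) {..n}) k (\<tau>, \<sigma>) =
          \<psi> k ((pull ?Y k n \<sigma> y, restrict (\<lambda>_. 1) {..k}), \<tau>)"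
        by (rule trans[OF _ y z(2,3)]) simp
      also have "\<dots> = (if \<forall>t\<le>k. \<tau> t = 0 then \<iota> k (pull L k n \<sigma> b) else h k (\<tau>, \<sigma>))"
        by (auto simp: \<psi>_def yx LN_pull hp)
      also have "\<dots> = h k (\<tau>, \<sigma>)"
        using restr[OF y[unfolded yx] z(2) \<sigma>(1)] unfolding \<sigma>(2) by metis
      finally show "cyl_transpose ?B W n (y, restrict (\<lambda>_. 1) {..n}) k z = h k z"
        by (simp only: z(1))
    qed simp
    have "W n ((y, restrict (\<lambda>_. 1) {..n}), restrict (\<lambda>_. 1) {..n}) =
        \<psi> n ((y, restrict (\<lambda>_. 1) {..n}), restrict (\<lambda>_. 1) {..n})"
      by (rule W_const[OF _ y ends]) simp_all
    also have "\<dots> = c" using c by (auto simp: \<psi>_def yx)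
    finally show "G n (y, restrict (\<lambda>_. 1) {..n}) = y"
      by (simp add: G_def ct1 fst_y) (simp add: yx)
  qed
qed

text \<open>The inverse sends an exit path to the start of its (L, N)-path. Starting points of
  constant paths are strictly recovered, so one homotopy is a projection; the other is the
  contraction transported along \<open>exit_map\<close>.\<close>

lemma Box_equivalence:
  assumes N: "kan_complex N"
  shows "equivalence (Box S) L (MN_comma S)"
proof -
  define inv where "inv k = the_inv_into (simplices (LN_comma S) k) (exit_map k)" for k
  note inverse = siso_inverse[OF siso_exit_map simplicial_set_LN, folded inv_def]
  have inv: "smap inv (MN_comma S) (LN_comma S)"
    using inverse(1) by (simp add: siso_def inv_def[abs_def])
  obtain G where G: "smap G (sprod (LN_comma S) codiscrete) (LN_comma S)"
    "\<And>n y. y \<in> simplices (LN_comma S) n \<Longrightarrow> G n (y, restrict (\<lambda>_. 0) {..n}) = const_paths n (fst y)"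
    "\<And>n y. y \<in> simplices (LN_comma S) n \<Longrightarrow> G n (y, restrict (\<lambda>_. 1) {..n}) = y"
    using path_contraction[OF N] by blast
  have fst: "smap (\<lambda>_. fst) (LN_comma S) L"
    by (rule smapI) (auto simp: LN_comma_def comma_def fibre_prod_def sprod_def)
  have "smap (\<lambda>k z. (inv k (fst z), snd z)) (sprod (MN_comma S) codiscrete) (sprod (LN_comma S) codiscrete)"
    by (rule smapI) (auto simp: sprod_iff sprod_pull smap_closed[OF inv] smap_pull[OF inv])
  moreover have "smap exit_map (LN_comma S) (MN_comma S)" using siso_exit_map by (simp add: siso_def)
  ultimately have H: "smap (\<lambda>k. exit_map k \<circ> (G k \<circ> (\<lambda>z. (inv k (fst z), snd z)))) (sprod (MN_comma S) codiscrete) (MN_comma S)"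
    by (intro smap_comp[OF smap_comp[OF _ G(1)]])
  let ?H = "\<lambda>k. exit_map k \<circ> (G k \<circ> (\<lambda>z. (inv k (fst z), snd z)))"
  have F0: "fst (b, restrict (\<lambda>_. 0 :: nat) {..k}) = (fst \<circ> inv k) (Box S k b)" if b: "b \<in> simplices L k" for k b
    using inverse(2)[OF smap_closed[OF smap_const_paths b]] by (simp add: Box_eq[OF b]) (simp add: const_paths_def)
  have H0: "?H k (y, restrict (\<lambda>_. 0) {..k}) = Box S k ((fst \<circ> inv k) y)" if y: "y \<in> simplices (MN_comma S) k" for k y
  proof -
    have y': "inv k y \<in> simplices (LN_comma S) k" by (rule smap_closed[OF inv y])
    have "fst (inv k y) \<in> simplices L k" by (rule smap_closed[OF fst y'])
    then show ?thesis by (simp add: G(2)[OF y'] Box_eq)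
  qed
  have H1: "?H k (y, restrict (\<lambda>_. 1) {..k}) = y" if y: "y \<in> simplices (MN_comma S) k" for k y
    by (simp only: comp_apply fst_conv snd_conv G(3)[OF smap_closed[OF inv y]] inverse(3)[OF y])
  have "smap (Box S) L (MN_comma S)" using smono_Box by (simp add: smono_def)
  show ?thesis
    by (rule equivalenceI[where F = "\<lambda>_. fst" and G = ?H, OF L.simplicial_set_axioms simplicial_set_MN
          \<open>smap (Box S) L (MN_comma S)\<close> smap_comp[OF inv fst] smap_fst F0 fst_conv H H0 H1])
qed

end

theorem mainTheorem5:
  fixes S :: "('m, 'l, 'n) sspan"
  assumes "linked_category S"
  shows
    "simplices (ExitCat S) 0 = In_M ` simplices (M_of S) 0 \<union> In_N ` simplices (N_of S) 0
     \<and> full_subcategory (\<lambda>_. In_M) (M_of S) (ExitCat S)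
     \<and> full_subcategory (\<lambda>_. In_N) (N_of S) (ExitCat S)
     \<and> \<not> (\<exists>e \<in> simplices (ExitCat S) 1. vertex (ExitCat S) 1 0 e \<in> In_N ` simplices (N_of S) 0
                                 \<and> vertex (ExitCat S) 1 1 e \<in> In_M ` simplices (M_of S) 0)
     \<and> (\<forall>p \<in> simplices (M_of S) 0. \<forall>q \<in> simplices (N_of S) 0.
          \<exists>f. equivalence f (hom_space (ExitCat S) (In_M p) (In_N q)) (fibre_paths S p q))
     \<and> (\<exists>f. siso f (MN_comma S) (LN_comma S))
     \<and> (smono (Box S) (L_of S) (MN_comma S)
        \<and> (\<forall>n. \<forall>b \<in> simplices (L_of S) n. \<exists>!h. constant_exit_loop S n b h))
     \<and> (linked_groupoid S \<longrightarrow> equivalence (Box S) (L_of S) (MN_comma S))"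
proof -
  interpret linked S by unfold_locales (rule assms)
  have "\<exists>f. siso f (MN_comma S) (LN_comma S)"
    using siso_inverse(1)[OF siso_exit_map simplicial_set_LN] by blast
  moreover have "linked_groupoid S \<longrightarrow> equivalence (Box S) (L_of S) (MN_comma S)"
    using Box_equivalence by (simp add: linked_groupoid_def)
  ultimately show ?thesis
    by (intro conjI objects full_M full_N no_morphism_N_to_M ballI hom_space_equivalence smono_Box
        allI constant_exit_loop_unique)
qed

end
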